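(* Let $(M,g)$ and $(N,\eta)$ be Riemannian manifolds of dimension greater than $1$. Then $(M,g)$ and $(N,\eta)$ have the same curvature radii if and only if they are homothetic.
   Context: For a regular curve $\gamma$ (i.e. $\dot\gamma\neq0$ everywhere) in a Riemannian manifold $(M,g)$, let $D_t$ be the Levi-Civita covariant derivative along $\gamma$ and $\pi_{\dot\gamma^\perp}$ the orthogonal projection onto $\{\dot\gamma(t)\}^\perp$. The geodesic curvature is $\kappa_g(\gamma)=|\pi_{\dot\gamma^\perp}(D_t\dot\gamma)|/|\dot\gamma|^2$, and if it never vanishes the radius of curvature is the vector field along $\gamma$ $$R_g(\gamma)=\frac{1}{\kappa_g(\gamma)}\frac{\pi_{\dot\gamma^\perp}(D_t\dot\gamma)}{|\pi_{\dot\gamma^\perp}(D_t\dot\gamma)|}.$$ This defines a map $$R_g:\{\gamma\in\mathcal C^2([0,1],M):\gamma\text{ regular},\ \kappa_g(\gamma)\text{ never vanishing}\}\to\mathcal C^0([0,1],TM),\quad\gamma\mapsto R_g(\gamma).$$ $(M,g)$ and $(N,\eta)$ are said to have the same curvature radii if there exists a diffeomorphism $\varphi:M\to N$ such that $R_\eta\circ\varphi=\varphi_\star\circ R_g$, as an equality of maps: $\gamma\mapsto\varphi\circ\gamma$ maps the domain of $R_g$ onto the domain of $R_\eta$, and $R_\eta(\varphi\circ\gamma)=\varphi_\star R_g(\gamma)$ for every $\gamma$ in the domain of $R_g$. $(M,g)$ and $(N,\eta)$ are homothetic if there exist a diffeomorphism $\varphi:M\to N$ and a constant $\lambda>0$ such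 that $\varphi^\star\eta=\lambda g$.
   Formalization: Both manifolds are assumed connected; without this the claim fails, e.g. for two unit 2-spheres versus a unit 2-sphere and a 2-sphere of radius 2 (disjoint unions), which have the same curvature radii but are not homothetic. *)

theory Defs
  imports "HOL-Analysis.Analysis"
begin

section \<open>Smooth maps between open subsets of Euclidean spaces\<close>

text \<open>On an open subset of a finite-dimensional space, \<open>f\<close> is of class \<open>C\<^sup>k\<^sup>+\<^sup>1\<close> iff it is
  differentiable and all its directional derivatives are of class \<open>C\<^sup>k\<close>.\<close>

fun Ck_on :: "nat \<Rightarrow> 'a::euclidean_space set \<Rightarrow> ('a \<Rightarrow> 'b::real_normed_vector) \<Rightarrow> bool" where
  "Ck_on 0 S f \<longleftrightarrow> continuous_on S f"
| "Ck_on (Suc k) S f \<longleftrightarrow>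
     (\<forall>x\<in>S. f differentiable (at x)) \<and> (\<forall>v. Ck_on k S (\<lambda>x. frechet_derivative f (at x) v))"

definition smooth_on :: "'a::euclidean_space set \<Rightarrow> ('a \<Rightarrow> 'b::real_normed_vector) \<Rightarrow> bool" where
  "smooth_on S f \<longleftrightarrow> (\<forall>k. Ck_on k S f)"

section \<open>Smooth manifolds\<close>

text \<open>A chart \<open>(U, x)\<close> consists of its domain and its coordinate map; the values of \<open>x\<close> outside \<open>U\<close>
  are irrelevant. The dimension of a manifold modelled on \<open>'e\<close> is \<open>DIM('e)\<close>. The atlas need not
  be maximal: a smooth structure is given by any smooth atlas.\<close>

type_synonym ('m, 'e) chart = "'m set \<times> ('m \<Rightarrow> 'e)"

record ('m, 'e) manifold =
  mtop :: "'m topology"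
  atlas :: "('m, 'e) chart set"

definition chart_inv :: "('m, 'e) chart \<Rightarrow> 'e \<Rightarrow> 'm" where
  "chart_inv c = inv_into (fst c) (snd c)"

definition is_chart :: "'m topology \<Rightarrow> ('m, 'e::euclidean_space) chart \<Rightarrow> bool" where
  "is_chart X c \<longleftrightarrow> openin X (fst c) \<and> open (snd c ` fst c) \<and>
     homeomorphic_map (subtopology X (fst c)) (top_of_set (snd c ` fst c)) (snd c)"

definition second_countable :: "'m topology \<Rightarrow> bool" where
  "second_countable X \<longleftrightarrow> (\<exists>\<B>. countable \<B> \<and> (\<forall>V\<in>\<B>. openin X V) \<and>
     (\<forall>U p. openin X U \<and> p \<in> U \<longrightarrow> (\<exists>V\<in>\<B>. p \<in> V \<and> V \<subseteq> U)))"

definition smooth_manifold :: "('m, 'e::euclidean_space) manifold \<Rightarrow> bool" where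
  "smooth_manifold M \<longleftrightarrow>
     Hausdorff_space (mtop M) \<and> second_countable (mtop M) \<and>
     (\<forall>c\<in>atlas M. is_chart (mtop M) c) \<and>
     (\<Union>c\<in>atlas M. fst c) = topspace (mtop M) \<and>
     (\<forall>c\<in>atlas M. \<forall>d\<in>atlas M. smooth_on (snd c ` (fst c \<inter> fst d)) (snd d \<circ> chart_inv c))"

definition charts_at :: "('m, 'e) manifold \<Rightarrow> 'm \<Rightarrow> ('m, 'e) chart set" where
  "charts_at M p = {c \<in> atlas M. p \<in> fst c}"

definition smooth_map ::
  "('m, 'e::euclidean_space) manifold \<Rightarrow> ('n, 'f::euclidean_space) manifold \<Rightarrow> ('m \<Rightarrow> 'n) \<Rightarrow> bool"
where
  "smooth_map M N \<phi> \<longleftrightarrow> continuous_map (mtop M) (mtop N) \<phi> \<and>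
     (\<forall>c\<in>atlas M. \<forall>d\<in>atlas N.
        smooth_on (snd c ` {p \<in> fst c. \<phi> p \<in> fst d}) (snd d \<circ> \<phi> \<circ> chart_inv c))"

definition diffeomorphism ::
  "('m, 'e::euclidean_space) manifold \<Rightarrow> ('n, 'f::euclidean_space) manifold \<Rightarrow> ('m \<Rightarrow> 'n) \<Rightarrow> bool"
where
  "diffeomorphism M N \<phi> \<longleftrightarrow> bij_betw \<phi> (topspace (mtop M)) (topspace (mtop N)) \<and>
     smooth_map M N \<phi> \<and> smooth_map N M (inv_into (topspace (mtop M)) \<phi>)"

section \<open>Tangent vectors\<close>

text \<open>A tangent vector at \<open>p\<close> is a class of pairs (chart at \<open>p\<close>, coordinate vector) under the
  identification of \<open>(c, a)\<close> and \<open>(d, b)\<close> when \<open>b\<close> is the image of \<open>a\<close> under the derivative of the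
  change of coordinates. Such a class is the graph of a function from the charts at \<open>p\<close> to \<open>'e\<close>;
  we extend this function by \<open>0\<close>. The vector space operations are pointwise.\<close>

type_synonym ('m, 'e) tvec = "('m, 'e) chart \<Rightarrow> 'e"

definition tangent_space ::
  "('m, 'e::euclidean_space) manifold \<Rightarrow> 'm \<Rightarrow> ('m, 'e) tvec set" where
  "tangent_space M p = {v. (\<forall>c. c \<notin> charts_at M p \<longrightarrow> v c = 0) \<and>
     (\<forall>c\<in>charts_at M p. \<forall>d\<in>charts_at M p.
        v d = frechet_derivative (snd d \<circ> chart_inv c) (at (snd c p)) (v c))}"

text \<open>The tangent vector \<open>\<Sum>i. a\<^sup>i \<partial>\<^sub>i\<close> at \<open>p\<close>, where \<open>\<partial>\<^sub>i\<close> are the coordinate vectors of the chart \<open>c\<close>.\<close>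

definition coord_vec ::
  "('m, 'e::euclidean_space) manifold \<Rightarrow> ('m, 'e) chart \<Rightarrow> 'm \<Rightarrow> 'e \<Rightarrow> ('m, 'e) tvec" where
  "coord_vec M c p a = (\<lambda>d. if d \<in> charts_at M p
     then frechet_derivative (snd d \<circ> chart_inv c) (at (snd c p)) a else 0)"

text \<open>The differential \<open>T\<^sub>pM \<rightarrow> T\<^bsub>\<phi> p\<^esub>N\<close> of a smooth map \<open>\<phi>\<close>. On tangent vectors the result does not
  depend on the chart \<open>c\<close> that is chosen at \<open>p\<close>.\<close>

definition pushforward ::
  "('m, 'e::euclidean_space) manifold \<Rightarrow> ('n, 'f::euclidean_space) manifold \<Rightarrow> ('m \<Rightarrow> 'n) \<Rightarrow> 'm
     \<Rightarrow> ('m, 'e) tvec \<Rightarrow> ('n, 'f) tvec" where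
  "pushforward M N \<phi> p v = (let c = (SOME c. c \<in> charts_at M p) in
     (\<lambda>d. if d \<in> charts_at N (\<phi> p)
       then frechet_derivative (snd d \<circ> \<phi> \<circ> chart_inv c) (at (snd c p)) (v c) else 0))"

section \<open>Riemannian metrics\<close>

text \<open>A metric is a family of inner products \<open>g p\<close> on the tangent spaces; the values of \<open>g p\<close> outside
  the tangent space at \<open>p\<close> are irrelevant.\<close>

type_synonym ('m, 'e) metric = "'m \<Rightarrow> ('m, 'e) tvec \<Rightarrow> ('m, 'e) tvec \<Rightarrow> real"

text \<open>The coordinate expression \<open>\<Sum>i j. g\<^sub>i\<^sub>j(x) a\<^sup>i b\<^sup>j\<close> of \<open>g\<close> in the chart \<open>c\<close>.\<close>

definition metric_coord ::
  "('m, 'e::euclidean_space) manifold \<Rightarrow> ('m, 'e) metric \<Rightarrow> ('m, 'e) chart \<Rightarrow> 'e \<Rightarrow> 'e \<Rightarrow> 'e \<Rightarrow> real"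
where
  "metric_coord M g c x a b =
     g (chart_inv c x) (coord_vec M c (chart_inv c x) a) (coord_vec M c (chart_inv c x) b)"

definition riemannian_metric ::
  "('m, 'e::euclidean_space) manifold \<Rightarrow> ('m, 'e) metric \<Rightarrow> bool" where
  "riemannian_metric M g \<longleftrightarrow>
     (\<forall>p\<in>topspace (mtop M).
        (\<forall>u\<in>tangent_space M p. \<forall>v\<in>tangent_space M p. g p u v = g p v u) \<and>
        (\<forall>u\<in>tangent_space M p. \<forall>v\<in>tangent_space M p. \<forall>w\<in>tangent_space M p. \<forall>r s.
           g p (\<lambda>c. r *\<^sub>R u c + s *\<^sub>R v c) w = r * g p u w + s * g p v w) \<and>
        (\<forall>u\<in>tangent_space M p. u \<noteq> (\<lambda>_. 0) \<longrightarrow> g p u u > 0)) \<and>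
     (\<forall>c\<in>atlas M. \<forall>a b. smooth_on (snd c ` fst c) (\<lambda>x. metric_coord M g c x a b))"

definition riemannian_manifold ::
  "('m, 'e::euclidean_space) manifold \<Rightarrow> ('m, 'e) metric \<Rightarrow> bool" where
  "riemannian_manifold M g \<longleftrightarrow> smooth_manifold M \<and> riemannian_metric M g"

definition tnorm :: "('m, 'e) metric \<Rightarrow> 'm \<Rightarrow> ('m, 'e) tvec \<Rightarrow> real" where
  "tnorm g p v = sqrt (g p v v)"

text \<open>Orthogonal projection of \<open>w\<close> onto the orthogonal complement of \<open>v \<noteq> 0\<close>.\<close>

definition perp_proj ::
  "('m, 'e::euclidean_space) metric \<Rightarrow> 'm \<Rightarrow> ('m, 'e) tvec \<Rightarrow> ('m, 'e) tvec \<Rightarrow> ('m, 'e) tvec" where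
  "perp_proj g p v w = (\<lambda>c. w c - (g p w v / g p v v) *\<^sub>R v c)"

section \<open>The Levi-Civita connection\<close>

text \<open>In a chart \<open>c\<close>, a connection is given at the point with coordinates \<open>x\<close> by a bilinear map \<open>\<Gamma>\<close>,
  with \<open>\<nabla>\<^sub>w u = D\<^sub>w u + \<Gamma> w u\<close> (so that \<open>\<Gamma> w u = \<nabla>\<^sub>w u\<close> for constant coordinate fields). It is
  torsion-free iff every such \<open>\<Gamma>\<close> is symmetric, and compatible with \<open>g\<close> iff
  \<open>D\<^sub>w (g(u, v)) = g(\<nabla>\<^sub>w u, v) + g(u, \<nabla>\<^sub>w v)\<close> for all constant coordinate fields \<open>u\<close>, \<open>v\<close>.\<close>

definition is_levi_civita ::
  "('m, 'e::euclidean_space) manifold \<Rightarrow> ('m, 'e) metric \<Rightarrow> ('m, 'e) chart \<Rightarrow> 'e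
     \<Rightarrow> ('e \<Rightarrow> 'e \<Rightarrow> 'e) \<Rightarrow> bool" where
  "is_levi_civita M g c x \<Gamma> \<longleftrightarrow> bilinear \<Gamma> \<and> (\<forall>u v. \<Gamma> u v = \<Gamma> v u) \<and>
     (\<forall>u v w. frechet_derivative (\<lambda>y. metric_coord M g c y u v) (at x) w =
        metric_coord M g c x (\<Gamma> w u) v + metric_coord M g c x u (\<Gamma> w v))"

text \<open>The fundamental theorem of Riemannian geometry (\<open>levi_civita_ex1\<close> below): there is exactly one
  such \<open>\<Gamma>\<close> at every point of a chart image, so that \<open>christoffel\<close> is well defined.\<close>

lemma smooth_on_differentiable:
  assumes "smooth_on S f" "x \<in> S" shows "f differentiable (at x)"
proof -
  have "Ck_on (Suc 0) S f" using assms(1) unfolding smooth_on_def by (rule spec)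
  then show ?thesis using assms(2) by simp
qed

lemma chart_inv_simps:
  assumes "is_chart X c"
  shows "p \<in> fst c \<Longrightarrow> chart_inv c (snd c p) = p"
    and "x \<in> snd c ` fst c \<Longrightarrow> chart_inv c x \<in> fst c"
    and "x \<in> snd c ` fst c \<Longrightarrow> snd c (chart_inv c x) = x"
proof -
  have "fst c \<subseteq> topspace X" using assms openin_subset unfolding is_chart_def by blast
  then have inj: "inj_on (snd c) (fst c)"
    using assms homeomorphic_imp_injective_map[of "subtopology X (fst c)" "top_of_set (snd c ` fst c)" "snd c"]
    unfolding is_chart_def by (simp add: Int_absorb1)
  show "p \<in> fst c \<Longrightarrow> chart_inv c (snd c p) = p"
    unfolding chart_inv_def using inj by simp
  show "x \<in> snd c ` fst c \<Longrightarrow> chart_inv c x \<in> fst c"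
    unfolding chart_inv_def by (rule inv_into_into)
  show "x \<in> snd c ` fst c \<Longrightarrow> snd c (chart_inv c x) = x"
    unfolding chart_inv_def by (rule f_inv_into_f)
qed

lemma open_chart_image:
  assumes "is_chart X c" "openin X V"
  shows "open (snd c ` (fst c \<inter> V))"
proof -
  have sub: "fst c \<subseteq> topspace X" using assms(1) openin_subset unfolding is_chart_def by blast
  have "open_map (subtopology X (fst c)) (top_of_set (snd c ` fst c)) (snd c)"
    using assms(1) unfolding is_chart_def by (intro homeomorphic_imp_open_map) simp
  moreover have "openin (subtopology X (fst c)) (fst c \<inter> V)"
    using openin_subtopology_Int[OF assms(2), of "fst c"] by (simp add: Int_commute)
  ultimately have "openin (top_of_set (snd c ` fst c)) (snd c ` (fst c \<inter> V))"
    unfolding open_map_def by blast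
  moreover have "open (snd c ` fst c)" using assms(1) unfolding is_chart_def by blast
  ultimately show ?thesis by (rule openin_open_trans)
qed

context
  fixes M :: "('m, 'e::euclidean_space) manifold"
  assumes M: "smooth_manifold M"
begin

lemma atlas_chart: "c \<in> atlas M \<Longrightarrow> is_chart (mtop M) c"
  using M unfolding smooth_manifold_def by blast

lemma transition_differentiable:
  assumes "c \<in> charts_at M p" "d \<in> charts_at M p"
  shows "(snd d \<circ> chart_inv c) differentiable (at (snd c p))"
  using M assms unfolding smooth_manifold_def charts_at_def
  by (intro smooth_on_differentiable[where S="snd c ` (fst c \<inter> fst d)"]) auto

lemma transition_cocycle:
  assumes "c \<in> charts_at M p" "d \<in> charts_at M p" "e \<in> charts_at M p"
  shows "frechet_derivative (snd e \<circ> chart_inv c) (at (snd c p)) a =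
    frechet_derivative (snd e \<circ> chart_inv d) (at (snd d p))
      (frechet_derivative (snd d \<circ> chart_inv c) (at (snd c p)) a)"
proof -
  have ch: "is_chart (mtop M) c" "is_chart (mtop M) d" 
    using assms atlas_chart by (auto simp: charts_at_def)
  have p: "p \<in> fst c" "p \<in> fst d" using assms by (auto simp: charts_at_def)
  let ?S = "snd c ` (fst c \<inter> fst d)"
  have op: "open ?S" using open_chart_image[OF ch(1)] ch(2) is_chart_def by blast
  have eq: "(snd d \<circ> chart_inv c) (snd c p) = snd d p"
    using p chart_inv_simps(1)[OF ch(1)] by simp
  have 1: "((snd d \<circ> chart_inv c) has_derivative
      frechet_derivative (snd d \<circ> chart_inv c) (at (snd c p))) (at (snd c p))"
    using transition_differentiable[OF assms(1,2)] frechet_derivative_works by blast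
  have 2: "((snd e \<circ> chart_inv d) has_derivative
      frechet_derivative (snd e \<circ> chart_inv d) (at (snd d p))) (at ((snd d \<circ> chart_inv c) (snd c p)))"
    unfolding eq using transition_differentiable[OF assms(2,3)] frechet_derivative_works by blast
  have 3: "((snd e \<circ> chart_inv d) \<circ> (snd d \<circ> chart_inv c) has_derivative
      frechet_derivative (snd e \<circ> chart_inv d) (at (snd d p)) \<circ>
      frechet_derivative (snd d \<circ> chart_inv c) (at (snd c p))) (at (snd c p))"
    by (rule diff_chain_at[OF 1 2])
  have "((snd e \<circ> chart_inv c) has_derivative
      frechet_derivative (snd e \<circ> chart_inv d) (at (snd d p)) \<circ>
      frechet_derivative (snd d \<circ> chart_inv c) (at (snd c p))) (at (snd c p))"
  proof (rule has_derivative_transform_within_open[OF 3 op])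
    show "snd c p \<in> ?S" using p by blast
    fix x assume "x \<in> ?S"
    then obtain q where "q \<in> fst c" "q \<in> fst d" "x = snd c q" by blast
    then show "(snd e \<circ> chart_inv d \<circ> (snd d \<circ> chart_inv c)) x = (snd e \<circ> chart_inv c) x"
      using chart_inv_simps(1)[OF ch(1)] chart_inv_simps(1)[OF ch(2)] by simp
  qed
  from frechet_derivative_at[OF this, symmetric] show ?thesis by simp
qed

lemma transition_self:
  assumes "c \<in> charts_at M p"
  shows "frechet_derivative (snd c \<circ> chart_inv c) (at (snd c p)) a = a"
proof -
  have ch: "is_chart (mtop M) c" and p: "p \<in> fst c" 
    using assms atlas_chart by (auto simp: charts_at_def)
  have op: "open (snd c ` fst c)" using ch is_chart_def by blast
  have "((snd c \<circ> chart_inv c) has_derivative (\<lambda>x. x)) (at (snd c p))"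
    by (rule has_derivative_transform_within_open[OF has_derivative_ident op])
       (use p chart_inv_simps(3)[OF ch] in auto)
  from frechet_derivative_at[OF this, symmetric] show ?thesis by simp
qed

lemma coord_vec_tangent:
  assumes "c \<in> charts_at M p"
  shows "coord_vec M c p a \<in> tangent_space M p"
proof -
  have "coord_vec M c p a e = frechet_derivative (snd e \<circ> chart_inv d) (at (snd d p)) (coord_vec M c p a d)"
    if "d \<in> charts_at M p" "e \<in> charts_at M p" for d e
    using that transition_cocycle[OF assms that, of a] unfolding coord_vec_def by presburger
  moreover have "coord_vec M c p a d = 0" if "d \<notin> charts_at M p" for d
    using that by (simp add: coord_vec_def)
  ultimately show ?thesis unfolding tangent_space_def by blast
qed

lemma tangent_eq_coord_vec:
  assumes "c \<in> charts_at M p" "v \<in> tangent_space M p"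
  shows "v = coord_vec M c p (v c)"
proof
  fix d
  show "v d = coord_vec M c p (v c) d"
  proof (cases "d \<in> charts_at M p")
    case True
    then have "v d = frechet_derivative (snd d \<circ> chart_inv c) (at (snd c p)) (v c)"
      using assms unfolding tangent_space_def by blast
    then show ?thesis unfolding coord_vec_def by (simp only: True if_True)
  next
    case False
    then have "v d = 0" using assms(2) unfolding tangent_space_def by blast
    then show ?thesis using False by (simp add: coord_vec_def)
  qed
qed

lemma coord_vec_self:
  assumes "c \<in> charts_at M p" shows "coord_vec M c p a c = a"
  using transition_self[OF assms] assms by (simp add: coord_vec_def)

lemma coord_vec_linear:
  assumes "c \<in> charts_at M p"
  shows "coord_vec M c p (r *\<^sub>R a + s *\<^sub>R b) =
    (\<lambda>d. r *\<^sub>R coord_vec M c p a d + s *\<^sub>R coord_vec M c p b d)"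
proof
  fix d
  show "coord_vec M c p (r *\<^sub>R a + s *\<^sub>R b) d =
    r *\<^sub>R coord_vec M c p a d + s *\<^sub>R coord_vec M c p b d"
  proof (cases "d \<in> charts_at M p")
    case True
    then have "linear (frechet_derivative (snd d \<circ> chart_inv c) (at (snd c p)))"
      using linear_frechet_derivative transition_differentiable[OF assms] by blast
    then show ?thesis using True by (simp add: coord_vec_def linear_add linear_scale)
  qed (simp add: coord_vec_def)
qed

context
  fixes g :: "('m, 'e) metric" and c :: "('m, 'e) chart"
  assumes g: "riemannian_metric M g" and c: "c \<in> atlas M"
begin

context
  fixes x assumes x: "x \<in> snd c ` fst c"
begin

lemma chart_point:
  "c \<in> charts_at M (chart_inv c x)" "chart_inv c x \<in> topspace (mtop M)"
  using chart_inv_simps(2)[OF atlas_chart[OF c] x] c atlas_chart[OF c]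
  by (auto simp: charts_at_def is_chart_def dest: openin_subset)

lemma metric_coord_sym: "metric_coord M g c x a b = metric_coord M g c x b a"
  using g chart_point coord_vec_tangent[OF chart_point(1)]
  unfolding riemannian_metric_def metric_coord_def by blast

lemma metric_coord_lin: "metric_coord M g c x (r *\<^sub>R a + s *\<^sub>R b) d = r * metric_coord M g c x a d + s * metric_coord M g c x b d"
  using g chart_point coord_vec_tangent[OF chart_point(1)]
  unfolding riemannian_metric_def metric_coord_def coord_vec_linear[OF chart_point(1)] by blast

lemma metric_coord_pos: assumes "a \<noteq> 0" shows "metric_coord M g c x a a > 0"
proof -
  have "coord_vec M c (chart_inv c x) a \<noteq> (\<lambda>_. 0)"
    using coord_vec_self[OF chart_point(1), of a] assms by auto
  then show ?thesis using g chart_point coord_vec_tangent[OF chart_point(1)]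
    unfolding riemannian_metric_def metric_coord_def by blast
qed

lemma metric_coord_bilinear: "bilinear (metric_coord M g c x)"
  unfolding bilinear_def
proof (intro conjI allI)
  show "linear (\<lambda>b. metric_coord M g c x a b)" for a
  proof (rule linearI)
    show "metric_coord M g c x a (b1 + b2) = metric_coord M g c x a b1 + metric_coord M g c x a b2" for b1 b2
      using metric_coord_lin[of 1 b1 1 b2 a] metric_coord_sym by simp
    show "metric_coord M g c x a (r *\<^sub>R b) = r *\<^sub>R metric_coord M g c x a b" for r b
      using metric_coord_lin[of r b 0 b a] metric_coord_sym by simp
  qed
  show "linear (\<lambda>a. metric_coord M g c x a b)" for b
  proof (rule linearI)
    show "metric_coord M g c x (a1 + a2) b = metric_coord M g c x a1 b + metric_coord M g c x a2 b" for a1 a2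
      using metric_coord_lin[of 1 a1 1 a2 b] by simp
    show "metric_coord M g c x (r *\<^sub>R a) b = r *\<^sub>R metric_coord M g c x a b" for r a
      using metric_coord_lin[of r a 0 a b] by simp
  qed
qed

lemma metric_coord_deriv: "((\<lambda>y. metric_coord M g c y u v) has_derivative (\<lambda>w. frechet_derivative (\<lambda>y. metric_coord M g c y u v) (at x) w)) (at x)"
proof -
  have "(\<lambda>y. metric_coord M g c y u v) differentiable (at x)"
    using g c x smooth_on_differentiable unfolding riemannian_metric_def by blast
  then show ?thesis using frechet_derivative_works by blast
qed

lemma metric_coord_deriv_linear: "linear (\<lambda>w. frechet_derivative (\<lambda>y. metric_coord M g c y u v) (at x) w)"
  using metric_coord_deriv has_derivative_linear by blast

end

lemma metric_coord_deriv_args: 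
  assumes x: "x \<in> snd c ` fst c"
  shows "frechet_derivative (\<lambda>y. metric_coord M g c y (r *\<^sub>R a + s *\<^sub>R b) v) (at x) w = r * frechet_derivative (\<lambda>y. metric_coord M g c y a v) (at x) w + s * frechet_derivative (\<lambda>y. metric_coord M g c y b v) (at x) w"
    and "frechet_derivative (\<lambda>y. metric_coord M g c y a b) (at x) w = frechet_derivative (\<lambda>y. metric_coord M g c y b a) (at x) w"
proof -
  have op: "open (snd c ` fst c)" using atlas_chart[OF c] is_chart_def by blast
  have 1: "((\<lambda>y. r * metric_coord M g c y a v + s * metric_coord M g c y b v) has_derivative
     (\<lambda>w. r * frechet_derivative (\<lambda>y. metric_coord M g c y a v) (at x) w + s * frechet_derivative (\<lambda>y. metric_coord M g c y b v) (at x) w)) (at x)"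
    by (intro has_derivative_add has_derivative_mult_right metric_coord_deriv[OF x])
  have "((\<lambda>y. metric_coord M g c y (r *\<^sub>R a + s *\<^sub>R b) v) has_derivative
     (\<lambda>w. r * frechet_derivative (\<lambda>y. metric_coord M g c y a v) (at x) w + s * frechet_derivative (\<lambda>y. metric_coord M g c y b v) (at x) w)) (at x)"
    by (rule has_derivative_transform_within_open[OF 1 op x]) (simp add: metric_coord_lin)
  from fun_cong[OF has_derivative_unique[OF metric_coord_deriv[OF x] this], of w]
  show "frechet_derivative (\<lambda>y. metric_coord M g c y (r *\<^sub>R a + s *\<^sub>R b) v) (at x) w = r * frechet_derivative (\<lambda>y. metric_coord M g c y a v) (at x) w + s * frechet_derivative (\<lambda>y. metric_coord M g c y b v) (at x) w" .
  have "((\<lambda>y. metric_coord M g c y a b) has_derivative (\<lambda>w. frechet_derivative (\<lambda>y. metric_coord M g c y b a) (at x) w)) (at x)"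
    by (rule has_derivative_transform_within_open[OF metric_coord_deriv[OF x] op x]) (simp add: metric_coord_sym)
  from fun_cong[OF has_derivative_unique[OF metric_coord_deriv[OF x] this], of w]
  show "frechet_derivative (\<lambda>y. metric_coord M g c y a b) (at x) w = frechet_derivative (\<lambda>y. metric_coord M g c y b a) (at x) w" .
qed

lemma levi_civita_ex1:
  assumes x: "x \<in> snd c ` fst c"
  shows "\<exists>!\<Gamma>. is_levi_civita M g c x \<Gamma>"
proof -
  let ?B = "metric_coord M g c x"
  have nd: "z = z'" if "\<And>y. ?B z y = ?B z' y" for z z'
  proof (rule ccontr)
    assume "z \<noteq> z'"
    then have "?B (z - z') (z - z') > 0" using metric_coord_pos[OF x] by simp
    moreover have "?B (z - z') (z - z') = 0"
      using that by (simp add: bilinear_lsub[OF metric_coord_bilinear[OF x]])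
    ultimately show False by simp
  qed
  have riesz: "\<exists>z. \<forall>y. ?B z y = l y" if l: "linear l" for l :: "'e \<Rightarrow> real"
  proof -
    let ?F = "\<lambda>z. \<Sum>b\<in>Basis. ?B z b *\<^sub>R b"
    have lin: "linear ?F"
      by (rule linearI) (simp_all add: bilinear_ladd[OF metric_coord_bilinear[OF x]] 
        bilinear_lmul[OF metric_coord_bilinear[OF x]] sum.distrib scaleR_left_distrib scaleR_sum_right)
    have ext: "?B z y = l' y" if "linear l'" "\<And>b. b \<in> Basis \<Longrightarrow> ?B z b = l' b" for z y and l'
    proof -
      have "linear (?B z)" using metric_coord_bilinear[OF x] by (simp add: bilinear_def)
      from linear_eq_stdbasis[OF this that(1)] that(2) have "?B z = l'" by blast
      then show ?thesis by simp
    qed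
    have co: "?F z \<bullet> b = ?B z b" if "b \<in> Basis" for z b
      using that by (rule inner_sum_left_Basis)
    have "inj ?F"
    proof (rule injI)
      fix z z' assume "?F z = ?F z'"
      then have eq: "?B z b = ?B z' b" if "b \<in> Basis" for b
        using co[OF that, of z] co[OF that, of z'] by simp
      have "linear (?B z')" using metric_coord_bilinear[OF x] by (simp add: bilinear_def)
      then have "?B z y = ?B z' y" for y using eq by (rule ext)
      then show "z = z'" by (rule nd)
    qed
    then have "surj ?F" by (rule linear_inj_imp_surj[OF lin])
    from surjD[OF this, of "\<Sum>b\<in>Basis. l b *\<^sub>R b"]
    obtain z where "?F z = (\<Sum>b\<in>Basis. l b *\<^sub>R b)" by auto
    then have "?B z b = l b" if "b \<in> Basis" for b
      using co[OF that, of z] inner_sum_left_Basis[OF that, of l] by simp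
    then have "?B z y = l y" for y by (rule ext[OF l])
    then show ?thesis by blast
  qed
  let ?T = "\<lambda>w u v. frechet_derivative (\<lambda>y. metric_coord M g c y u v) (at x) w"
  have Tl: "?T (r *\<^sub>R a + s *\<^sub>R b) u v = r * ?T a u v + s * ?T b u v" for r a s b u v
    using metric_coord_deriv_linear[OF x, of u v] by (simp add: linear_add linear_scale)
  have Tm: "?T w (r *\<^sub>R a + s *\<^sub>R b) v = r * ?T w a v + s * ?T w b v" for r a s b w v
    by (rule metric_coord_deriv_args(1)[OF x])
  have Ts: "?T w a b = ?T w b a" for w a b by (rule metric_coord_deriv_args(2)[OF x])
  have Tr: "?T w v (r *\<^sub>R a + s *\<^sub>R b) = r * ?T w v a + s * ?T w v b" for r a s b w v
    using Tm[where w=w and r=r and a=a and s=s and b=b and v=v] unfolding Ts[where w=w and a=v and b="r *\<^sub>R a + s *\<^sub>R b"] Ts[where w=w and a=v and b=a] Ts[where w=w and a=v and b=b] .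
  define K where "K w u y = (?T w u y + ?T u w y - ?T y w u) / 2" for w u y
  have Kr: "K w u (r *\<^sub>R a + s *\<^sub>R b) = r * K w u a + s * K w u b" for r a s b w u
    unfolding K_def Tl Tr by (simp add: field_simps)
  have Km: "K w (r *\<^sub>R a + s *\<^sub>R b) u = r * K w a u + s * K w b u" for r a s b w u
    unfolding K_def Tl Tm Tr by (simp add: field_simps)
  have Ks: "K w u y = K u w y" for w u y unfolding K_def using Ts by (simp add: add.commute)
  have "linear (K w u)" for w u
    by (rule linearI) (use Kr[of w u 1 _ 1] Kr[of w u _ _ 0] in \<open>simp_all\<close>)
  then have K_riesz: "\<exists>z. \<forall>y. ?B z y = K w u y" for w u by (rule riesz)
  define G where "G w u = (SOME z. \<forall>y. ?B z y = K w u y)" for w u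
  have G: "?B (G w u) y = K w u y" for w u y
    using someI_ex[OF K_riesz[of w u]] unfolding G_def by blast
  have Gm: "G w (r *\<^sub>R a + s *\<^sub>R b) = r *\<^sub>R G w a + s *\<^sub>R G w b" for r a s b w
    by (rule nd) (simp add: G Km metric_coord_lin[OF x])
  have Gs: "G w u = G u w" for w u by (rule nd) (simp add: G Ks)
  have lin2: "linear (G w)" for w
    by (rule linearI) (use Gm[of w 1 _ 1] Gm[of w _ _ 0] in \<open>simp_all\<close>)
  then have lin1: "linear (\<lambda>w. G w u)" for u 
  proof -
    have "(\<lambda>w. G w u) = G u" using Gs by blast
    then show ?thesis using lin2[of u] by simp
  qed
  have "?T w u v = ?B (G w u) v + ?B u (G w v)" for u v w
  proof -
    have "?B u (G w v) = K w v u" using metric_coord_sym[OF x, of u "G w v"] G[of w v u] by (rule trans)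
    moreover have "?T w v u = ?T w u v" "?T v u w = ?T v w u" "?T u v w = ?T u w v" by (rule Ts)+
    ultimately show ?thesis unfolding G K_def by (simp add: field_simps)
  qed
  then have ex: "is_levi_civita M g c x G"
    unfolding is_levi_civita_def bilinear_def using lin1 lin2 Gs by blast
  moreover have "H = G" if H: "is_levi_civita M g c x H" for H
  proof (intro ext nd)
    fix w u y
    have t: "?T w u v = ?B (H w u) v + ?B (H w v) u" for w u v
    proof -
      have "?T w u v = ?B (H w u) v + ?B u (H w v)"
        using H unfolding is_levi_civita_def by blast
      also have "?B u (H w v) = ?B (H w v) u" by (rule metric_coord_sym[OF x])
      finally show ?thesis .
    qed
    have s: "H u v = H v u" for u v using H unfolding is_levi_civita_def by blast
    have "K w u y = ?B (H w u) y"
      unfolding K_def t[where w=w and u=u and v=y] t[where w=u and u=w and v=y] t[where w=y and u=w and v=u] s[of u w] s[of y w] s[of y u] by simp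
    then show "?B (H w u) y = ?B (G w u) y" unfolding G by (rule sym)
  qed
  ultimately show ?thesis by blast
qed

end
end

definition christoffel ::
  "('m, 'e::euclidean_space) manifold \<Rightarrow> ('m, 'e) metric \<Rightarrow> ('m, 'e) chart \<Rightarrow> 'e \<Rightarrow> 'e \<Rightarrow> 'e \<Rightarrow> 'e"
where
  "christoffel M g c x = (THE \<Gamma>. is_levi_civita M g c x \<Gamma>)"

section \<open>Curves and their curvature radii\<close>

text \<open>Curves are functions on the closed unit interval, i.e. extensional functions on \<open>{0..1}\<close>;
  derivatives are one-sided at the end points.\<close>

abbreviation curve_deriv :: "(real \<Rightarrow> 'a::real_normed_vector) \<Rightarrow> real \<Rightarrow> 'a" where
  "curve_deriv f t \<equiv> vector_derivative f (at t within {0..1})"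

definition C2_curves :: "('m, 'e::euclidean_space) manifold \<Rightarrow> (real \<Rightarrow> 'm) set" where
  "C2_curves M = {\<gamma> \<in> {0..1} \<rightarrow>\<^sub>E topspace (mtop M).
     continuous_map (top_of_set {0..1}) (mtop M) \<gamma> \<and>
     (\<forall>c\<in>atlas M.
        let f = snd c \<circ> \<gamma>; I = {t \<in> {0..1}. \<gamma> t \<in> fst c} in
          (\<forall>t\<in>I. f differentiable (at t within {0..1})) \<and>
          (\<forall>t\<in>I. curve_deriv f differentiable (at t within {0..1})) \<and>
          continuous_on I (curve_deriv (curve_deriv f)))}"

definition velocity ::
  "('m, 'e::euclidean_space) manifold \<Rightarrow> (real \<Rightarrow> 'm) \<Rightarrow> real \<Rightarrow> ('m, 'e) tvec" where
  "velocity M \<gamma> t = (\<lambda>c. if c \<in> charts_at M (\<gamma> t) then curve_deriv (snd c \<circ> \<gamma>) t else 0)"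

text \<open>The Levi-Civita covariant derivative \<open>D\<^sub>t V\<close> of a vector field \<open>V\<close> along \<open>\<gamma>\<close>.\<close>

definition cov_deriv ::
  "('m, 'e::euclidean_space) manifold \<Rightarrow> ('m, 'e) metric \<Rightarrow> (real \<Rightarrow> 'm) \<Rightarrow> (real \<Rightarrow> ('m, 'e) tvec)
     \<Rightarrow> real \<Rightarrow> ('m, 'e) tvec" where
  "cov_deriv M g \<gamma> V t = (\<lambda>c. if c \<in> charts_at M (\<gamma> t)
     then curve_deriv (\<lambda>s. V s c) t + christoffel M g c (snd c (\<gamma> t)) (velocity M \<gamma> t c) (V t c)
     else 0)"

definition regular :: "('m, 'e::euclidean_space) manifold \<Rightarrow> (real \<Rightarrow> 'm) \<Rightarrow> bool" where
  "regular M \<gamma> \<longleftrightarrow> (\<forall>t\<in>{0..1}. velocity M \<gamma> t \<noteq> (\<lambda>_. 0))"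

definition normal_accel ::
  "('m, 'e::euclidean_space) manifold \<Rightarrow> ('m, 'e) metric \<Rightarrow> (real \<Rightarrow> 'm) \<Rightarrow> real \<Rightarrow> ('m, 'e) tvec"
where
  "normal_accel M g \<gamma> t =
     perp_proj g (\<gamma> t) (velocity M \<gamma> t) (cov_deriv M g \<gamma> (velocity M \<gamma>) t)"

definition geodesic_curvature ::
  "('m, 'e::euclidean_space) manifold \<Rightarrow> ('m, 'e) metric \<Rightarrow> (real \<Rightarrow> 'm) \<Rightarrow> real \<Rightarrow> real" where
  "geodesic_curvature M g \<gamma> t =
     tnorm g (\<gamma> t) (normal_accel M g \<gamma> t) / (tnorm g (\<gamma> t) (velocity M \<gamma> t))\<^sup>2"

definition curvature_radius_dom ::
  "('m, 'e::euclidean_space) manifold \<Rightarrow> ('m, 'e) metric \<Rightarrow> (real \<Rightarrow> 'm) set" where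
  "curvature_radius_dom M g = {\<gamma> \<in> C2_curves M. regular M \<gamma> \<and>
     (\<forall>t\<in>{0..1}. geodesic_curvature M g \<gamma> t \<noteq> 0)}"

text \<open>The base point \<open>\<gamma> t\<close> of the value at \<open>t\<close> is left implicit.\<close>

definition curvature_radius ::
  "('m, 'e::euclidean_space) manifold \<Rightarrow> ('m, 'e) metric \<Rightarrow> (real \<Rightarrow> 'm) \<Rightarrow> real \<Rightarrow> ('m, 'e) tvec"
where
  "curvature_radius M g \<gamma> = (\<lambda>t\<in>{0..1}. \<lambda>c.
     (1 / geodesic_curvature M g \<gamma> t) *\<^sub>R
       ((1 / tnorm g (\<gamma> t) (normal_accel M g \<gamma> t)) *\<^sub>R normal_accel M g \<gamma> t c))"

section \<open>Same curvature radii and homothety\<close>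

definition same_curvature_radii ::
  "('m, 'e::euclidean_space) manifold \<Rightarrow> ('m, 'e) metric
     \<Rightarrow> ('n, 'f::euclidean_space) manifold \<Rightarrow> ('n, 'f) metric \<Rightarrow> bool" where
  "same_curvature_radii M g N h \<longleftrightarrow> (\<exists>\<phi>. diffeomorphism M N \<phi> \<and>
     (\<lambda>\<gamma>. compose {0..1} \<phi> \<gamma>) ` curvature_radius_dom M g = curvature_radius_dom N h \<and>
     (\<forall>\<gamma>\<in>curvature_radius_dom M g.
        curvature_radius N h (compose {0..1} \<phi> \<gamma>) =
        (\<lambda>t\<in>{0..1}. pushforward M N \<phi> (\<gamma> t) (curvature_radius M g \<gamma> t))))"

definition homothetic ::
  "('m, 'e::euclidean_space) manifold \<Rightarrow> ('m, 'e) metric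
     \<Rightarrow> ('n, 'f::euclidean_space) manifold \<Rightarrow> ('n, 'f) metric \<Rightarrow> bool" where
  "homothetic M g N h \<longleftrightarrow> (\<exists>\<phi> l. diffeomorphism M N \<phi> \<and> l > 0 \<and>
     (\<forall>p\<in>topspace (mtop M). \<forall>u\<in>tangent_space M p. \<forall>v\<in>tangent_space M p.
        h (\<phi> p) (pushforward M N \<phi> p u) (pushforward M N \<phi> p v) = l * g p u v))"

end

theory Submission
  imports Defs
begin

text \<open>
  Both directions rest on the connection defect \<open>E\<close> of a map \<open>\<phi>\<close>, read in charts: the tensor by which
  the acceleration of \<open>\<phi> \<circ> \<gamma>\<close> differs from the push-forward of the acceleration of \<open>\<gamma>\<close>, evaluated at
  the velocity of \<open>\<gamma>\<close> (\<open>acceleration_compose_coord\<close>). If \<open>\<phi>\<close> pulls the metric of \<open>N\<close> back to \<open>\<lambda> g\<close>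
  for a function \<open>\<lambda>\<close>, then differentiating this relation gives
  \<open>H (E w u) (DF v) + H (DF u) (E w v) = - d\<lambda> w * g u v\<close> (\<open>conformal_defect\<close>), where \<open>DF\<close> is the
  differential of \<open>\<phi>\<close> and \<open>H\<close> the metric of \<open>N\<close>. Moreover \<open>E\<close> is symmetric.

  For a homothety \<open>\<lambda>\<close> is constant, so the form \<open>H (E w u) (DF v)\<close> is symmetric in \<open>w\<close> and \<open>u\<close> and skew
  in \<open>u\<close> and \<open>v\<close>. Hence \<open>E = 0\<close> and accelerations are pushed forward to accelerations
  (\<open>homothety_defect_zero\<close>). The constant factor cancels in the curvature radius, so homotheties
  preserve curvature radii. The identity map in two different charts is the special case that makes
  acceleration a tangent vector.

  Conversely, let \<open>\<phi>\<close> preserve curvature radii. At every point, any two orthogonal nonzero vectors are,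
  up to scale, the velocity and the normal acceleration of some curve
  (\<open>curve_with_normal_acceleration\<close>). The curvature radius of a curve is a multiple of the normal
  acceleration and orthogonal to the velocity, and this holds for the image curve as well; so the
  differential of \<open>\<phi>\<close> preserves orthogonality and is therefore conformal (\<open>radii_conformal_at\<close>). With
  lengths under control, equal curvature radii mean equal normal accelerations, hence \<open>E u u\<close> is a
  multiple of \<open>DF u\<close> for all \<open>u\<close> (\<open>radii_defect_tangential\<close>). Inserting this in the relation above,
  with a vector \<open>v\<close> orthogonal to a given \<open>w\<close>, gives \<open>d\<lambda> w = 0\<close>
  (\<open>conformal_factor_derivative_zero\<close>). So \<open>\<lambda>\<close> is locally constant, and constant since \<open>M\<close> is
  connected.
\<close>

section \<open>Derivatives of smooth maps\<close>

definition D2 :: "('a::euclidean_space \<Rightarrow> 'b::real_normed_vector) \<Rightarrow> 'a \<Rightarrow> 'a \<Rightarrow> 'a \<Rightarrow> 'b" where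
  "D2 F x u v = frechet_derivative (\<lambda>y. frechet_derivative F (at y) v) (at x) u"

lemma smooth_on_has_derivative:
  assumes "smooth_on S F" "x \<in> S"
  shows "(F has_derivative frechet_derivative F (at x)) (at x)"
  using smooth_on_differentiable[OF assms] frechet_derivative_works by blast

lemma smooth_on_linear:
  assumes "smooth_on S F" "x \<in> S"
  shows "linear (frechet_derivative F (at x))"
  using smooth_on_has_derivative[OF assms] has_derivative_linear by blast

lemma smooth_on_derivative:
  assumes "smooth_on S F"
  shows "smooth_on S (\<lambda>x. frechet_derivative F (at x) v)"
  unfolding smooth_on_def
proof
  fix k
  have "Ck_on (Suc k) S F" using assms unfolding smooth_on_def by blast
  then show "Ck_on k S (\<lambda>x. frechet_derivative F (at x) v)" by simp
qed

lemma smooth_on_continuous_on: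
  assumes "smooth_on S F"
  shows "continuous_on S F"
  using assms unfolding smooth_on_def by (metis Ck_on.simps(1))

lemma smooth_on_has_derivative2:
  assumes "smooth_on S F" "x \<in> S"
  shows "((\<lambda>y. frechet_derivative F (at y) v) has_derivative (\<lambda>u. D2 F x u v)) (at x)"
  unfolding D2_def
  using smooth_on_has_derivative[OF smooth_on_derivative[OF assms(1)] assms(2)] .

lemma smooth_on_continuous_D2:
  assumes "smooth_on S F"
  shows "continuous_on S (\<lambda>x. D2 F x u v)"
  unfolding D2_def
  by (intro smooth_on_continuous_on smooth_on_derivative assms)

lemma D2_linear_left:
  assumes "smooth_on S F" "x \<in> S"
  shows "linear (\<lambda>u. D2 F x u v)"
  using smooth_on_has_derivative2[OF assms] has_derivative_linear by blast

text \<open>The mean value theorem is applied to the increment in direction \<open>v\<close>, as a function of the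
  step in direction \<open>u\<close>, and then to \<open>F' _ u\<close> in direction \<open>v\<close>. The left-hand side is symmetric in \<open>u\<close>
  and \<open>v\<close>, so that it can be compared with both mixed second derivatives.\<close>

lemma second_difference_mvt:
  fixes F :: "'a::euclidean_space \<Rightarrow> real"
  assumes t: "0 < t"
    and S: "\<And>a b. 0 \<le> a \<Longrightarrow> a \<le> t \<Longrightarrow> 0 \<le> b \<Longrightarrow> b \<le> t \<Longrightarrow> x + a *\<^sub>R u + b *\<^sub>R v \<in> S"
    and F: "\<And>y. y \<in> S \<Longrightarrow> (F has_derivative F' y) (at y)"
    and Fu: "\<And>y. y \<in> S \<Longrightarrow> ((\<lambda>y. F' y u) has_derivative Fu y) (at y)"
  shows "\<exists>a b. 0 \<le> a \<and> a \<le> t \<and> 0 \<le> b \<and> b \<le> t \<and>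
     F (x + t *\<^sub>R u + t *\<^sub>R v) - F (x + t *\<^sub>R u) - F (x + t *\<^sub>R v) + F x
     = t\<^sup>2 * Fu (x + a *\<^sub>R u + b *\<^sub>R v) v"
proof -
  define k where "k a = F (x + a *\<^sub>R u + t *\<^sub>R v) - F (x + a *\<^sub>R u)" for a
  have lin: "linear (F' y)" if "y \<in> S" for y using F[OF that] has_derivative_linear by blast
  have linu: "linear (Fu y)" if "y \<in> S" for y using Fu[OF that] has_derivative_linear by blast
  have dk: "(k has_derivative (\<lambda>h. h * (F' (x + a *\<^sub>R u + t *\<^sub>R v) u - F' (x + a *\<^sub>R u) u))) (at a within {0..t})"
    if a: "0 \<le> a" "a \<le> t" for a
  proof -
    have p1: "x + a *\<^sub>R u + t *\<^sub>R v \<in> S" and p2: "x + a *\<^sub>R u \<in> S"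
      using S[OF a, of t] S[OF a, of 0] t by auto
    have 1: "((\<lambda>a. F (x + a *\<^sub>R u + t *\<^sub>R v)) has_derivative (\<lambda>h. F' (x + a *\<^sub>R u + t *\<^sub>R v) (h *\<^sub>R u))) (at a within {0..t})"
      by (rule has_derivative_compose[where f="\<lambda>a. x + a *\<^sub>R u + t *\<^sub>R v" and x=a and g=F, OF _ F[OF p1]]) (auto intro!: derivative_eq_intros)
    have 2: "((\<lambda>a. F (x + a *\<^sub>R u)) has_derivative (\<lambda>h. F' (x + a *\<^sub>R u) (h *\<^sub>R u))) (at a within {0..t})"
      by (rule has_derivative_compose[where f="\<lambda>a. x + a *\<^sub>R u" and x=a and g=F, OF _ F[OF p2]]) (auto intro!: derivative_eq_intros)
    show ?thesis
      unfolding k_def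
      by (rule has_derivative_eq_rhs[OF has_derivative_diff[OF 1 2]])
         (auto simp: linear_scale[OF lin[OF p1]] linear_scale[OF lin[OF p2]] right_diff_distrib)
  qed
  from mvt_very_simple[of 0 t k, OF _ dk] t
  obtain a where a: "0 \<le> a" "a \<le> t"
    and ka: "k t - k 0 = t * (F' (x + a *\<^sub>R u + t *\<^sub>R v) u - F' (x + a *\<^sub>R u) u)" by auto
  define m where "m b = F' (x + a *\<^sub>R u + b *\<^sub>R v) u" for b
  have dm: "(m has_derivative (\<lambda>h. h * Fu (x + a *\<^sub>R u + b *\<^sub>R v) v)) (at b within {0..t})"
    if b: "0 \<le> b" "b \<le> t" for b
  proof -
    have p: "x + a *\<^sub>R u + b *\<^sub>R v \<in> S" using S[OF a b] .
    have "((\<lambda>b. F' (x + a *\<^sub>R u + b *\<^sub>R v) u) has_derivative (\<lambda>h. Fu (x + a *\<^sub>R u + b *\<^sub>R v) (h *\<^sub>R v))) (at b within {0..t})"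
      by (rule has_derivative_compose[where f="\<lambda>b. x + a *\<^sub>R u + b *\<^sub>R v" and x=b and g="\<lambda>y. F' y u", OF _ Fu[OF p]]) (auto intro!: derivative_eq_intros)
    then show ?thesis unfolding m_def by (simp add: linear_scale[OF linu[OF p]])
  qed
  from mvt_very_simple[of 0 t m, OF _ dm] t
  obtain b where b: "0 \<le> b" "b \<le> t" and mb: "m t - m 0 = t * Fu (x + a *\<^sub>R u + b *\<^sub>R v) v" by auto
  have "F (x + t *\<^sub>R u + t *\<^sub>R v) - F (x + t *\<^sub>R u) - F (x + t *\<^sub>R v) + F x = k t - k 0"
    by (simp add: k_def)
  also have "\<dots> = t * (m t - m 0)" unfolding ka m_def by simp
  also have "\<dots> = t\<^sup>2 * Fu (x + a *\<^sub>R u + b *\<^sub>R v) v" unfolding mb by (simp add: power2_eq_square)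
  finally show ?thesis using a b by blast
qed

text \<open>If the mixed derivatives differed at \<open>x\<close>, they would stay apart on a small ball by continuity;
  but there the second difference over a small parallelogram is a value of either of them, up to the
  same factor \<open>t\<^sup>2\<close>.\<close>

lemma second_derivative_commutes_real:
  fixes F :: "'a::euclidean_space \<Rightarrow> real"
  assumes S: "open S" "x \<in> S"
    and F: "\<And>y. y \<in> S \<Longrightarrow> (F has_derivative F' y) (at y)"
    and Fu: "\<And>y. y \<in> S \<Longrightarrow> ((\<lambda>y. F' y u) has_derivative Fu y) (at y)"
    and Fv: "\<And>y. y \<in> S \<Longrightarrow> ((\<lambda>y. F' y v) has_derivative Fv y) (at y)"
    and cu: "continuous_on S (\<lambda>y. Fu y v)" and cv: "continuous_on S (\<lambda>y. Fv y u)"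
  shows "Fu x v = Fv x u"
proof (rule ccontr)
  assume ne: "Fu x v \<noteq> Fv x u"
  define e where "e = \<bar>Fu x v - Fv x u\<bar> / 2"
  have e: "e > 0" using ne by (simp add: e_def)
  have "isCont (\<lambda>y. Fu y v) x" "isCont (\<lambda>y. Fv y u) x"
    using cu cv S by (auto simp: continuous_on_eq_continuous_at)
  then obtain d1 d2 where d: "d1 > 0" "d2 > 0"
    and d1: "\<And>y. dist y x < d1 \<Longrightarrow> dist (Fu y v) (Fu x v) < e"
    and d2: "\<And>y. dist y x < d2 \<Longrightarrow> dist (Fv y u) (Fv x u) < e"
    using e unfolding continuous_at_eps_delta dist_norm by metis
  obtain d3 where d3: "d3 > 0" "ball x d3 \<subseteq> S" using S open_contains_ball by blast
  define r where "r = min d1 (min d2 d3)"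
  have r: "r > 0" using d d3 by (simp add: r_def)
  define t where "t = r / (2 * (norm u + norm v + 1))"
  have np: "norm u + norm v + 1 > 0" by (smt (verit) norm_ge_zero)
  have t: "t > 0" using r np by (simp add: t_def)
  have near: "dist (x + a *\<^sub>R u + b *\<^sub>R v) x < r" if "0 \<le> a" "a \<le> t" "0 \<le> b" "b \<le> t" for a b
  proof -
    have "dist (x + a *\<^sub>R u + b *\<^sub>R v) x = norm (a *\<^sub>R u + b *\<^sub>R v)"
      by (simp add: dist_norm add.assoc)
    also have "\<dots> \<le> norm (a *\<^sub>R u) + norm (b *\<^sub>R v)" by (rule norm_triangle_ineq)
    also have "\<dots> \<le> t * norm u + t * norm v" using that by (auto intro!: add_mono mult_right_mono)
    also have "\<dots> \<le> t * (norm u + norm v + 1)" using t by (simp add: algebra_simps)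
    also have "\<dots> = r / 2" using np unfolding t_def by (simp add: divide_simps)
    also have "\<dots> < r" using r by simp
    finally show ?thesis .
  qed
  have inS: "x + a *\<^sub>R u + b *\<^sub>R v \<in> S" if "0 \<le> a" "a \<le> t" "0 \<le> b" "b \<le> t" for a b
    using near[OF that] d3 by (auto simp: r_def dist_commute)
  have inS': "x + a *\<^sub>R v + b *\<^sub>R u \<in> S" if "0 \<le> a" "a \<le> t" "0 \<le> b" "b \<le> t" for a b
    using inS[of b a] that by (simp add: algebra_simps)
  obtain a b where ab: "0 \<le> a" "a \<le> t" "0 \<le> b" "b \<le> t" and
    1: "F (x + t *\<^sub>R u + t *\<^sub>R v) - F (x + t *\<^sub>R u) - F (x + t *\<^sub>R v) + F x
     = t\<^sup>2 * Fu (x + a *\<^sub>R u + b *\<^sub>R v) v"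
    using second_difference_mvt[OF t inS F Fu] by blast
  obtain a' b' where ab': "0 \<le> a'" "a' \<le> t" "0 \<le> b'" "b' \<le> t" and
    2: "F (x + t *\<^sub>R v + t *\<^sub>R u) - F (x + t *\<^sub>R v) - F (x + t *\<^sub>R u) + F x
     = t\<^sup>2 * Fv (x + a' *\<^sub>R v + b' *\<^sub>R u) u"
    using second_difference_mvt[OF t inS' F Fv] by blast
  have "x + t *\<^sub>R v + t *\<^sub>R u = x + t *\<^sub>R u + t *\<^sub>R v" by (simp add: algebra_simps)
  then have "t\<^sup>2 * Fu (x + a *\<^sub>R u + b *\<^sub>R v) v = t\<^sup>2 * Fv (x + a' *\<^sub>R v + b' *\<^sub>R u) u"
    using 1 2 by (smt (verit))
  then have eq: "Fu (x + a *\<^sub>R u + b *\<^sub>R v) v = Fv (x + a' *\<^sub>R v + b' *\<^sub>R u) u" using t by simp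
  have "dist (Fu (x + a *\<^sub>R u + b *\<^sub>R v) v) (Fu x v) < e"
    using near[OF ab] by (intro d1) (simp add: r_def)
  moreover have "dist (Fv (x + a' *\<^sub>R v + b' *\<^sub>R u) u) (Fv x u) < e"
    using near[OF ab'(3,4,1,2)] by (intro d2) (simp add: r_def algebra_simps)
  ultimately have "\<bar>Fu x v - Fv x u\<bar> < 2 * e" unfolding eq dist_real_def by linarith
  then show False by (simp add: e_def)
qed

lemma D2_commute:
  fixes F :: "'a::euclidean_space \<Rightarrow> 'b::euclidean_space"
  assumes F: "smooth_on S F" and S: "open S" "x \<in> S"
  shows "D2 F x u v = D2 F x v u"
proof (rule euclidean_eqI)
  fix b :: 'b assume "b \<in> Basis"
  have 1: "((\<lambda>y. F y \<bullet> b) has_derivative (\<lambda>w. frechet_derivative F (at y) w \<bullet> b)) (at y)" if "y \<in> S" for y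
    by (intro has_derivative_inner_left smooth_on_has_derivative[OF F that])
  have 2: "((\<lambda>y. frechet_derivative F (at y) w \<bullet> b) has_derivative (\<lambda>z. D2 F y z w \<bullet> b)) (at y)" if "y \<in> S" for y w
    by (intro has_derivative_inner_left smooth_on_has_derivative2[OF F that])
  have 3: "continuous_on S (\<lambda>y. D2 F y z w \<bullet> b)" for z w
    by (intro continuous_intros smooth_on_continuous_D2[OF F])
  show "D2 F x u v \<bullet> b = D2 F x v u \<bullet> b"
    using second_derivative_commutes_real[OF S 1 2 2 3 3] by blast
qed

lemma D2_linear_right:
  fixes F :: "'a::euclidean_space \<Rightarrow> 'b::euclidean_space"
  assumes "smooth_on S F" "open S" "x \<in> S"
  shows "linear (D2 F x u)"
proof -
  have "D2 F x u = (\<lambda>v. D2 F x v u)" using D2_commute[OF assms] by blast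
  then show ?thesis using D2_linear_left[OF assms(1,3), of u] by simp
qed

lemma linear_expand:
  fixes L :: "'a::euclidean_space \<Rightarrow> 'b::real_vector"
  assumes "linear L"
  shows "L v = (\<Sum>i\<in>Basis. (v \<bullet> i) *\<^sub>R L i)"
proof -
  have "L v = L (\<Sum>i\<in>Basis. (v \<bullet> i) *\<^sub>R i)" by (simp add: euclidean_representation)
  also have "\<dots> = (\<Sum>i\<in>Basis. (v \<bullet> i) *\<^sub>R L i)"
    by (simp add: linear_sum[OF assms] linear_scale[OF assms])
  finally show ?thesis .
qed

text \<open>The Leibniz rule for evaluating a moving linear map at a moving vector, with differentiability of
  the family of maps tested on single vectors. Expanding the increment \<open>v s - v t\<close> in a basis gives
  coefficients that vanish at \<open>t\<close>, so that in this part only the value of \<open>L\<close> at \<open>t\<close> matters.\<close>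

lemma linear_family_has_derivative:
  fixes L :: "'c::real_normed_vector \<Rightarrow> 'a::euclidean_space \<Rightarrow> 'b::real_normed_vector"
  assumes lin: "\<And>s. s \<in> T \<Longrightarrow> linear (L s)" and t: "t \<in> T"
    and dL: "\<And>a. ((\<lambda>s. L s a) has_derivative L' a) (at t within T)"
    and v: "(v has_derivative v') (at t within T)"
  shows "((\<lambda>s. L s (v s)) has_derivative (\<lambda>r. L' (v t) r + L t (v' r))) (at t within T)"
proof -
  have 1: "((\<lambda>s. L s (v t) + (\<Sum>i\<in>Basis. ((v s - v t) \<bullet> i) *\<^sub>R L s i)) has_derivative
      (\<lambda>r. L' (v t) r + (\<Sum>i\<in>Basis. ((v t - v t) \<bullet> i) *\<^sub>R L' i r + ((v' r - 0) \<bullet> i) *\<^sub>R L t i))) (at t within T)"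
    by (intro has_derivative_add has_derivative_sum has_derivative_scaleR has_derivative_inner_left
        has_derivative_diff dL v has_derivative_const)
  have 2: "L s (v s) = L s (v t) + (\<Sum>i\<in>Basis. ((v s - v t) \<bullet> i) *\<^sub>R L s i)" if "s \<in> T" for s
    using linear_expand[OF lin[OF that], of "v s - v t"] linear_diff[OF lin[OF that], of "v s" "v t"]
    by (metis add_diff_cancel_left' add.commute diff_add_cancel)
  have 3: "L t (v' r) = (\<Sum>i\<in>Basis. ((v t - v t) \<bullet> i) *\<^sub>R L' i r + ((v' r - 0) \<bullet> i) *\<^sub>R L t i)" for r
    using linear_expand[OF lin[OF t], of "v' r"] by simp
  show ?thesis
    unfolding 3 by (rule has_derivative_transform[OF t 2 1])
qed

lemma linear_family_continuous_on:
  fixes L :: "'c::topological_space \<Rightarrow> 'a::euclidean_space \<Rightarrow> 'b::real_normed_vector"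
  assumes lin: "\<And>s. s \<in> T \<Longrightarrow> linear (L s)"
    and cL: "\<And>i. continuous_on T (\<lambda>s. L s i)" and v: "continuous_on T v"
  shows "continuous_on T (\<lambda>s. L s (v s))"
proof -
  have "continuous_on T (\<lambda>s. \<Sum>i\<in>Basis. (v s \<bullet> i) *\<^sub>R L s i)"
    by (intro continuous_intros cL v)
  then show ?thesis
    using linear_expand[OF lin] by (simp cong: continuous_on_cong)
qed

section \<open>Twice differentiable curves\<close>

text \<open>The condition that membership in \<open>C2_curves\<close> puts on the coordinates of a curve in one chart, for
  a set \<open>I\<close> of times. Derivatives are taken within the unit interval, hence depend only on the values
  on \<open>I\<close> as soon as \<open>I\<close> is relatively open.\<close>

definition C2_curve_on :: "real set \<Rightarrow> (real \<Rightarrow> 'a::real_normed_vector) \<Rightarrow> bool" where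
  "C2_curve_on I f \<longleftrightarrow> (\<forall>t\<in>I. f differentiable (at t within {0..1})) \<and>
     (\<forall>t\<in>I. curve_deriv f differentiable (at t within {0..1})) \<and>
     continuous_on I (curve_deriv (curve_deriv f))"

lemma curve_derivI:
  fixes f :: "real \<Rightarrow> 'a::euclidean_space"
  assumes "(f has_vector_derivative d) (at t within {0..1})" "t \<in> {0..1}"
  shows "curve_deriv f t = d"
  using vector_derivative_within_closed_interval[of 0 1 t f d] assms by simp

lemma at_within_relatively_open:
  assumes "openin (top_of_set A) I" "t \<in> I"
  shows "at t within A = at t within I"
proof -
  obtain T where T: "open T" "I = A \<inter> T" using assms(1) by (auto simp: openin_open)
  show ?thesis by (rule at_within_nhd[of t T]) (use T assms(2) in auto)
qed

lemma has_vector_derivative_cong_relatively_open: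
  assumes "openin (top_of_set A) I" "t \<in> I" "\<And>s. s \<in> I \<Longrightarrow> f s = g s"
  shows "(f has_vector_derivative d) (at t within A) \<longleftrightarrow> (g has_vector_derivative d) (at t within A)"
  unfolding at_within_relatively_open[OF assms(1,2)] has_vector_derivative_def
  using has_derivative_transform[OF assms(2), of f g] has_derivative_transform[OF assms(2), of g f] assms(3)
  by metis

lemma curve_deriv_cong:
  assumes "openin (top_of_set {0..1}) I" "t \<in> I" "\<And>s. s \<in> I \<Longrightarrow> f s = g s"
  shows "curve_deriv f t = curve_deriv g t"
  unfolding vector_derivative_def
  using has_vector_derivative_cong_relatively_open[OF assms] by simp

lemma curve_differentiable_cong:
  assumes "openin (top_of_set {0..1}) I" "t \<in> I" "\<And>s. s \<in> I \<Longrightarrow> f s = g s"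
  shows "f differentiable (at t within {0..1}) \<longleftrightarrow> g differentiable (at t within {0..1})"
  unfolding at_within_relatively_open[OF assms(1,2)] differentiable_def
  using has_derivative_transform[OF assms(2), of f g] has_derivative_transform[OF assms(2), of g f] assms(3)
  by metis

lemma C2_curve_on_cong:
  assumes I: "openin (top_of_set {0..1}) I" and eq: "\<And>s. s \<in> I \<Longrightarrow> f s = g s"
  shows "C2_curve_on I f \<longleftrightarrow> C2_curve_on I g"
proof -
  have 1: "curve_deriv f s = curve_deriv g s" if "s \<in> I" for s
    using curve_deriv_cong[OF I that eq] .
  have 2: "curve_deriv (curve_deriv f) s = curve_deriv (curve_deriv g) s" if "s \<in> I" for s
    using curve_deriv_cong[OF I that 1] .
  show ?thesis
    unfolding C2_curve_on_def
    using curve_differentiable_cong[where f=f and g=g, OF I _ eq]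
      curve_differentiable_cong[where f="curve_deriv f" and g="curve_deriv g", OF I _ 1]
      continuous_on_cong[where s=I and f="curve_deriv (curve_deriv f)" and g="curve_deriv (curve_deriv g)", OF refl 2]
    by auto
qed

lemma C2_curve_on_subset:
  assumes "C2_curve_on J f" "I \<subseteq> J"
  shows "C2_curve_on I f"
  using assms continuous_on_subset unfolding C2_curve_on_def by blast

text \<open>The image of a curve under a smooth map is studied through pairs of charts, one of the source and
  one of the target, whereas \<open>C2_curves\<close> speaks of all the times spent in a chart of the target.
  These times are covered by relatively open sets on which a single chart of the source suffices.\<close>

lemma C2_curve_on_locally:
  assumes "\<And>t. t \<in> J \<Longrightarrow> \<exists>I. openin (top_of_set {0..1}) I \<and> t \<in> I \<and> C2_curve_on I f"
  shows "C2_curve_on J f"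
  unfolding C2_curve_on_def
proof (intro conjI ballI)
  fix t assume "t \<in> J"
  then obtain I where I: "openin (top_of_set {0..1}) I" "t \<in> I" "C2_curve_on I f" using assms by blast
  then show "f differentiable (at t within {0..1})" "curve_deriv f differentiable (at t within {0..1})"
    unfolding C2_curve_on_def by auto
next
  define K where "K = \<Union>{I. openin (top_of_set {0..1}) I \<and> C2_curve_on I f}"
  have K: "openin (top_of_set {0..1}) K" unfolding K_def by (rule openin_Union) simp
  have "continuous_on K (curve_deriv (curve_deriv f))"
    unfolding continuous_on_eq_continuous_within
  proof
    fix t assume t: "t \<in> K"
    then obtain I where I: "openin (top_of_set {0..1}) I" "t \<in> I" "C2_curve_on I f" unfolding K_def by blast
    then have "continuous (at t within I) (curve_deriv (curve_deriv f))"
      unfolding C2_curve_on_def continuous_on_eq_continuous_within by blast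
    moreover have "at t within I = at t within K"
      using at_within_relatively_open[OF I(1,2)] at_within_relatively_open[OF K t] by simp
    ultimately show "continuous (at t within K) (curve_deriv (curve_deriv f))" by simp
  qed
  moreover have "J \<subseteq> K" using assms unfolding K_def by blast
  ultimately show "continuous_on J (curve_deriv (curve_deriv f))" by (rule continuous_on_subset)
qed

lemma C2_curve_on_deriv:
  assumes "C2_curve_on I f" "t \<in> I"
  shows "(f has_vector_derivative curve_deriv f t) (at t within {0..1})"
    and "(curve_deriv f has_vector_derivative curve_deriv (curve_deriv f) t) (at t within {0..1})"
  using assms unfolding C2_curve_on_def by (auto simp: vector_derivative_works)

lemma C2_curve_on_continuous:
  assumes "C2_curve_on I f" "I \<subseteq> {0..1}"
  shows "continuous_on I f" "continuous_on I (curve_deriv f)" "continuous_on I (curve_deriv (curve_deriv f))"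
proof -
  show "continuous_on I (curve_deriv (curve_deriv f))" using assms(1) unfolding C2_curve_on_def by blast
  show "continuous_on I f" "continuous_on I (curve_deriv f)"
    unfolding continuous_on_eq_continuous_within
    using C2_curve_on_deriv[OF assms(1)] has_vector_derivative_continuous continuous_within_subset assms(2) by blast+
qed

lemma
  fixes F :: "'a::euclidean_space \<Rightarrow> 'b::euclidean_space"
  assumes I: "openin (top_of_set {0..1}) I" and f: "C2_curve_on I f"
    and F: "smooth_on S F" and S: "open S" and fS: "f ` I \<subseteq> S"
  shows C2_chain_velocity: "t \<in> I \<Longrightarrow>
      curve_deriv (\<lambda>s. F (f s)) t = frechet_derivative F (at (f t)) (curve_deriv f t)"
    and C2_chain_acceleration: "t \<in> I \<Longrightarrow> curve_deriv (curve_deriv (\<lambda>s. F (f s))) t =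
      D2 F (f t) (curve_deriv f t) (curve_deriv f t) +
      frechet_derivative F (at (f t)) (curve_deriv (curve_deriv f) t)"
    and C2_chain: "C2_curve_on I (\<lambda>s. F (f s))"
proof -
  let ?A = "{0..1::real}"
  have IA: "I \<subseteq> ?A" using I openin_imp_subset by blast
  have inS: "f t \<in> S" if "t \<in> I" for t using fS that by blast
  have d1: "((\<lambda>s. F (f s)) has_vector_derivative frechet_derivative F (at (f t)) (curve_deriv f t)) (at t within ?A)"
    if t: "t \<in> I" for t
  proof -
    have "((\<lambda>s. F (f s)) has_derivative (\<lambda>r. frechet_derivative F (at (f t)) (r *\<^sub>R curve_deriv f t))) (at t within ?A)"
      using C2_curve_on_deriv(1)[OF f t] smooth_on_has_derivative[OF F inS[OF t]]
      unfolding has_vector_derivative_def by (rule has_derivative_compose)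
    then show ?thesis
      unfolding has_vector_derivative_def by (simp add: linear_scale[OF smooth_on_linear[OF F inS[OF t]]])
  qed
  show vel: "curve_deriv (\<lambda>s. F (f s)) t = frechet_derivative F (at (f t)) (curve_deriv f t)" if "t \<in> I" for t
    using curve_derivI[OF d1[OF that]] that IA by blast
  have d2: "(curve_deriv (\<lambda>s. F (f s)) has_vector_derivative
       D2 F (f t) (curve_deriv f t) (curve_deriv f t) +
      frechet_derivative F (at (f t)) (curve_deriv (curve_deriv f) t)) (at t within ?A)"
    if t: "t \<in> I" for t
  proof -
    have sub: "at t within ?A = at t within I" by (rule at_within_relatively_open[OF I t])
    have a: "((\<lambda>s. frechet_derivative F (at (f s)) a) has_derivative (\<lambda>r. D2 F (f t) (r *\<^sub>R curve_deriv f t) a)) (at t within I)" for a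
      using C2_curve_on_deriv(1)[OF f t] smooth_on_has_derivative2[OF F inS[OF t]]
      unfolding has_vector_derivative_def sub by (rule has_derivative_compose)
    have b: "(curve_deriv f has_derivative (\<lambda>r. r *\<^sub>R curve_deriv (curve_deriv f) t)) (at t within I)"
      using C2_curve_on_deriv(2)[OF f t] unfolding has_vector_derivative_def sub .
    have "((\<lambda>s. frechet_derivative F (at (f s)) (curve_deriv f s)) has_derivative
       (\<lambda>r. D2 F (f t) (r *\<^sub>R curve_deriv f t) (curve_deriv f t) +
      frechet_derivative F (at (f t)) (r *\<^sub>R curve_deriv (curve_deriv f) t))) (at t within I)"
      by (rule linear_family_has_derivative[where L="\<lambda>s. frechet_derivative F (at (f s))", OF _ t a b])
         (use smooth_on_linear[OF F inS] in blast)
    then have "((\<lambda>s. frechet_derivative F (at (f s)) (curve_deriv f s)) has_vector_derivative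
       D2 F (f t) (curve_deriv f t) (curve_deriv f t) +
      frechet_derivative F (at (f t)) (curve_deriv (curve_deriv f) t)) (at t within ?A)"
      unfolding has_vector_derivative_def sub
      by (simp add: linear_scale[OF smooth_on_linear[OF F inS[OF t]]] linear_scale[OF D2_linear_left[OF F inS[OF t]]] scaleR_add_right)
    then show ?thesis
      using has_vector_derivative_cong_relatively_open[where f="curve_deriv (\<lambda>s. F (f s))"
          and g="\<lambda>s. frechet_derivative F (at (f s)) (curve_deriv f s)", OF I t vel] by blast
  qed
  show acc: "curve_deriv (curve_deriv (\<lambda>s. F (f s))) t =
      D2 F (f t) (curve_deriv f t) (curve_deriv f t) +
      frechet_derivative F (at (f t)) (curve_deriv (curve_deriv f) t)" if "t \<in> I" for t
    using curve_derivI[OF d2[OF that]] that IA by blast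
  note cont = C2_curve_on_continuous[OF f IA]
  have cc: "continuous_on I (\<lambda>s. k (f s))" if "continuous_on S k" for k :: "'a \<Rightarrow> 'b"
    using continuous_on_compose2[OF that cont(1) fS] .
  have "continuous_on I (\<lambda>t. D2 F (f t) (curve_deriv f t) (curve_deriv f t))"
  proof (rule linear_family_continuous_on[where L="\<lambda>t. D2 F (f t) (curve_deriv f t)"])
    show "linear (D2 F (f t) (curve_deriv f t))" if "t \<in> I" for t using D2_linear_right[OF F S inS[OF that]] .
    show "continuous_on I (\<lambda>t. D2 F (f t) (curve_deriv f t) i)" for i
      by (rule linear_family_continuous_on[where L="\<lambda>t u. D2 F (f t) u i"])
         (use D2_linear_left[OF F inS] cont cc[OF smooth_on_continuous_D2[OF F]] in auto)
  qed (rule cont)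
  moreover have "continuous_on I (\<lambda>t. frechet_derivative F (at (f t)) (curve_deriv (curve_deriv f) t))"
    by (rule linear_family_continuous_on)
       (use smooth_on_linear[OF F inS] cont cc[OF smooth_on_continuous_on[OF smooth_on_derivative[OF F]]] in auto)
  ultimately have "continuous_on I (\<lambda>t. D2 F (f t) (curve_deriv f t) (curve_deriv f t) +
      frechet_derivative F (at (f t)) (curve_deriv (curve_deriv f) t))" by (rule continuous_on_add)
  then have "continuous_on I (curve_deriv (curve_deriv (\<lambda>s. F (f s))))"
    using acc by (simp cong: continuous_on_cong)
  then show "C2_curve_on I (\<lambda>s. F (f s))"
    unfolding C2_curve_on_def using d1 d2 differentiableI_vector by blast
qed

section \<open>Conformal maps and connections in coordinates\<close>

text \<open>How far \<open>F\<close> is from being affine for the connections with Christoffel symbols \<open>\<Gamma>\<close> and \<open>\<Gamma>'\<close>. The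
  second derivative of \<open>F\<close> makes this a tensor; it vanishes iff \<open>\<Gamma>\<close> and \<open>\<Gamma>'\<close> are related by the
  transformation law of Christoffel symbols under \<open>F\<close>.\<close>

definition connection_defect ::
  "('a::euclidean_space \<Rightarrow> 'b::euclidean_space) \<Rightarrow> 'a \<Rightarrow> ('a \<Rightarrow> 'a \<Rightarrow> 'a) \<Rightarrow> ('b \<Rightarrow> 'b \<Rightarrow> 'b) \<Rightarrow> 'a \<Rightarrow> 'a \<Rightarrow> 'b"
where
  "connection_defect F x \<Gamma> \<Gamma>' w u =
     frechet_derivative F (at x) (\<Gamma> w u)
     - \<Gamma>' (frechet_derivative F (at x) w) (frechet_derivative F (at x) u) - D2 F x w u"

lemma bilinear_field_has_derivative:
  fixes H :: "'b::euclidean_space \<Rightarrow> 'b \<Rightarrow> 'b \<Rightarrow> real" and F :: "'a::euclidean_space \<Rightarrow> 'b"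
  assumes S: "x \<in> S" and F: "smooth_on S F" and oS: "open S"
    and Hb: "\<And>y. y \<in> S \<Longrightarrow> bilinear (H (F y))"
    and Hd: "\<And>a b. ((\<lambda>z. H z a b) has_derivative H' a b) (at (F x))"
  shows "((\<lambda>y. H (F y) (frechet_derivative F (at y) u) (frechet_derivative F (at y) v)) has_derivative
    (\<lambda>w. H' (frechet_derivative F (at x) u) (frechet_derivative F (at x) v) (frechet_derivative F (at x) w)
       + H (F x) (frechet_derivative F (at x) u) (D2 F x w v)
       + H (F x) (D2 F x w u) (frechet_derivative F (at x) v))) (at x)"
proof -
  let ?D = "\<lambda>y. frechet_derivative F (at y)"
  have at: "at x = at x within S" using at_within_open[OF S oS] by simp
  have l1: "linear (H (F y) a)" and l2: "linear (\<lambda>a. H (F y) a b)" if "y \<in> S" for y a b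
    using Hb[OF that] unfolding bilinear_def by auto
  have 0: "((\<lambda>y. H (F y) a b) has_derivative (\<lambda>w. H' a b (?D x w))) (at x within S)" for a b
    using has_derivative_compose[OF smooth_on_has_derivative[OF F S] Hd[of a b]] unfolding at .
  have 1: "((\<lambda>y. H (F y) a (?D y v)) has_derivative
     (\<lambda>w. H' a (?D x v) (?D x w) + H (F x) a (D2 F x w v))) (at x within S)" for a
    by (rule linear_family_has_derivative[where L="\<lambda>y. H (F y) a", OF l1 S 0])
       (use smooth_on_has_derivative2[OF F S] at in auto)
  show ?thesis
    using linear_family_has_derivative[where L="\<lambda>y a. H (F y) a (?D y v)", OF l2 S 1, of "\<lambda>y. ?D y u" "\<lambda>w. D2 F x w u"]
      smooth_on_has_derivative2[OF F S, of u] unfolding at by simp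
qed

text \<open>Both sides of the conformality relation are differentiated in direction \<open>w\<close>. Compatibility of the
  connections with \<open>G\<close> and \<open>H\<close> expresses the derivatives of the metrics by \<open>\<Gamma>\<close> and \<open>\<Gamma>'\<close>, and these
  terms combine with the second derivatives of \<open>F\<close> to the connection defect.\<close>

lemma conformal_connection_defect:
  fixes F :: "'a::euclidean_space \<Rightarrow> 'b::euclidean_space"
    and G :: "'a \<Rightarrow> 'a \<Rightarrow> 'a \<Rightarrow> real" and H :: "'b \<Rightarrow> 'b \<Rightarrow> 'b \<Rightarrow> real"
  assumes S: "x \<in> S" and F: "smooth_on S F" and oS: "open S"
    and conf: "\<And>y u v. y \<in> S \<Longrightarrow>
      H (F y) (frechet_derivative F (at y) u) (frechet_derivative F (at y) v) = lam y * G y u v"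
    and lam: "(lam has_derivative dlam) (at x)"
    and Gd: "\<And>u v. ((\<lambda>y. G y u v) has_derivative (\<lambda>w. G x (\<Gamma> w u) v + G x u (\<Gamma> w v))) (at x)"
    and Hb: "\<And>y. y \<in> S \<Longrightarrow> bilinear (H (F y))"
    and Hd: "\<And>a b. ((\<lambda>z. H z a b) has_derivative (\<lambda>w. H (F x) (\<Gamma>' w a) b + H (F x) a (\<Gamma>' w b))) (at (F x))"
  shows "H (F x) (connection_defect F x \<Gamma> \<Gamma>' w u) (frechet_derivative F (at x) v)
      + H (F x) (frechet_derivative F (at x) u) (connection_defect F x \<Gamma> \<Gamma>' w v) = - dlam w * G x u v"
proof -
  let ?D = "\<lambda>y. frechet_derivative F (at y)" and ?H = "H (F x)"
  have 1: "((\<lambda>y. lam y * G y u v) has_derivative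
     (\<lambda>w. lam x * (G x (\<Gamma> w u) v + G x u (\<Gamma> w v)) + dlam w * G x u v)) (at x)"
    by (rule has_derivative_mult[OF lam Gd])
  have 2: "((\<lambda>y. H (F y) (?D y u) (?D y v)) has_derivative
    (\<lambda>w. ?H (\<Gamma>' (?D x w) (?D x u)) (?D x v) + ?H (?D x u) (\<Gamma>' (?D x w) (?D x v))
       + ?H (?D x u) (D2 F x w v) + ?H (D2 F x w u) (?D x v))) (at x)"
    by (rule bilinear_field_has_derivative[OF S F oS Hb Hd])
  have 3: "((\<lambda>y. H (F y) (?D y u) (?D y v)) has_derivative
     (\<lambda>w. lam x * (G x (\<Gamma> w u) v + G x u (\<Gamma> w v)) + dlam w * G x u v)) (at x)"
    by (rule has_derivative_transform_within_open[OF 1 oS S]) (simp add: conf)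
  have "?H (\<Gamma>' (?D x w) (?D x u)) (?D x v) + ?H (?D x u) (\<Gamma>' (?D x w) (?D x v))
       + ?H (?D x u) (D2 F x w v) + ?H (D2 F x w u) (?D x v)
     = lam x * (G x (\<Gamma> w u) v + G x u (\<Gamma> w v)) + dlam w * G x u v"
    using fun_cong[OF has_derivative_unique[OF 2 3], of w] .
  moreover have "lam x * (G x (\<Gamma> w u) v + G x u (\<Gamma> w v)) =
     ?H (?D x (\<Gamma> w u)) (?D x v) + ?H (?D x u) (?D x (\<Gamma> w v))"
    by (simp add: conf[OF S] distrib_left)
  ultimately show ?thesis
    unfolding connection_defect_def
    by (simp add: bilinear_lsub[OF Hb[OF S]] bilinear_rsub[OF Hb[OF S]])
qed

text \<open>The argument behind the uniqueness of the Levi-Civita connection: going around the six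
  permutations of the arguments, \<open>T\<close> returns to its negative.\<close>

lemma symmetric_skew_trilinear_zero:
  fixes T :: "'a \<Rightarrow> 'a \<Rightarrow> 'a \<Rightarrow> real"
  assumes "\<And>w u v. T w u v = T u w v" and "\<And>w u v. T w u v + T w v u = 0"
  shows "T w u v = 0"
  using assms(1)[of w u v] assms(2)[of u w v] assms(1)[of u v w] assms(2)[of v u w]
    assms(1)[of v w u] assms(2)[of w v u] by linarith

lemma connection_defect_commute:
  fixes F :: "'a::euclidean_space \<Rightarrow> 'b::euclidean_space"
  assumes "x \<in> S" "smooth_on S F" "open S" "\<And>u v. \<Gamma> u v = \<Gamma> v u" "\<And>u v. \<Gamma>' u v = \<Gamma>' v u"
  shows "connection_defect F x \<Gamma> \<Gamma>' w u = connection_defect F x \<Gamma> \<Gamma>' u w"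
  unfolding connection_defect_def using D2_commute[OF assms(2,3,1)] assms(4,5) by metis

text \<open>If \<open>u\<close> and \<open>v\<close> have the same length for \<open>G\<close>, then \<open>u + v\<close> and \<open>u - v\<close> are orthogonal for \<open>G\<close>,
  hence for \<open>H\<close>, so that \<open>u\<close> and \<open>v\<close> have the same length for \<open>H\<close> too. By scaling, the quadratic forms
  are proportional, and polarisation gives the bilinear forms.\<close>

lemma conformal_linear_algebra:
  fixes G H :: "'a::real_vector \<Rightarrow> 'a \<Rightarrow> real"
  assumes G: "bilinear G" "\<And>u v. G u v = G v u" "\<And>u. u \<noteq> 0 \<Longrightarrow> G u u > 0"
    and H: "bilinear H" "\<And>u v. H u v = H v u"
    and orth: "\<And>u v. u \<noteq> 0 \<Longrightarrow> v \<noteq> 0 \<Longrightarrow> G u v = 0 \<Longrightarrow> H u v = 0"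
    and e: "e \<noteq> 0"
  shows "H u v = H e e / G e e * G u v"
proof -
  note bG = bilinear_ladd[OF G(1)] bilinear_radd[OF G(1)] bilinear_lsub[OF G(1)] bilinear_rsub[OF G(1)]
    bilinear_lmul[OF G(1)] bilinear_rmul[OF G(1)] bilinear_lzero[OF G(1)] bilinear_rzero[OF G(1)]
  note bH = bilinear_ladd[OF H(1)] bilinear_radd[OF H(1)] bilinear_lsub[OF H(1)] bilinear_rsub[OF H(1)]
    bilinear_lmul[OF H(1)] bilinear_rmul[OF H(1)] bilinear_lzero[OF H(1)] bilinear_rzero[OF H(1)]
  have Ge: "G e e > 0" using G(3) e .
  have eq: "H u u = H v v" if "G u u = G v v" for u v
  proof (cases "u + v = 0 \<or> u - v = 0")
    case True
    then have "u = - v \<or> u = v" by (auto simp: eq_neg_iff_add_eq_0)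
    then show ?thesis using bilinear_lneg[OF H(1)] bilinear_rneg[OF H(1)] by auto
  next
    case False
    have "G (u + v) (u - v) = 0" using that by (simp add: bG G(2)[of u v])
    then have "H (u + v) (u - v) = 0" using orth False by blast
    then show ?thesis by (simp add: bH H(2)[of u v])
  qed
  have q: "H u u = H e e / G e e * G u u" for u
  proof (cases "u = 0")
    case True then show ?thesis by (simp add: bG bH)
  next
    case False
    define r where "r = sqrt (G u u / G e e)"
    have r: "r * r = G u u / G e e" unfolding r_def using G(3)[OF False] Ge by simp
    have "G u u = G (r *\<^sub>R e) (r *\<^sub>R e)" using r Ge by (simp add: bG mult.assoc[symmetric])
    then have "H u u = H (r *\<^sub>R e) (r *\<^sub>R e)" by (rule eq)
    then show ?thesis using r by (simp add: bH mult.assoc[symmetric])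
  qed
  define k where "k = H e e / G e e"
  have "H u u + 2 * H u v + H v v = k * (G u u + 2 * G u v + G v v)"
    using q[of "u + v"] by (simp add: bG bH G(2)[of v u] H(2)[of v u] k_def[symmetric] ac_simps)
  moreover have "H u u = k * G u u" "H v v = k * G v v" using q unfolding k_def by blast+
  ultimately show ?thesis unfolding k_def[symmetric] by (simp add: algebra_simps)
qed

section \<open>Smooth maps in charts\<close>

definition local_rep :: "('m, 'e) chart \<Rightarrow> ('n, 'f) chart \<Rightarrow> ('m \<Rightarrow> 'n) \<Rightarrow> 'e \<Rightarrow> 'f" where
  "local_rep c d \<phi> = snd d \<circ> \<phi> \<circ> chart_inv c"

definition local_dom :: "('m, 'e) chart \<Rightarrow> ('n, 'f) chart \<Rightarrow> ('m \<Rightarrow> 'n) \<Rightarrow> 'e set" where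
  "local_dom c d \<phi> = snd c ` {p \<in> fst c. \<phi> p \<in> fst d}"

lemma local_rep_identity: "local_rep c d (\<lambda>p. p) = snd d \<circ> chart_inv c"
  by (auto simp: local_rep_def)

lemma charts_atD:
  assumes "c \<in> charts_at M p" shows "c \<in> atlas M" "p \<in> fst c"
  using assms by (auto simp: charts_at_def)

lemma chart_image_mem:
  assumes "c \<in> charts_at M p" shows "snd c p \<in> snd c ` fst c"
  using charts_atD[OF assms] by blast

lemma charts_atI:
  assumes "c \<in> atlas M" "p \<in> fst c" shows "c \<in> charts_at M p"
  using assms by (auto simp: charts_at_def)

lemma local_domI:
  assumes "c \<in> charts_at M p" "d \<in> charts_at N (\<phi> p)"
  shows "snd c p \<in> local_dom c d \<phi>"
  using assms by (auto simp: local_dom_def charts_at_def)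

lemma chart_openin:
  assumes "smooth_manifold M" "c \<in> atlas M" shows "openin (mtop M) (fst c)"
  using atlas_chart[OF assms] unfolding is_chart_def by blast

lemma charts_at_topspace:
  assumes "smooth_manifold M" "c \<in> charts_at M p" shows "p \<in> topspace (mtop M)"
  using chart_openin[OF assms(1)] charts_atD[OF assms(2)] openin_subset by blast

lemma charts_at_ex:
  assumes "smooth_manifold M" "p \<in> topspace (mtop M)" shows "\<exists>c. c \<in> charts_at M p"
  using assms unfolding smooth_manifold_def charts_at_def by blast

lemma chart_inv_chart:
  assumes "smooth_manifold M" "c \<in> charts_at M p" shows "chart_inv c (snd c p) = p"
  using chart_inv_simps(1)[OF atlas_chart[OF assms(1)]] charts_atD[OF assms(2)] by blast

lemma local_rep_at:
  assumes "smooth_manifold M" "c \<in> charts_at M p" shows "local_rep c d \<phi> (snd c p) = snd d (\<phi> p)"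
  using chart_inv_chart[OF assms] by (simp add: local_rep_def)

lemma smooth_map_identity:
  assumes "smooth_manifold M" shows "smooth_map M M (\<lambda>p. p)"
  unfolding smooth_map_def
proof (intro conjI ballI)
  show "continuous_map (mtop M) (mtop M) (\<lambda>p. p)" by simp
  fix c d assume cd: "c \<in> atlas M" "d \<in> atlas M"
  have "{p \<in> fst c. p \<in> fst d} = fst c \<inter> fst d" "snd d \<circ> (\<lambda>p. p) \<circ> chart_inv c = snd d \<circ> chart_inv c" by auto
  then show "smooth_on (snd c ` {p \<in> fst c. p \<in> fst d}) (snd d \<circ> (\<lambda>p. p) \<circ> chart_inv c)"
    using assms cd unfolding smooth_manifold_def by simp
qed

lemma smooth_map_topspace:
  assumes "smooth_map M N \<phi>" "p \<in> topspace (mtop M)" shows "\<phi> p \<in> topspace (mtop N)"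
  using assms unfolding smooth_map_def continuous_map_def by blast

lemma smooth_map_local_rep:
  assumes "smooth_map M N \<phi>" "c \<in> atlas M" "d \<in> atlas N"
  shows "smooth_on (local_dom c d \<phi>) (local_rep c d \<phi>)"
  using assms unfolding smooth_map_def local_rep_def local_dom_def by blast

lemma open_local_dom:
  assumes M: "smooth_manifold M" and N: "smooth_manifold N" and "smooth_map M N \<phi>" "c \<in> atlas M" "d \<in> atlas N"
  shows "open (local_dom c d \<phi>)"
proof -
  let ?V = "{p \<in> topspace (mtop M). \<phi> p \<in> fst d}"
  have "openin (mtop M) ?V"
    using assms(3) chart_openin[OF N assms(5)] openin_continuous_map_preimage unfolding smooth_map_def by blast
  from open_chart_image[OF atlas_chart[OF M assms(4)] this]
  have "open (snd c ` (fst c \<inter> ?V))" .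
  moreover have "fst c \<inter> ?V = {p \<in> fst c. \<phi> p \<in> fst d}"
    using openin_subset[OF chart_openin[OF M assms(4)]] by blast
  ultimately show ?thesis by (simp add: local_dom_def)
qed

context
  fixes M :: "('m, 'e::euclidean_space) manifold" and N :: "('n, 'f::euclidean_space) manifold" and \<phi>
  assumes M: "smooth_manifold M" and N: "smooth_manifold N" and \<phi>: "smooth_map M N \<phi>"
begin

lemma local_rep_has_derivative:
  assumes "c \<in> charts_at M p" "d \<in> charts_at N (\<phi> p)"
  shows "(local_rep c d \<phi> has_derivative frechet_derivative (local_rep c d \<phi>) (at (snd c p))) (at (snd c p))"
  using smooth_on_has_derivative[OF smooth_map_local_rep[OF \<phi> charts_atD(1)[OF assms(1)] charts_atD(1)[OF assms(2)]]
    local_domI[of c M p d N \<phi>, OF assms]] .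

lemma local_rep_derivative_linear:
  assumes "c \<in> charts_at M p" "d \<in> charts_at N (\<phi> p)"
  shows "linear (frechet_derivative (local_rep c d \<phi>) (at (snd c p)))"
  using has_derivative_linear[OF local_rep_has_derivative[OF assms]] .

end

text \<open>The composite \<open>\<omega>\<close> is a map of its own, tied to \<open>\<psi> \<circ> \<phi>\<close> only on the manifold: for a diffeomorphism
  and its inverse, the composite is the identity there and arbitrary elsewhere.\<close>

lemma local_rep_chain:
  fixes M :: "('m, 'e::euclidean_space) manifold" and N :: "('n, 'f::euclidean_space) manifold"
    and P :: "('k, 'h::euclidean_space) manifold"
  assumes M: "smooth_manifold M" and N: "smooth_manifold N" and P: "smooth_manifold P"
    and \<phi>: "smooth_map M N \<phi>" and \<psi>: "smooth_map N P \<psi>"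
    and \<omega>: "\<And>q. q \<in> topspace (mtop M) \<Longrightarrow> \<omega> q = \<psi> (\<phi> q)"
    and c: "c \<in> charts_at M p" and d: "d \<in> charts_at N (\<phi> p)" and e: "e \<in> charts_at P (\<psi> (\<phi> p))"
  shows "frechet_derivative (local_rep c e \<omega>) (at (snd c p)) a =
     frechet_derivative (local_rep d e \<psi>) (at (snd d (\<phi> p))) (frechet_derivative (local_rep c d \<phi>) (at (snd c p)) a)"
proof -
  note cM = charts_atD[OF c] and dN = charts_atD[OF d]
  have 1: "(local_rep d e \<psi> has_derivative frechet_derivative (local_rep d e \<psi>) (at (snd d (\<phi> p))))
     (at (local_rep c d \<phi> (snd c p)))"
    unfolding local_rep_at[OF M c] by (rule local_rep_has_derivative[OF N P \<psi> d e])
  have 2: "((\<lambda>x. local_rep d e \<psi> (local_rep c d \<phi> x)) has_derivative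
      (\<lambda>a. frechet_derivative (local_rep d e \<psi>) (at (snd d (\<phi> p))) (frechet_derivative (local_rep c d \<phi>) (at (snd c p)) a)))
     (at (snd c p))"
    by (rule has_derivative_compose[OF local_rep_has_derivative[OF M N \<phi> c d] 1])
  have "(local_rep c e \<omega> has_derivative
      (\<lambda>a. frechet_derivative (local_rep d e \<psi>) (at (snd d (\<phi> p))) (frechet_derivative (local_rep c d \<phi>) (at (snd c p)) a)))
     (at (snd c p))"
  proof (rule has_derivative_transform_within_open[OF 2 open_local_dom[OF M N \<phi> cM(1) dN(1)] local_domI[of c M p d N \<phi>, OF c d]])
    fix x assume "x \<in> local_dom c d \<phi>"
    then obtain q where q: "q \<in> fst c" "\<phi> q \<in> fst d" "x = snd c q" by (auto simp: local_dom_def)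
    have qc: "q = chart_inv c x" "\<phi> q = chart_inv d (snd d (\<phi> q))"
      using chart_inv_chart[OF M charts_atI[OF cM(1) q(1)]] chart_inv_chart[OF N charts_atI[OF dN(1) q(2)]] q(3) by auto
    have "q \<in> topspace (mtop M)" using charts_at_topspace[OF M charts_atI[OF cM(1) q(1)]] .
    then show "local_rep d e \<psi> (local_rep c d \<phi> x) = local_rep c e \<omega> x"
      unfolding local_rep_def using \<omega> qc by simp
  qed
  from frechet_derivative_at[OF this] show ?thesis by metis
qed

section \<open>Tangent spaces\<close>

lemma tangent_outside: "v \<in> tangent_space M p \<Longrightarrow> c \<notin> charts_at M p \<Longrightarrow> v c = 0"
  unfolding tangent_space_def by blast

lemma tangent_transition:
  assumes "v \<in> tangent_space M p" "c \<in> charts_at M p" "d \<in> charts_at M p"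
  shows "v d = frechet_derivative (local_rep c d (\<lambda>p. p)) (at (snd c p)) (v c)"
  using assms unfolding tangent_space_def local_rep_identity by blast

lemma tangent_space_lincomb:
  assumes M: "smooth_manifold M" and u: "u \<in> tangent_space M p" and v: "v \<in> tangent_space M p"
  shows "(\<lambda>c. r *\<^sub>R u c + s *\<^sub>R v c) \<in> tangent_space M p"
proof (cases "\<exists>c. c \<in> charts_at M p")
  case True
  then obtain c where c: "c \<in> charts_at M p" by blast
  show ?thesis
    using coord_vec_linear[OF M c, of r "u c" s "v c"] coord_vec_tangent[OF M c, of "r *\<^sub>R u c + s *\<^sub>R v c"]
      tangent_eq_coord_vec[OF M c u] tangent_eq_coord_vec[OF M c v] by metis
next
  case False
  then show ?thesis using tangent_outside[OF u] tangent_outside[OF v] unfolding tangent_space_def by auto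
qed

lemma tangent_zero: "(\<lambda>_. 0) \<in> tangent_space M p" if "smooth_manifold M" "v \<in> tangent_space M p"
  using tangent_space_lincomb[OF that(1) that(2) that(2), of 0 0] by simp

lemma pushforward_outside:
  "d \<notin> charts_at N (\<phi> p) \<Longrightarrow> pushforward M N \<phi> p v d = 0"
  by (simp add: pushforward_def Let_def)

context
  fixes M :: "('m, 'e::euclidean_space) manifold" and N :: "('n, 'f::euclidean_space) manifold" and \<phi>
  assumes M: "smooth_manifold M" and N: "smooth_manifold N" and \<phi>: "smooth_map M N \<phi>"
begin

text \<open>The chart selected by \<open>SOME\<close> in the definition may be replaced by any other one, since tangent
  vectors transform by the derivatives of chart changes.\<close>

lemma pushforward_apply:
  assumes c: "c \<in> charts_at M p" and v: "v \<in> tangent_space M p" and d: "d \<in> charts_at N (\<phi> p)"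
  shows "pushforward M N \<phi> p v d = frechet_derivative (local_rep c d \<phi>) (at (snd c p)) (v c)"
proof -
  define b where "b = (SOME c. c \<in> charts_at M p)"
  have b: "b \<in> charts_at M p" unfolding b_def using c by (rule someI)
  have "pushforward M N \<phi> p v d = frechet_derivative (local_rep b d \<phi>) (at (snd b p)) (v b)"
    using d unfolding pushforward_def Let_def b_def local_rep_def by simp
  also have "\<dots> = frechet_derivative (local_rep c d \<phi>) (at (snd c p))
      (frechet_derivative (local_rep b c (\<lambda>p. p)) (at (snd b p)) (v b))"
    by (rule local_rep_chain[OF M M N smooth_map_identity[OF M] \<phi> refl b c d])
  also have "frechet_derivative (local_rep b c (\<lambda>p. p)) (at (snd b p)) (v b) = v c"
    using tangent_transition[OF v b c] by simp
  finally show ?thesis .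
qed

lemma pushforward_eq_coord_vec:
  assumes c: "c \<in> charts_at M p" and v: "v \<in> tangent_space M p" and d: "d \<in> charts_at N (\<phi> p)"
  shows "pushforward M N \<phi> p v = coord_vec N d (\<phi> p) (frechet_derivative (local_rep c d \<phi>) (at (snd c p)) (v c))"
proof
  fix e
  show "pushforward M N \<phi> p v e = coord_vec N d (\<phi> p) (frechet_derivative (local_rep c d \<phi>) (at (snd c p)) (v c)) e"
  proof (cases "e \<in> charts_at N (\<phi> p)")
    case True
    have "pushforward M N \<phi> p v e = frechet_derivative (local_rep c e \<phi>) (at (snd c p)) (v c)"
      by (rule pushforward_apply[OF c v True])
    also have "\<dots> = frechet_derivative (local_rep d e (\<lambda>p. p)) (at (snd d (\<phi> p)))
        (frechet_derivative (local_rep c d \<phi>) (at (snd c p)) (v c))"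
      by (rule local_rep_chain[OF M N N \<phi> smooth_map_identity[OF N] refl c d True])
    finally show ?thesis using True by (simp add: coord_vec_def local_rep_identity)
  next
    case False
    then show ?thesis by (simp add: pushforward_outside coord_vec_def)
  qed
qed

lemma pushforward_tangent:
  assumes p: "p \<in> topspace (mtop M)" and v: "v \<in> tangent_space M p"
  shows "pushforward M N \<phi> p v \<in> tangent_space N (\<phi> p)"
proof -
  obtain c where c: "c \<in> charts_at M p" using charts_at_ex[OF M p] by blast
  obtain d where d: "d \<in> charts_at N (\<phi> p)" using charts_at_ex[OF N smooth_map_topspace[OF \<phi> p]] by blast
  show ?thesis using pushforward_eq_coord_vec[OF c v d] coord_vec_tangent[OF N d] by simp
qed

lemma pushforward_lincomb:
  assumes p: "p \<in> topspace (mtop M)" and u: "u \<in> tangent_space M p" and v: "v \<in> tangent_space M p"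
  shows "pushforward M N \<phi> p (\<lambda>c. r *\<^sub>R u c + s *\<^sub>R v c) =
    (\<lambda>d. r *\<^sub>R pushforward M N \<phi> p u d + s *\<^sub>R pushforward M N \<phi> p v d)"
proof
  fix d
  obtain c where c: "c \<in> charts_at M p" using charts_at_ex[OF M p] by blast
  show "pushforward M N \<phi> p (\<lambda>c. r *\<^sub>R u c + s *\<^sub>R v c) d =
    r *\<^sub>R pushforward M N \<phi> p u d + s *\<^sub>R pushforward M N \<phi> p v d"
  proof (cases "d \<in> charts_at N (\<phi> p)")
    case True
    note lin = local_rep_derivative_linear[OF M N \<phi> c True]
    show ?thesis
      by (simp add: pushforward_apply[OF c _ True] u v tangent_space_lincomb[OF M u v] linear_add[OF lin] linear_scale[OF lin])
  qed (simp add: pushforward_outside)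
qed

end

lemma pushforward_scale:
  assumes M: "smooth_manifold M" and N: "smooth_manifold N" and \<phi>: "smooth_map M N \<phi>"
   and p: "p \<in> topspace (mtop M)" and u: "u \<in> tangent_space M p"
  shows "pushforward M N \<phi> p (\<lambda>c. r *\<^sub>R u c) = (\<lambda>d. r *\<^sub>R pushforward M N \<phi> p u d)"
  using pushforward_lincomb[OF M N \<phi> p u u, of r 0] by simp

lemma pushforward_chain:
  fixes M :: "('m, 'e::euclidean_space) manifold" and N :: "('n, 'f::euclidean_space) manifold"
    and P :: "('k, 'h::euclidean_space) manifold"
  assumes M: "smooth_manifold M" and N: "smooth_manifold N" and \<phi>: "smooth_map M N \<phi>"
    and P: "smooth_manifold P" and \<psi>: "smooth_map N P \<psi>"
    and \<omega>: "\<And>q. q \<in> topspace (mtop M) \<Longrightarrow> \<omega> q = \<psi> (\<phi> q)" and s\<omega>: "smooth_map M P \<omega>"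
    and p: "p \<in> topspace (mtop M)" and v: "v \<in> tangent_space M p"
  shows "pushforward N P \<psi> (\<phi> p) (pushforward M N \<phi> p v) = pushforward M P \<omega> p v"
proof -
  obtain c where c: "c \<in> charts_at M p" using charts_at_ex[OF M p] by blast
  note q = smooth_map_topspace[OF \<phi> p]
  obtain d where d: "d \<in> charts_at N (\<phi> p)" using charts_at_ex[OF N q] by blast
  obtain e where e: "e \<in> charts_at P (\<psi> (\<phi> p))" using charts_at_ex[OF P smooth_map_topspace[OF \<psi> q]] by blast
  have e': "e \<in> charts_at P (\<omega> p)" using e \<omega>[OF p] by simp
  show ?thesis
    unfolding pushforward_eq_coord_vec[OF N P \<psi> d pushforward_tangent[OF M N \<phi> p v] e]
      pushforward_eq_coord_vec[OF M P s\<omega> c v e'] pushforward_apply[OF M N \<phi> c v d]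
    using local_rep_chain[OF M N P \<phi> \<psi> \<omega> c d e, of "v c"] \<omega>[OF p] by simp
qed

lemma pushforward_identity:
  assumes M: "smooth_manifold M" and p: "p \<in> topspace (mtop M)" and v: "v \<in> tangent_space M p"
  shows "pushforward M M (\<lambda>p. p) p v = v"
proof -
  obtain c where c: "c \<in> charts_at M p" using charts_at_ex[OF M p] by blast
  show ?thesis
    using pushforward_eq_coord_vec[OF M M smooth_map_identity[OF M] c v c] tangent_eq_coord_vec[OF M c v]
      tangent_transition[OF v c c] by simp
qed

section \<open>Metrics\<close>

context
  fixes M :: "('m, 'e::euclidean_space) manifold" and g :: "('m, 'e) metric"
  assumes M: "smooth_manifold M" and g: "riemannian_metric M g"
begin

lemma metric_eq_coord:
  assumes c: "c \<in> charts_at M p" and "u \<in> tangent_space M p" "v \<in> tangent_space M p"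
  shows "g p u v = metric_coord M g c (snd c p) (u c) (v c)"
  unfolding metric_coord_def chart_inv_chart[OF M c]
  using tangent_eq_coord_vec[OF M c] assms by metis

lemma metric_commute:
  assumes "p \<in> topspace (mtop M)" "u \<in> tangent_space M p" "v \<in> tangent_space M p"
  shows "g p u v = g p v u"
  using g assms unfolding riemannian_metric_def by blast

lemma metric_lincomb_left:
  assumes "p \<in> topspace (mtop M)" "u \<in> tangent_space M p" "v \<in> tangent_space M p" "w \<in> tangent_space M p"
  shows "g p (\<lambda>c. r *\<^sub>R u c + s *\<^sub>R v c) w = r * g p u w + s * g p v w"
  using g assms unfolding riemannian_metric_def by blast

lemma metric_lincomb_right:
  assumes "p \<in> topspace (mtop M)" "u \<in> tangent_space M p" "v \<in> tangent_space M p" "w \<in> tangent_space M p"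
  shows "g p w (\<lambda>c. r *\<^sub>R u c + s *\<^sub>R v c) = r * g p w u + s * g p w v"
  using metric_lincomb_left[OF assms] metric_commute[OF assms(1)] assms tangent_space_lincomb[OF M] by simp

lemma metric_scale:
  assumes "p \<in> topspace (mtop M)" "u \<in> tangent_space M p" "w \<in> tangent_space M p"
  shows "g p (\<lambda>c. r *\<^sub>R u c) w = r * g p u w" "g p w (\<lambda>c. r *\<^sub>R u c) = r * g p w u"
  using metric_lincomb_left[OF assms(1,2,2,3), of r 0] metric_lincomb_right[OF assms(1,2,2,3), of r 0] by simp_all

lemma metric_positive:
  assumes "p \<in> topspace (mtop M)" "u \<in> tangent_space M p" "u \<noteq> (\<lambda>_. 0)"
  shows "g p u u > 0"
  using g assms unfolding riemannian_metric_def by blast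

lemma metric_zero:
  assumes "p \<in> topspace (mtop M)" "u \<in> tangent_space M p"
  shows "g p u (\<lambda>_. 0) = 0" "g p (\<lambda>_. 0) u = 0"
  using metric_scale[OF assms(1,2,2), of 0] by simp_all

lemma christoffel_levi_civita:
  assumes "c \<in> atlas M" "x \<in> snd c ` fst c"
  shows "is_levi_civita M g c x (christoffel M g c x)"
  unfolding christoffel_def by (rule theI'[OF levi_civita_ex1[OF M g assms]])

lemma christoffel_commute:
  assumes "c \<in> atlas M" "x \<in> snd c ` fst c"
  shows "christoffel M g c x u v = christoffel M g c x v u"
  using christoffel_levi_civita[OF assms] unfolding is_levi_civita_def by blast

lemma christoffel_bilinear:
  assumes "c \<in> atlas M" "x \<in> snd c ` fst c"
  shows "bilinear (christoffel M g c x)"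
  using christoffel_levi_civita[OF assms] unfolding is_levi_civita_def by blast

lemma metric_coord_derivative:
  assumes "c \<in> atlas M" "x \<in> snd c ` fst c"
  shows "frechet_derivative (\<lambda>y. metric_coord M g c y u v) (at x) w =
        metric_coord M g c x (christoffel M g c x w u) v + metric_coord M g c x u (christoffel M g c x w v)"
  using christoffel_levi_civita[OF assms] unfolding is_levi_civita_def by blast

lemma metric_coord_has_derivative:
  assumes "c \<in> atlas M" "x \<in> snd c ` fst c"
  shows "((\<lambda>y. metric_coord M g c y u v) has_derivative (\<lambda>w. 
        metric_coord M g c x (christoffel M g c x w u) v + metric_coord M g c x u (christoffel M g c x w v))) (at x)"
  using metric_coord_deriv[OF M g assms, of u v] metric_coord_derivative[OF assms] by simp

end

lemma metric_coord_pullback: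
  assumes M: "smooth_manifold M" and N: "smooth_manifold N" and \<phi>: "smooth_map M N \<phi>"
    and c: "c \<in> charts_at M p" and d: "d \<in> charts_at N (\<phi> p)"
  shows "metric_coord N h d (snd d (\<phi> p)) (frechet_derivative (local_rep c d \<phi>) (at (snd c p)) a)
     (frechet_derivative (local_rep c d \<phi>) (at (snd c p)) b) =
     h (\<phi> p) (pushforward M N \<phi> p (coord_vec M c p a)) (pushforward M N \<phi> p (coord_vec M c p b))"
  unfolding metric_coord_def chart_inv_chart[OF N d]
    pushforward_eq_coord_vec[OF M N \<phi> c coord_vec_tangent[OF M c] d] coord_vec_self[OF M c] ..

section \<open>Diffeomorphisms with their inverses\<close>

text \<open>A diffeomorphism together with its inverse. The pair is symmetric in \<open>M\<close> and \<open>N\<close>, whereas applying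
  \<open>inv_into\<close> twice gives back the original map only on the manifold.\<close>

definition mutually_inverse ::
  "('m, 'e::euclidean_space) manifold \<Rightarrow> ('n, 'f::euclidean_space) manifold \<Rightarrow> ('m \<Rightarrow> 'n) \<Rightarrow> ('n \<Rightarrow> 'm) \<Rightarrow> bool"
where
  "mutually_inverse M N \<phi> \<psi> \<longleftrightarrow> smooth_map M N \<phi> \<and> smooth_map N M \<psi> \<and>
     (\<forall>p\<in>topspace (mtop M). \<psi> (\<phi> p) = p) \<and> (\<forall>q\<in>topspace (mtop N). \<phi> (\<psi> q) = q)"

lemma mutually_inverse_smooth: "mutually_inverse M N \<phi> \<psi> \<Longrightarrow> smooth_map M N \<phi>"
  unfolding mutually_inverse_def by blast

lemma mutually_inverse_sym: "mutually_inverse M N \<phi> \<psi> \<Longrightarrow> mutually_inverse N M \<psi> \<phi>"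
  unfolding mutually_inverse_def by blast

lemma mutually_inverse_identity:
  "smooth_manifold M \<Longrightarrow> mutually_inverse M M (\<lambda>p. p) (\<lambda>p. p)"
  unfolding mutually_inverse_def using smooth_map_identity by blast

lemma diffeomorphism_mutually_inverse:
  assumes "diffeomorphism M N \<phi>"
  shows "mutually_inverse M N \<phi> (inv_into (topspace (mtop M)) \<phi>)"
  using assms unfolding diffeomorphism_def mutually_inverse_def
  by (auto simp: bij_betw_inv_into_left bij_betw_inv_into_right)

lemma pushforward_inverse:
  fixes M :: "('m, 'e::euclidean_space) manifold" and N :: "('n, 'f::euclidean_space) manifold"
  assumes M: "smooth_manifold M" and N: "smooth_manifold N" and inv: "mutually_inverse M N \<phi> \<psi>"
    and p: "p \<in> topspace (mtop M)" and v: "v \<in> tangent_space M p"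
  shows "pushforward N M \<psi> (\<phi> p) (pushforward M N \<phi> p v) = v"
proof -
  have i: "smooth_map M N \<phi>" "smooth_map N M \<psi>" "\<And>q. q \<in> topspace (mtop M) \<Longrightarrow> q = \<psi> (\<phi> q)"
    using inv unfolding mutually_inverse_def by auto
  show ?thesis
    using pushforward_chain[OF M N i(1) M i(2,3) smooth_map_identity[OF M] p v] pushforward_identity[OF M p v]
    by simp
qed

lemma pushforward_nonzero:
  fixes M :: "('m, 'e::euclidean_space) manifold" and N :: "('n, 'f::euclidean_space) manifold"
  assumes M: "smooth_manifold M" and N: "smooth_manifold N" and inv: "mutually_inverse M N \<phi> \<psi>"
    and p: "p \<in> topspace (mtop M)" and v: "v \<in> tangent_space M p" "v \<noteq> (\<lambda>_. 0)"
  shows "pushforward M N \<phi> p v \<noteq> (\<lambda>_. 0)"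
proof
  assume 0: "pushforward M N \<phi> p v = (\<lambda>_. 0)"
  have "pushforward M N \<phi> p (\<lambda>_. 0) = (\<lambda>_. 0)"
    using pushforward_scale[OF M N mutually_inverse_smooth[OF inv] p v(1), of 0] by simp
  then show False
    using 0 v(2) pushforward_inverse[OF M N inv p v(1)] pushforward_inverse[OF M N inv p tangent_zero[OF M v(1)]] by simp
qed

lemma local_rep_derivative_surj:
  fixes M :: "('m, 'e::euclidean_space) manifold" and N :: "('n, 'f::euclidean_space) manifold"
  assumes M: "smooth_manifold M" and N: "smooth_manifold N" and inv: "mutually_inverse M N \<phi> \<psi>"
    and c: "c \<in> charts_at M p" and d: "d \<in> charts_at N (\<phi> p)"
  shows "\<exists>u. frechet_derivative (local_rep c d \<phi>) (at (snd c p)) u = z"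
proof -
  have p: "p \<in> topspace (mtop M)" using charts_at_topspace[OF M c] .
  have i: "smooth_map M N \<phi>" "smooth_map N M \<psi>" "\<And>q. q \<in> topspace (mtop N) \<Longrightarrow> q = \<phi> (\<psi> q)" "\<psi> (\<phi> p) = p"
    using inv p unfolding mutually_inverse_def by auto
  have c': "c \<in> charts_at M (\<psi> (\<phi> p))" and d': "d \<in> charts_at N (\<phi> (\<psi> (\<phi> p)))" using c d i(4) by auto
  have "frechet_derivative (local_rep d d (\<lambda>q. q)) (at (snd d (\<phi> p))) z =
     frechet_derivative (local_rep c d \<phi>) (at (snd c (\<psi> (\<phi> p))))
       (frechet_derivative (local_rep d c \<psi>) (at (snd d (\<phi> p))) z)"
    by (rule local_rep_chain[OF N M N i(2,1,3) d c' d'])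
  then show ?thesis using transition_self[OF N d, of z] i(4) unfolding local_rep_identity i(4) by metis
qed

section \<open>Curves in charts\<close>

lemma C2_curves_iff:
  "\<gamma> \<in> C2_curves M \<longleftrightarrow> \<gamma> \<in> {0..1} \<rightarrow>\<^sub>E topspace (mtop M) \<and>
     continuous_map (top_of_set {0..1}) (mtop M) \<gamma> \<and>
     (\<forall>c\<in>atlas M. C2_curve_on {t \<in> {0..1}. \<gamma> t \<in> fst c} (snd c \<circ> \<gamma>))"
  unfolding C2_curves_def C2_curve_on_def Let_def by blast

lemma openin_curve_preimage:
  assumes "continuous_map (top_of_set {0..1::real}) X \<gamma>" "openin X U"
  shows "openin (top_of_set {0..1}) {t \<in> {0..1}. \<gamma> t \<in> U}"
  using openin_continuous_map_preimage[OF assms] by simp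

lemma C2_curves_topspace:
  assumes "\<gamma> \<in> C2_curves M" "t \<in> {0..1}" shows "\<gamma> t \<in> topspace (mtop M)"
  using assms unfolding C2_curves_iff by auto

lemma velocity_apply:
  "c \<in> charts_at M (\<gamma> t) \<Longrightarrow> velocity M \<gamma> t c = curve_deriv (snd c \<circ> \<gamma>) t"
  by (simp add: velocity_def)

abbreviation acceleration ::
  "('m, 'e::euclidean_space) manifold \<Rightarrow> ('m, 'e) metric \<Rightarrow> (real \<Rightarrow> 'm) \<Rightarrow> real \<Rightarrow> ('m, 'e) tvec" where
  "acceleration M g \<gamma> \<equiv> cov_deriv M g \<gamma> (velocity M \<gamma>)"

lemma acceleration_apply:
  fixes M :: "('m, 'e::euclidean_space) manifold"
  assumes M: "smooth_manifold M" and \<gamma>: "\<gamma> \<in> C2_curves M" and t: "t \<in> {0..1}" and c: "c \<in> charts_at M (\<gamma> t)"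
  shows "acceleration M g \<gamma> t c = curve_deriv (curve_deriv (snd c \<circ> \<gamma>)) t
     + christoffel M g c (snd c (\<gamma> t)) (velocity M \<gamma> t c) (velocity M \<gamma> t c)"
proof -
  note cM = charts_atD[OF c]
  let ?I = "{t \<in> {0..1}. \<gamma> t \<in> fst c}"
  have I: "openin (top_of_set {0..1}) ?I"
    using openin_curve_preimage[OF _ chart_openin[OF M cM(1)]] \<gamma> unfolding C2_curves_iff by blast
  have "curve_deriv (\<lambda>s. velocity M \<gamma> s c) t = curve_deriv (curve_deriv (snd c \<circ> \<gamma>)) t"
    by (rule curve_deriv_cong[OF I]) (use t cM in \<open>auto simp: velocity_def charts_at_def\<close>)
  then show ?thesis using c by (simp add: cov_deriv_def)
qed

context
  fixes M :: "('m, 'e::euclidean_space) manifold" and N :: "('n, 'f::euclidean_space) manifold"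
    and \<phi> :: "'m \<Rightarrow> 'n" and \<gamma> :: "real \<Rightarrow> 'm"
  assumes M: "smooth_manifold M" and N: "smooth_manifold N" and \<phi>: "smooth_map M N \<phi>" and \<gamma>: "\<gamma> \<in> C2_curves M"
begin

lemma compose_continuous: "continuous_map (top_of_set {0..1}) (mtop N) (compose {0..1} \<phi> \<gamma>)"
proof -
  have "continuous_map (top_of_set {0..1}) (mtop N) (\<phi> \<circ> \<gamma>)"
    using \<gamma> \<phi> continuous_map_compose unfolding C2_curves_iff smooth_map_def by blast
  then show ?thesis by (rule continuous_map_eq) (simp add: compose_def)
qed

lemma compose_in_charts:
  fixes c d
  assumes c: "c \<in> atlas M" and d: "d \<in> atlas N"
  defines "I \<equiv> {t \<in> {0..1}. \<gamma> t \<in> fst c \<and> \<phi> (\<gamma> t) \<in> fst d}"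
  shows "openin (top_of_set {0..1}) I"
    and "s \<in> I \<Longrightarrow> (snd d \<circ> compose {0..1} \<phi> \<gamma>) s = local_rep c d \<phi> ((snd c \<circ> \<gamma>) s)"
    and "(snd c \<circ> \<gamma>) ` I \<subseteq> local_dom c d \<phi>"
    and "C2_curve_on I (snd c \<circ> \<gamma>)"
proof -
  have 1: "openin (top_of_set {0..1}) {t \<in> {0..1}. \<gamma> t \<in> fst c}"
    using openin_curve_preimage[OF _ chart_openin[OF M c]] \<gamma> unfolding C2_curves_iff by blast
  have 2: "openin (top_of_set {0..1}) {t \<in> {0..1}. compose {0..1} \<phi> \<gamma> t \<in> fst d}"
    by (rule openin_curve_preimage[OF compose_continuous chart_openin[OF N d]])
  have "I = {t \<in> {0..1}. \<gamma> t \<in> fst c} \<inter> {t \<in> {0..1}. compose {0..1} \<phi> \<gamma> t \<in> fst d}"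
    by (auto simp: I_def compose_def)
  then show "openin (top_of_set {0..1}) I" using openin_Int[OF 1 2] by simp
  show "(snd d \<circ> compose {0..1} \<phi> \<gamma>) s = local_rep c d \<phi> ((snd c \<circ> \<gamma>) s)" if "s \<in> I"
  proof -
    have "\<gamma> s \<in> fst c" "s \<in> {0..1}" using that by (auto simp: I_def)
    then show ?thesis using local_rep_at[OF M charts_atI[where p="\<gamma> s", OF c], of d \<phi>] by (simp add: compose_def)
  qed
  show "(snd c \<circ> \<gamma>) ` I \<subseteq> local_dom c d \<phi>" by (auto simp: I_def local_dom_def)
  show "C2_curve_on I (snd c \<circ> \<gamma>)"
    by (rule C2_curve_on_subset[where J="{t \<in> {0..1}. \<gamma> t \<in> fst c}"])
       (use \<gamma> c in \<open>auto simp: C2_curves_iff I_def\<close>)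
qed

lemma compose_C2_on:
  assumes c: "c \<in> atlas M" and d: "d \<in> atlas N"
  shows "C2_curve_on {t \<in> {0..1}. \<gamma> t \<in> fst c \<and> \<phi> (\<gamma> t) \<in> fst d} (snd d \<circ> compose {0..1} \<phi> \<gamma>)"
  using C2_curve_on_cong[where f="snd d \<circ> compose {0..1} \<phi> \<gamma>" and g="\<lambda>s. local_rep c d \<phi> ((snd c \<circ> \<gamma>) s)",
      OF compose_in_charts(1,2)[OF c d]]
    C2_chain[OF compose_in_charts(1,4)[OF c d] smooth_map_local_rep[OF \<phi> c d] open_local_dom[OF M N \<phi> c d]
       compose_in_charts(3)[OF c d]] by blast

lemma compose_C2_curves: "compose {0..1} \<phi> \<gamma> \<in> C2_curves N"
  unfolding C2_curves_iff
proof (intro conjI ballI compose_continuous)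
  show "compose {0..1} \<phi> \<gamma> \<in> {0..1} \<rightarrow>\<^sub>E topspace (mtop N)"
    using C2_curves_topspace[OF \<gamma>] smooth_map_topspace[OF \<phi>] by (auto simp: compose_def)
  fix d assume d: "d \<in> atlas N"
  show "C2_curve_on {t \<in> {0..1}. compose {0..1} \<phi> \<gamma> t \<in> fst d} (snd d \<circ> compose {0..1} \<phi> \<gamma>)"
  proof (rule C2_curve_on_locally)
    fix t assume t: "t \<in> {t \<in> {0..1}. compose {0..1} \<phi> \<gamma> t \<in> fst d}"
    then obtain c where c: "c \<in> charts_at M (\<gamma> t)" using charts_at_ex[OF M C2_curves_topspace[OF \<gamma>]] by blast
    note cM = charts_atD[OF c]
    show "\<exists>I. openin (top_of_set {0..1}) I \<and> t \<in> I \<and> C2_curve_on I (snd d \<circ> compose {0..1} \<phi> \<gamma>)"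
      using compose_in_charts(1)[OF cM(1) d] compose_C2_on[OF cM(1) d] t cM(2)
      by (intro exI[of _ "{t \<in> {0..1}. \<gamma> t \<in> fst c \<and> \<phi> (\<gamma> t) \<in> fst d}"]) (auto simp: compose_def)
  qed
qed

context
  fixes t c d
  assumes t: "t \<in> {0..1}" and c: "c \<in> charts_at M (\<gamma> t)" and d: "d \<in> charts_at N (\<phi> (\<gamma> t))"
begin

lemma velocity_compose_coord:
  "velocity N (compose {0..1} \<phi> \<gamma>) t d =
     frechet_derivative (local_rep c d \<phi>) (at (snd c (\<gamma> t))) (velocity M \<gamma> t c)"
proof -
  note cM = charts_atD[OF c] and dN = charts_atD[OF d]
  note cd = compose_in_charts[OF cM(1) dN(1)]
  have tI: "t \<in> {t \<in> {0..1}. \<gamma> t \<in> fst c \<and> \<phi> (\<gamma> t) \<in> fst d}" using t cM dN by blast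
  have d': "d \<in> charts_at N (compose {0..1} \<phi> \<gamma> t)" using d t by (simp add: compose_def)
  have "velocity N (compose {0..1} \<phi> \<gamma>) t d = curve_deriv (\<lambda>s. local_rep c d \<phi> ((snd c \<circ> \<gamma>) s)) t"
    unfolding velocity_apply[where \<gamma>="compose {0..1} \<phi> \<gamma>" and t=t, OF d'] by (rule curve_deriv_cong[OF cd(1) tI cd(2)])
  also have "\<dots> = frechet_derivative (local_rep c d \<phi>) (at ((snd c \<circ> \<gamma>) t)) (curve_deriv (snd c \<circ> \<gamma>) t)"
    by (rule C2_chain_velocity[OF cd(1,4) smooth_map_local_rep[OF \<phi> cM(1) dN(1)] open_local_dom[OF M N \<phi> cM(1) dN(1)]
       cd(3) tI])
  finally show ?thesis by (simp add: velocity_apply[where \<gamma>=\<gamma> and t=t, OF c])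
qed

text \<open>The coordinate acceleration picks up the second derivative of the local representation, and each
  covariant derivative adds its Christoffel term; what remains besides the differential is the
  connection defect at the velocity.\<close>

lemma acceleration_compose_coord:
  "acceleration N h (compose {0..1} \<phi> \<gamma>) t d =
     frechet_derivative (local_rep c d \<phi>) (at (snd c (\<gamma> t))) (acceleration M g \<gamma> t c)
     - connection_defect (local_rep c d \<phi>) (snd c (\<gamma> t)) (christoffel M g c (snd c (\<gamma> t)))
         (christoffel N h d (snd d (\<phi> (\<gamma> t)))) (velocity M \<gamma> t c) (velocity M \<gamma> t c)"
proof -
  note cM = charts_atD[OF c] and dN = charts_atD[OF d]
  note cd = compose_in_charts[OF cM(1) dN(1)]
  let ?I = "{t \<in> {0..1}. \<gamma> t \<in> fst c \<and> \<phi> (\<gamma> t) \<in> fst d}"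
  have tI: "t \<in> ?I" using t cM dN by blast
  have d': "d \<in> charts_at N (compose {0..1} \<phi> \<gamma> t)" using d t by (simp add: compose_def)
  let ?F = "local_rep c d \<phi>" and ?f = "snd c \<circ> \<gamma>"
  have 1: "curve_deriv (snd d \<circ> compose {0..1} \<phi> \<gamma>) s = curve_deriv (\<lambda>s. ?F (?f s)) s" if "s \<in> ?I" for s
    by (rule curve_deriv_cong[OF cd(1) that cd(2)])
  have "curve_deriv (curve_deriv (snd d \<circ> compose {0..1} \<phi> \<gamma>)) t = curve_deriv (curve_deriv (\<lambda>s. ?F (?f s))) t"
    by (rule curve_deriv_cong[OF cd(1) tI 1])
  also have "\<dots> = D2 ?F (?f t) (curve_deriv ?f t) (curve_deriv ?f t) +
      frechet_derivative ?F (at (?f t)) (curve_deriv (curve_deriv ?f) t)"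
    by (rule C2_chain_acceleration[OF cd(1,4) smooth_map_local_rep[OF \<phi> cM(1) dN(1)]
       open_local_dom[OF M N \<phi> cM(1) dN(1)] cd(3) tI])
  finally have 2: "curve_deriv (curve_deriv (snd d \<circ> compose {0..1} \<phi> \<gamma>)) t =
      D2 ?F (snd c (\<gamma> t)) (velocity M \<gamma> t c) (velocity M \<gamma> t c) +
      frechet_derivative ?F (at (snd c (\<gamma> t))) (curve_deriv (curve_deriv ?f) t)"
    by (simp add: velocity_apply[where \<gamma>=\<gamma> and t=t, OF c])
  show ?thesis
    unfolding acceleration_apply[OF N compose_C2_curves t d'] 2 acceleration_apply[OF M \<gamma> t c]
      velocity_compose_coord connection_defect_def
    using t by (simp add: compose_def linear_add[OF local_rep_derivative_linear[OF M N \<phi> c d]])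
qed

end

end

section \<open>Conformal maps between Riemannian manifolds\<close>

lemma metric_coord_conformal:
  fixes M :: "('m, 'e::euclidean_space) manifold" and N :: "('n, 'f::euclidean_space) manifold"
  assumes M: "smooth_manifold M" and N: "smooth_manifold N" and \<phi>: "smooth_map M N \<phi>"
    and conf: "\<And>p u v. p \<in> topspace (mtop M) \<Longrightarrow> u \<in> tangent_space M p \<Longrightarrow> v \<in> tangent_space M p \<Longrightarrow>
       h (\<phi> p) (pushforward M N \<phi> p u) (pushforward M N \<phi> p v) = lam p * g p u v"
    and c: "c \<in> atlas M" and d: "d \<in> atlas N" and y: "y \<in> local_dom c d \<phi>"
  shows "metric_coord N h d (local_rep c d \<phi> y) (frechet_derivative (local_rep c d \<phi>) (at y) u) (frechet_derivative (local_rep c d \<phi>) (at y) v) =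
     lam (chart_inv c y) * metric_coord M g c y u v"
proof -
  obtain q where q: "c \<in> charts_at M q" "d \<in> charts_at N (\<phi> q)" "y = snd c q"
    using y c d by (auto simp: local_dom_def charts_at_def)
  show ?thesis
    unfolding q(3) local_rep_at[OF M q(1)] metric_coord_pullback[OF M N \<phi> q(1,2)] chart_inv_chart[OF M q(1)]
      metric_coord_def[of M g]
    by (rule conf[OF charts_at_topspace[OF M q(1)] coord_vec_tangent[OF M q(1)] coord_vec_tangent[OF M q(1)]])
qed

lemma metric_coord_local_rep_bilinear:
  fixes M :: "('m, 'e::euclidean_space) manifold" and N :: "('n, 'f::euclidean_space) manifold"
  assumes M: "smooth_manifold M" and N: "smooth_manifold N" and h: "riemannian_metric N h"
    and c: "c \<in> atlas M" and d: "d \<in> atlas N" and y: "y \<in> local_dom c d \<phi>"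
  shows "bilinear (metric_coord N h d (local_rep c d \<phi> y))"
proof -
  obtain q where q: "c \<in> charts_at M q" "d \<in> charts_at N (\<phi> q)" "y = snd c q"
    using y c d by (auto simp: local_dom_def charts_at_def)
  show ?thesis unfolding q(3) local_rep_at[OF M q(1)]
    by (rule metric_coord_bilinear[OF N h d chart_image_mem[OF q(2)]])
qed

lemma conformal_defect:
  fixes M :: "('m, 'e::euclidean_space) manifold" and N :: "('n, 'f::euclidean_space) manifold"
  assumes M: "smooth_manifold M" and g: "riemannian_metric M g" and N: "smooth_manifold N" and h: "riemannian_metric N h"
    and \<phi>: "smooth_map M N \<phi>"
    and conf: "\<And>p u v. p \<in> topspace (mtop M) \<Longrightarrow> u \<in> tangent_space M p \<Longrightarrow> v \<in> tangent_space M p \<Longrightarrow>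
       h (\<phi> p) (pushforward M N \<phi> p u) (pushforward M N \<phi> p v) = lam p * g p u v"
    and c: "c \<in> charts_at M p" and d: "d \<in> charts_at N (\<phi> p)"
    and lam: "((\<lambda>y. lam (chart_inv c y)) has_derivative dlam) (at (snd c p))"
  defines "DF \<equiv> frechet_derivative (local_rep c d \<phi>) (at (snd c p))"
    and "E \<equiv> connection_defect (local_rep c d \<phi>) (snd c p) (christoffel M g c (snd c p)) (christoffel N h d (snd d (\<phi> p)))"
    and "H \<equiv> metric_coord N h d (snd d (\<phi> p))"
  shows "H (E w u) (DF v) + H (DF u) (E w v) = - dlam w * metric_coord M g c (snd c p) u v"
proof -
  note cM = charts_atD[OF c] and dN = charts_atD[OF d]
  let ?F = "local_rep c d \<phi>" and ?S = "local_dom c d \<phi>"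
  have Fp: "?F (snd c p) = snd d (\<phi> p)" by (rule local_rep_at[OF M c])
  have "metric_coord N h d (?F (snd c p)) (connection_defect ?F (snd c p) (christoffel M g c (snd c p)) (christoffel N h d (snd d (\<phi> p))) w u)
       (frechet_derivative ?F (at (snd c p)) v)
     + metric_coord N h d (?F (snd c p)) (frechet_derivative ?F (at (snd c p)) u)
        (connection_defect ?F (snd c p) (christoffel M g c (snd c p)) (christoffel N h d (snd d (\<phi> p))) w v)
     = - dlam w * metric_coord M g c (snd c p) u v"
  proof (rule conformal_connection_defect[where lam="\<lambda>y. lam (chart_inv c y)"])
    show "snd c p \<in> ?S" using local_domI[of c M p d N \<phi>, OF c d] .
    show "smooth_on ?S ?F" by (rule smooth_map_local_rep[OF \<phi> cM(1) dN(1)])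
    show "open ?S" by (rule open_local_dom[OF M N \<phi> cM(1) dN(1)])
    show "((\<lambda>y. metric_coord M g c y u v) has_derivative (\<lambda>w.
        metric_coord M g c (snd c p) (christoffel M g c (snd c p) w u) v +
        metric_coord M g c (snd c p) u (christoffel M g c (snd c p) w v))) (at (snd c p))" for u v
      by (rule metric_coord_has_derivative[OF M g cM(1) chart_image_mem[OF c]])
    show "((\<lambda>z. metric_coord N h d z a b) has_derivative (\<lambda>w.
        metric_coord N h d (?F (snd c p)) (christoffel N h d (snd d (\<phi> p)) w a) b +
        metric_coord N h d (?F (snd c p)) a (christoffel N h d (snd d (\<phi> p)) w b))) (at (?F (snd c p)))" for a b
      unfolding Fp by (rule metric_coord_has_derivative[OF N h dN(1) chart_image_mem[OF d]])
  qed (use metric_coord_conformal[where h=h and lam=lam and g=g, OF M N \<phi> conf cM(1) dN(1)]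
      metric_coord_local_rep_bilinear[OF M N h cM(1) dN(1)] lam in auto)
  then show ?thesis unfolding Fp E_def H_def DF_def .
qed

lemma defect_commute:
  fixes M :: "('m, 'e::euclidean_space) manifold" and N :: "('n, 'f::euclidean_space) manifold"
  assumes M: "smooth_manifold M" and g: "riemannian_metric M g" and N: "smooth_manifold N" and h: "riemannian_metric N h"
    and \<phi>: "smooth_map M N \<phi>"
    and c: "c \<in> charts_at M p" and d: "d \<in> charts_at N (\<phi> p)"
  shows "connection_defect (local_rep c d \<phi>) (snd c p) (christoffel M g c (snd c p)) (christoffel N h d (snd d (\<phi> p))) w u
    = connection_defect (local_rep c d \<phi>) (snd c p) (christoffel M g c (snd c p)) (christoffel N h d (snd d (\<phi> p))) u w"
  by (rule connection_defect_commute[OF local_domI[of c M p d N \<phi>, OF c d] smooth_map_local_rep[OF \<phi> charts_atD(1)[OF c] charts_atD(1)[OF d]]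
       open_local_dom[OF M N \<phi> charts_atD(1)[OF c] charts_atD(1)[OF d]]
       christoffel_commute[OF M g charts_atD(1)[OF c] chart_image_mem[OF c]]
       christoffel_commute[OF N h charts_atD(1)[OF d] chart_image_mem[OF d]]])

text \<open>For a constant factor the right-hand side of \<open>conformal_defect\<close> is \<open>0\<close>: the trilinear form
  \<open>H (E w u) (DF v)\<close>, which is symmetric in \<open>w\<close> and \<open>u\<close>, is skew in \<open>u\<close> and \<open>v\<close>. Hence it vanishes, and
  so does \<open>E\<close> because \<open>DF\<close> is onto.\<close>

lemma homothety_defect_zero:
  fixes M :: "('m, 'e::euclidean_space) manifold" and N :: "('n, 'f::euclidean_space) manifold"
  assumes M: "smooth_manifold M" and g: "riemannian_metric M g" and N: "smooth_manifold N" and h: "riemannian_metric N h"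
    and inv: "mutually_inverse M N \<phi> \<psi>"
    and scale: "\<And>p u v. p \<in> topspace (mtop M) \<Longrightarrow> u \<in> tangent_space M p \<Longrightarrow> v \<in> tangent_space M p \<Longrightarrow>
       h (\<phi> p) (pushforward M N \<phi> p u) (pushforward M N \<phi> p v) = l * g p u v"
    and c: "c \<in> charts_at M p" and d: "d \<in> charts_at N (\<phi> p)"
  shows "connection_defect (local_rep c d \<phi>) (snd c p) (christoffel M g c (snd c p)) (christoffel N h d (snd d (\<phi> p))) w u = 0"
proof -
  have \<phi>: "smooth_map M N \<phi>" using inv unfolding mutually_inverse_def by blast
  let ?DF = "frechet_derivative (local_rep c d \<phi>) (at (snd c p))"
  let ?E = "connection_defect (local_rep c d \<phi>) (snd c p) (christoffel M g c (snd c p)) (christoffel N h d (snd d (\<phi> p)))"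
  let ?H = "metric_coord N h d (snd d (\<phi> p))"
  note hd = charts_atD(1)[OF d] chart_image_mem[OF d]
  have c0: "?H (?E w u) (?DF v) + ?H (?DF u) (?E w v) = - 0 * metric_coord M g c (snd c p) u v" for w u v
    by (rule conformal_defect[OF M g N h \<phi> scale c d has_derivative_const])
  have anti: "?H (?E w u) (?DF v) + ?H (?E w v) (?DF u) = 0" for w u v
    unfolding metric_coord_sym[OF N h hd, of "?E w v" "?DF u"] c0 by simp
  have comm: "?E w u = ?E u w" for w u by (rule defect_commute[OF M g N h \<phi> c d])
  have zero: "?H (?E w u) (?DF v) = 0" for v
    by (rule symmetric_skew_trilinear_zero[of "\<lambda>w u v. ?H (?E w u) (?DF v)", OF _ anti]) (subst comm, rule refl)
  obtain v where "?DF v = ?E w u" using local_rep_derivative_surj[OF M N inv c d] by blast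
  then show ?thesis using zero[of v] metric_coord_pos[OF N h hd, of "?E w u"] by (cases "?E w u = 0") auto
qed

section \<open>Homotheties preserve curvature radii\<close>

lemma compose_identity_curve:
  assumes "\<gamma> \<in> C2_curves M" shows "compose {0..1} (\<lambda>p. p) \<gamma> = \<gamma>"
proof
  fix t show "compose {0..1} (\<lambda>p. p) \<gamma> t = \<gamma> t"
    using assms unfolding C2_curves_iff by (cases "t \<in> {0..1}") (auto simp: compose_def PiE_def extensional_def)
qed

lemma tangent_spaceI:
  assumes "\<And>c. c \<notin> charts_at M p \<Longrightarrow> v c = 0"
    and "\<And>c d. c \<in> charts_at M p \<Longrightarrow> d \<in> charts_at M p \<Longrightarrow>
       v d = frechet_derivative (local_rep c d (\<lambda>p. p)) (at (snd c p)) (v c)"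
  shows "v \<in> tangent_space M p"
  using assms unfolding tangent_space_def local_rep_identity by blast

lemma velocity_tangent:
  assumes M: "smooth_manifold M" and \<gamma>: "\<gamma> \<in> C2_curves M" and t: "t \<in> {0..1}"
  shows "velocity M \<gamma> t \<in> tangent_space M (\<gamma> t)"
proof (rule tangent_spaceI)
  show "velocity M \<gamma> t c = 0" if "c \<notin> charts_at M (\<gamma> t)" for c using that by (simp add: velocity_def)
  show "velocity M \<gamma> t d = frechet_derivative (local_rep c d (\<lambda>p. p)) (at (snd c (\<gamma> t))) (velocity M \<gamma> t c)"
    if "c \<in> charts_at M (\<gamma> t)" "d \<in> charts_at M (\<gamma> t)" for c d
    using velocity_compose_coord[OF M M smooth_map_identity[OF M] \<gamma> t that]
    unfolding compose_identity_curve[OF \<gamma>] .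
qed

lemma velocity_compose:
  assumes M: "smooth_manifold M" and N: "smooth_manifold N" and \<phi>: "smooth_map M N \<phi>"
    and \<gamma>: "\<gamma> \<in> C2_curves M" and t: "t \<in> {0..1}"
  shows "velocity N (compose {0..1} \<phi> \<gamma>) t = pushforward M N \<phi> (\<gamma> t) (velocity M \<gamma> t)"
proof
  fix d
  obtain c where c: "c \<in> charts_at M (\<gamma> t)" using charts_at_ex[OF M C2_curves_topspace[OF \<gamma> t]] by blast
  show "velocity N (compose {0..1} \<phi> \<gamma>) t d = pushforward M N \<phi> (\<gamma> t) (velocity M \<gamma> t) d"
  proof (cases "d \<in> charts_at N (\<phi> (\<gamma> t))")
    case True
    show ?thesis unfolding velocity_compose_coord[OF M N \<phi> \<gamma> t c True]
        pushforward_apply[OF M N \<phi> c velocity_tangent[OF M \<gamma> t] True] ..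
  next
    case False
    then show ?thesis using t by (simp add: pushforward_outside velocity_def compose_def)
  qed
qed

text \<open>The identity of \<open>M\<close> is a homothety whose local representations are the chart changes, so the
  vanishing of its connection defect is the coordinate invariance of the covariant derivative.\<close>

lemma acceleration_tangent:
  assumes M: "smooth_manifold M" and g: "riemannian_metric M g" and \<gamma>: "\<gamma> \<in> C2_curves M" and t: "t \<in> {0..1}"
  shows "acceleration M g \<gamma> t \<in> tangent_space M (\<gamma> t)"
proof (rule tangent_spaceI)
  show "acceleration M g \<gamma> t c = 0" if "c \<notin> charts_at M (\<gamma> t)" for c using that by (simp add: cov_deriv_def)
  fix c d assume cd: "c \<in> charts_at M (\<gamma> t)" "d \<in> charts_at M (\<gamma> t)"
  have "g p (pushforward M M (\<lambda>p. p) p u) (pushforward M M (\<lambda>p. p) p v) = 1 * g p u v"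
    if "p \<in> topspace (mtop M)" "u \<in> tangent_space M p" "v \<in> tangent_space M p" for p u v
    using pushforward_identity[OF M] that by simp
  then have defect: "connection_defect (local_rep c d (\<lambda>p. p)) (snd c (\<gamma> t)) (christoffel M g c (snd c (\<gamma> t)))
      (christoffel M g d (snd d (\<gamma> t))) w u = 0" for w u
    by (rule homothety_defect_zero[where \<phi>="\<lambda>p. p", OF M g M g mutually_inverse_identity[OF M] _ cd])
  show "acceleration M g \<gamma> t d = frechet_derivative (local_rep c d (\<lambda>p. p)) (at (snd c (\<gamma> t))) (acceleration M g \<gamma> t c)"
    using acceleration_compose_coord[OF M M smooth_map_identity[OF M] \<gamma> t cd, of g g]
    unfolding compose_identity_curve[OF \<gamma>] defect by simp
qed

lemma perp_proj_tangent:
  assumes M: "smooth_manifold M" and "v \<in> tangent_space M p" "w \<in> tangent_space M p"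
  shows "perp_proj g p v w \<in> tangent_space M p"
  unfolding perp_proj_def
  using tangent_space_lincomb[OF M assms(3,2), of 1 "- (g p w v / g p v v)"] by simp

lemma normal_accel_tangent:
  assumes M: "smooth_manifold M" and g: "riemannian_metric M g" and \<gamma>: "\<gamma> \<in> C2_curves M" and t: "t \<in> {0..1}"
  shows "normal_accel M g \<gamma> t \<in> tangent_space M (\<gamma> t)"
  unfolding normal_accel_def
  by (rule perp_proj_tangent[OF M velocity_tangent[OF M \<gamma> t] acceleration_tangent[OF M g \<gamma> t]])

lemma curvature_radius_dom_C2: "\<gamma> \<in> curvature_radius_dom M g \<Longrightarrow> \<gamma> \<in> C2_curves M"
  by (simp add: curvature_radius_dom_def)

lemma curvature_radius_at:
  assumes "t \<in> {0..1}"
  shows "curvature_radius M g \<gamma> t = (\<lambda>c. (1 / (geodesic_curvature M g \<gamma> t * tnorm g (\<gamma> t) (normal_accel M g \<gamma> t))) *\<^sub>R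
     normal_accel M g \<gamma> t c)"
  using assms by (simp add: curvature_radius_def)

context
  fixes M :: "('m, 'e::euclidean_space) manifold" and N :: "('n, 'f::euclidean_space) manifold"
    and g h \<phi> \<psi> l
  assumes M: "smooth_manifold M" and g: "riemannian_metric M g" and N: "smooth_manifold N" and h: "riemannian_metric N h"
    and inv: "mutually_inverse M N \<phi> \<psi>" and l: "l > 0"
    and scale: "\<And>p u v. p \<in> topspace (mtop M) \<Longrightarrow> u \<in> tangent_space M p \<Longrightarrow> v \<in> tangent_space M p \<Longrightarrow>
       h (\<phi> p) (pushforward M N \<phi> p u) (pushforward M N \<phi> p v) = l * g p u v"
begin

lemma homothety_tnorm:
  assumes "p \<in> topspace (mtop M)" "v \<in> tangent_space M p"
  shows "tnorm h (\<phi> p) (pushforward M N \<phi> p v) = sqrt l * tnorm g p v"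
  unfolding tnorm_def using scale[OF assms assms(2)] by (simp add: real_sqrt_mult)

lemma homothety_perp_proj:
  assumes "p \<in> topspace (mtop M)" "v \<in> tangent_space M p" "w \<in> tangent_space M p"
  shows "perp_proj h (\<phi> p) (pushforward M N \<phi> p v) (pushforward M N \<phi> p w) = pushforward M N \<phi> p (perp_proj g p v w)"
  unfolding perp_proj_def scale[OF assms(1,3,2)] scale[OF assms(1,2,2)]
  using pushforward_lincomb[OF M N mutually_inverse_smooth[OF inv] assms(1,3,2), of 1 "- (g p w v / g p v v)"] l by simp

context
  fixes \<gamma> :: "real \<Rightarrow> 'm" and t :: real assumes \<gamma>: "\<gamma> \<in> C2_curves M" and t: "t \<in> {0..1}"
begin

lemma homothety_acceleration:
  "acceleration N h (compose {0..1} \<phi> \<gamma>) t = pushforward M N \<phi> (\<gamma> t) (acceleration M g \<gamma> t)"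
proof
  fix d
  obtain c where c: "c \<in> charts_at M (\<gamma> t)" using charts_at_ex[OF M C2_curves_topspace[OF \<gamma> t]] by blast
  show "acceleration N h (compose {0..1} \<phi> \<gamma>) t d = pushforward M N \<phi> (\<gamma> t) (acceleration M g \<gamma> t) d"
  proof (cases "d \<in> charts_at N (\<phi> (\<gamma> t))")
    case True
    have "connection_defect (local_rep c d \<phi>) (snd c (\<gamma> t)) (christoffel M g c (snd c (\<gamma> t)))
        (christoffel N h d (snd d (\<phi> (\<gamma> t)))) w u = 0" for w u
      by (rule homothety_defect_zero[OF M g N h inv scale c True])
    then show ?thesis unfolding acceleration_compose_coord[OF M N mutually_inverse_smooth[OF inv] \<gamma> t c True, where g=g]
        pushforward_apply[OF M N mutually_inverse_smooth[OF inv] c acceleration_tangent[OF M g \<gamma> t] True] by simp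
  next
    case False
    then show ?thesis using t by (simp add: pushforward_outside cov_deriv_def compose_def)
  qed
qed

lemma homothety_normal_accel:
  "normal_accel N h (compose {0..1} \<phi> \<gamma>) t = pushforward M N \<phi> (\<gamma> t) (normal_accel M g \<gamma> t)"
  unfolding normal_accel_def homothety_acceleration velocity_compose[OF M N mutually_inverse_smooth[OF inv] \<gamma> t]
  using homothety_perp_proj[OF C2_curves_topspace[OF \<gamma> t] velocity_tangent[OF M \<gamma> t] acceleration_tangent[OF M g \<gamma> t]] t
  by (simp add: compose_def)

lemma homothety_normal_accel_norm:
  "tnorm h (compose {0..1} \<phi> \<gamma> t) (normal_accel N h (compose {0..1} \<phi> \<gamma>) t) = sqrt l * tnorm g (\<gamma> t) (normal_accel M g \<gamma> t)"
  unfolding homothety_normal_accel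
  using homothety_tnorm[OF C2_curves_topspace[OF \<gamma> t] normal_accel_tangent[OF M g \<gamma> t]] t by (simp add: compose_def)

lemma homothety_geodesic_curvature:
  "geodesic_curvature N h (compose {0..1} \<phi> \<gamma>) t = geodesic_curvature M g \<gamma> t / sqrt l"
proof -
  have "tnorm h (compose {0..1} \<phi> \<gamma> t) (velocity N (compose {0..1} \<phi> \<gamma>) t) = sqrt l * tnorm g (\<gamma> t) (velocity M \<gamma> t)"
    unfolding velocity_compose[OF M N mutually_inverse_smooth[OF inv] \<gamma> t]
    using homothety_tnorm[OF C2_curves_topspace[OF \<gamma> t] velocity_tangent[OF M \<gamma> t]] t by (simp add: compose_def)
  then show ?thesis
    unfolding geodesic_curvature_def homothety_normal_accel_norm using l by (simp add: power2_eq_square)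
qed

text \<open>Lengths are multiplied by \<open>sqrt l\<close> and the geodesic curvature is divided by it. In the
  curvature radius the two factors cancel.\<close>

lemma homothety_curvature_radius_at:
  "curvature_radius N h (compose {0..1} \<phi> \<gamma>) t = pushforward M N \<phi> (\<gamma> t) (curvature_radius M g \<gamma> t)"
  unfolding curvature_radius_at[OF t] homothety_geodesic_curvature homothety_normal_accel_norm
  unfolding pushforward_scale[OF M N mutually_inverse_smooth[OF inv] C2_curves_topspace[OF \<gamma> t] normal_accel_tangent[OF M g \<gamma> t]]
    homothety_normal_accel
  using l by simp

lemma homothety_velocity_nonzero:
  assumes "velocity M \<gamma> t \<noteq> (\<lambda>_. 0)"
  shows "velocity N (compose {0..1} \<phi> \<gamma>) t \<noteq> (\<lambda>_. 0)"
proof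
  note p = C2_curves_topspace[OF \<gamma> t] and v = velocity_tangent[OF M \<gamma> t]
  assume "velocity N (compose {0..1} \<phi> \<gamma>) t = (\<lambda>_. 0)"
  then have z: "pushforward M N \<phi> (\<gamma> t) (velocity M \<gamma> t) = (\<lambda>_. 0)"
    unfolding velocity_compose[OF M N mutually_inverse_smooth[OF inv] \<gamma> t] .
  have "g (\<gamma> t) (velocity M \<gamma> t) (velocity M \<gamma> t) > 0" by (rule metric_positive[OF M g p v assms])
  moreover have "l * g (\<gamma> t) (velocity M \<gamma> t) (velocity M \<gamma> t) = 0"
    using scale[OF p v v] metric_zero(1)[OF N h smooth_map_topspace[OF mutually_inverse_smooth[OF inv] p] pushforward_tangent[OF M N mutually_inverse_smooth[OF inv] p v]]
    unfolding z by simp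
  ultimately show False using l by simp
qed

end

lemma homothety_curvature_radius_dom:
  assumes "\<gamma> \<in> curvature_radius_dom M g"
  shows "compose {0..1} \<phi> \<gamma> \<in> curvature_radius_dom N h"
proof -
  have \<gamma>: "\<gamma> \<in> C2_curves M" using assms by (simp add: curvature_radius_dom_def)
  show ?thesis
    using assms compose_C2_curves[OF M N mutually_inverse_smooth[OF inv] \<gamma>] homothety_velocity_nonzero[OF \<gamma>]
      homothety_geodesic_curvature[OF \<gamma>] l
    unfolding curvature_radius_dom_def regular_def by simp
qed

lemma homothety_curvature_radius:
  assumes "\<gamma> \<in> curvature_radius_dom M g"
  shows "curvature_radius N h (compose {0..1} \<phi> \<gamma>) = (\<lambda>t\<in>{0..1}. pushforward M N \<phi> (\<gamma> t) (curvature_radius M g \<gamma> t))"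
proof
  have \<gamma>: "\<gamma> \<in> C2_curves M" using assms by (simp add: curvature_radius_dom_def)
  fix t
  show "curvature_radius N h (compose {0..1} \<phi> \<gamma>) t = (\<lambda>t\<in>{0..1}. pushforward M N \<phi> (\<gamma> t) (curvature_radius M g \<gamma> t)) t"
  proof (cases "t \<in> {0..1}")
    case True then show ?thesis using homothety_curvature_radius_at[OF \<gamma> True] by simp
  next
    case False then show ?thesis by (auto simp: curvature_radius_def)
  qed
qed

text \<open>With this, \<open>homothety_curvature_radius_dom\<close> also applies to \<open>\<psi>\<close>, so that every curve in the domain
  for \<open>N\<close> is the image of one in the domain for \<open>M\<close>.\<close>

lemma homothety_inverse_scale:
  assumes q: "q \<in> topspace (mtop N)" and u: "u \<in> tangent_space N q" and v: "v \<in> tangent_space N q"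
  shows "g (\<psi> q) (pushforward N M \<psi> q u) (pushforward N M \<psi> q v) = 1 / l * h q u v"
proof -
  have \<psi>: "smooth_map N M \<psi>" and eq: "\<phi> (\<psi> q) = q" using inv q unfolding mutually_inverse_def by auto
  note p = smooth_map_topspace[OF \<psi> q]
  have "pushforward M N \<phi> (\<psi> q) (pushforward N M \<psi> q w) = w" if "w \<in> tangent_space N q" for w
    by (rule pushforward_inverse[OF N M mutually_inverse_sym[OF inv] q that])
  then show ?thesis
    using scale[OF p pushforward_tangent[OF N M \<psi> q u] pushforward_tangent[OF N M \<psi> q v]] u v l unfolding eq by simp
qed

end

lemma homothetic_imp_same_curvature_radii:
  fixes M :: "('m, 'e::euclidean_space) manifold" and N :: "('n, 'f::euclidean_space) manifold"
  assumes Mg: "riemannian_manifold M g" and Nh: "riemannian_manifold N h" and hom: "homothetic M g N h"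
  shows "same_curvature_radii M g N h"
proof -
  have M: "smooth_manifold M" "riemannian_metric M g" and N: "smooth_manifold N" "riemannian_metric N h"
    using Mg Nh unfolding riemannian_manifold_def by auto
  obtain \<phi> l where \<phi>: "diffeomorphism M N \<phi>" and l: "l > 0"
    and sc: "\<And>p u v. p \<in> topspace (mtop M) \<Longrightarrow> u \<in> tangent_space M p \<Longrightarrow> v \<in> tangent_space M p \<Longrightarrow>
       h (\<phi> p) (pushforward M N \<phi> p u) (pushforward M N \<phi> p v) = l * g p u v"
    using hom unfolding homothetic_def by blast
  define \<psi> where "\<psi> = inv_into (topspace (mtop M)) \<phi>"
  have inv: "mutually_inverse M N \<phi> \<psi>" unfolding \<psi>_def by (rule diffeomorphism_mutually_inverse[OF \<phi>])
  note dom = homothety_curvature_radius_dom[OF M N inv l sc]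
  have dom': "compose {0..1} \<psi> \<delta> \<in> curvature_radius_dom M g" if "\<delta> \<in> curvature_radius_dom N h" for \<delta>
    by (rule homothety_curvature_radius_dom[OF N M mutually_inverse_sym[OF inv] _ homothety_inverse_scale[OF M N inv l sc] that])
       (use l in auto)
  have recover: "\<delta> = compose {0..1} \<phi> (compose {0..1} \<psi> \<delta>)" if "\<delta> \<in> curvature_radius_dom N h" for \<delta>
  proof
    fix t
    have "\<delta> \<in> {0..1} \<rightarrow>\<^sub>E topspace (mtop N)" using that unfolding curvature_radius_dom_def C2_curves_iff by blast
    then show "\<delta> t = compose {0..1} \<phi> (compose {0..1} \<psi> \<delta>) t"
      using inv unfolding mutually_inverse_def
      by (cases "t \<in> {0..1}") (auto simp: compose_def PiE_def extensional_def Pi_def)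
  qed
  have img: "(\<lambda>\<gamma>. compose {0..1} \<phi> \<gamma>) ` curvature_radius_dom M g = curvature_radius_dom N h"
  proof
    show "(\<lambda>\<gamma>. compose {0..1} \<phi> \<gamma>) ` curvature_radius_dom M g \<subseteq> curvature_radius_dom N h"
      using dom by (rule image_subsetI)
    show "curvature_radius_dom N h \<subseteq> (\<lambda>\<gamma>. compose {0..1} \<phi> \<gamma>) ` curvature_radius_dom M g"
      using recover dom' by (rule image_eqI[THEN subsetI])
  qed
  show ?thesis
    unfolding same_curvature_radii_def
    by (intro exI[of _ \<phi>] conjI ballI \<phi> img homothety_curvature_radius[OF M N inv l sc])
qed

section \<open>Curves with prescribed velocity and acceleration\<close>

lemma bilinear_family_continuous_on:
  fixes B :: "'c::topological_space \<Rightarrow> 'a::euclidean_space \<Rightarrow> 'a \<Rightarrow> 'b::real_normed_vector"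
  assumes "\<And>s. s \<in> T \<Longrightarrow> bilinear (B s)" "\<And>i j. continuous_on T (\<lambda>s. B s i j)"
    and "continuous_on T a" "continuous_on T b"
  shows "continuous_on T (\<lambda>s. B s (a s) (b s))"
proof (rule linear_family_continuous_on[where L="\<lambda>s. B s (a s)"])
  show "linear (B s (a s))" if "s \<in> T" for s using assms(1)[OF that] unfolding bilinear_def by blast
  show "continuous_on T (\<lambda>s. B s (a s) j)" for j
    by (rule linear_family_continuous_on[where L="\<lambda>s a. B s a j"]) (use assms in \<open>auto simp: bilinear_def\<close>)
qed (rule assms)

lemma quadratic_curve_C2:
  fixes x u a :: "'a::euclidean_space" and e :: real
  defines "f \<equiv> \<lambda>t. x + (e * t) *\<^sub>R u + ((e * t)\<^sup>2 / 2) *\<^sub>R a"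
  shows "C2_curve_on {0..1} f"
    and "t \<in> {0..1} \<Longrightarrow> curve_deriv f t = e *\<^sub>R (u + (e * t) *\<^sub>R a)"
    and "t \<in> {0..1} \<Longrightarrow> curve_deriv (curve_deriv f) t = e\<^sup>2 *\<^sub>R a"
proof -
  let ?A = "{0..1::real}"
  have o: "openin (top_of_set ?A) ?A" by simp
  have d1: "(f has_vector_derivative e *\<^sub>R (u + (e * t) *\<^sub>R a)) (at t within ?A)" for t
    unfolding f_def by (auto intro!: derivative_eq_intros simp: power2_eq_square algebra_simps)
  show v: "curve_deriv f t = e *\<^sub>R (u + (e * t) *\<^sub>R a)" if "t \<in> ?A" for t
    by (rule curve_derivI[OF d1 that])
  have "((\<lambda>t. e *\<^sub>R (u + (e * t) *\<^sub>R a)) has_vector_derivative e\<^sup>2 *\<^sub>R a) (at t within ?A)" for t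
    by (auto intro!: derivative_eq_intros simp: power2_eq_square)
  then have d2: "(curve_deriv f has_vector_derivative e\<^sup>2 *\<^sub>R a) (at t within ?A)" if "t \<in> ?A" for t
    using has_vector_derivative_cong_relatively_open[where f="curve_deriv f" and g="\<lambda>t. e *\<^sub>R (u + (e * t) *\<^sub>R a)", OF o that v] by blast
  show acc: "curve_deriv (curve_deriv f) t = e\<^sup>2 *\<^sub>R a" if "t \<in> ?A" for t
    by (rule curve_derivI[OF d2[OF that] that])
  have "continuous_on ?A (curve_deriv (curve_deriv f))"
    by (rule continuous_on_eq[OF continuous_on_const[of _ "e\<^sup>2 *\<^sub>R a"]]) (rule acc[symmetric])
  then show "C2_curve_on ?A f"
    unfolding C2_curve_on_def using d1 d2 differentiableI_vector by blast
qed

lemma chart_curve_C2: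
  fixes M :: "('m, 'e::euclidean_space) manifold"
  assumes M: "smooth_manifold M" and c: "c \<in> atlas M"
    and f: "C2_curve_on {0..1} f" and fS: "f ` {0..1} \<subseteq> snd c ` fst c"
  defines "\<gamma> \<equiv> (\<lambda>t\<in>{0..1}. chart_inv c (f t))"
  shows "\<gamma> \<in> C2_curves M" and "t \<in> {0..1} \<Longrightarrow> c \<in> charts_at M (\<gamma> t)"
    and "t \<in> {0..1} \<Longrightarrow> (snd c \<circ> \<gamma>) t = f t"
proof -
  let ?A = "{0..1::real}"
  note ci = chart_inv_simps[OF atlas_chart[OF M c]]
  have ch: "\<gamma> t \<in> fst c" and eq: "snd c (\<gamma> t) = f t" if "t \<in> ?A" for t
  proof -
    have "f t \<in> snd c ` fst c" using fS that by blast
    then show "\<gamma> t \<in> fst c" "snd c (\<gamma> t) = f t" using ci(2,3)[of "f t"] that by (simp_all add: \<gamma>_def)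
  qed
  show cc: "c \<in> charts_at M (\<gamma> t)" if "t \<in> ?A" for t by (rule charts_atI[OF c ch[OF that]])
  show "(snd c \<circ> \<gamma>) t = f t" if "t \<in> ?A" using eq[OF that] by simp
  have top: "\<gamma> t \<in> topspace (mtop M)" if "t \<in> ?A" for t by (rule charts_at_topspace[OF M cc[OF that]])
  have fc: "continuous_on ?A f" using C2_curve_on_continuous(1)[OF f] by simp
  have pre: "openin (top_of_set ?A) {t \<in> ?A. \<gamma> t \<in> U}" if "openin (mtop M) U" for U
  proof -
    have "{t \<in> ?A. \<gamma> t \<in> U} = ?A \<inter> f -` (snd c ` (fst c \<inter> U))"
    proof (intro set_eqI iffI)
      fix t assume "t \<in> {t \<in> ?A. \<gamma> t \<in> U}"
      then show "t \<in> ?A \<inter> f -` (snd c ` (fst c \<inter> U))" using ch[of t] eq[of t] by force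
    next
      fix t assume t: "t \<in> ?A \<inter> f -` (snd c ` (fst c \<inter> U))"
      then obtain q where q: "q \<in> fst c" "q \<in> U" "f t = snd c q" by auto
      then have "\<gamma> t = q" using ci(1)[OF q(1)] t by (simp add: \<gamma>_def)
      then show "t \<in> {t \<in> ?A. \<gamma> t \<in> U}" using q t by simp
    qed
    then show ?thesis
      using continuous_openin_preimage_gen[OF fc open_chart_image[OF atlas_chart[OF M c] that]] by simp
  qed
  show "\<gamma> \<in> C2_curves M"
    unfolding C2_curves_iff
  proof (intro conjI ballI)
    show "\<gamma> \<in> ?A \<rightarrow>\<^sub>E topspace (mtop M)" using top by (auto simp: \<gamma>_def)
    show "continuous_map (top_of_set ?A) (mtop M) \<gamma>"
      unfolding continuous_map_def using top pre by auto
    fix d assume d: "d \<in> atlas M"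
    let ?J = "{t \<in> ?A. \<gamma> t \<in> fst d}"
    have J: "openin (top_of_set ?A) ?J" by (rule pre[OF chart_openin[OF M d]])
    have fJ: "C2_curve_on ?J f" by (rule C2_curve_on_subset[OF f]) auto
    have img: "f ` ?J \<subseteq> local_dom c d (\<lambda>p. p)"
    proof (rule image_subsetI)
      fix t assume "t \<in> ?J"
      then show "f t \<in> local_dom c d (\<lambda>p. p)" unfolding local_dom_def using ch[of t] eq[of t] by force
    qed
    have "C2_curve_on ?J (\<lambda>t. local_rep c d (\<lambda>p. p) (f t))"
      by (rule C2_chain[OF J fJ smooth_map_local_rep[OF smooth_map_identity[OF M] c d]
           open_local_dom[OF M M smooth_map_identity[OF M] c d] img])
    moreover have "C2_curve_on ?J (snd d \<circ> \<gamma>) \<longleftrightarrow> C2_curve_on ?J (\<lambda>t. local_rep c d (\<lambda>p. p) (f t))"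
      by (rule C2_curve_on_cong[OF J]) (auto simp: local_rep_def \<gamma>_def)
    ultimately show "C2_curve_on ?J (snd d \<circ> \<gamma>)" by blast
  qed
qed

context
  fixes M :: "('m, 'e::euclidean_space) manifold" and g :: "('m, 'e) metric"
  assumes M: "smooth_manifold M" and g: "riemannian_metric M g"
begin

text \<open>The diagonal case of the Koszul formula. The Christoffel symbols are given by a definite
  description; the formula exhibits them as continuous functions of the point.\<close>

lemma koszul:
  assumes c: "c \<in> atlas M" and x: "x \<in> snd c ` fst c"
  shows "metric_coord M g c x (christoffel M g c x u u) z =
    frechet_derivative (\<lambda>y. metric_coord M g c y u z) (at x) u
    - frechet_derivative (\<lambda>y. metric_coord M g c y u u) (at x) z / 2"
  unfolding metric_coord_derivative[OF M g c x]
  using christoffel_commute[OF M g c x, of z u] metric_coord_sym[OF M g c x, of u "christoffel M g c x u z"] by simp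

lemma metric_coord_continuous_on:
  assumes c: "c \<in> atlas M" and f: "continuous_on T f" "f ` T \<subseteq> snd c ` fst c"
    and ab: "continuous_on T a" "continuous_on T b"
  shows "continuous_on T (\<lambda>s. metric_coord M g c (f s) (a s) (b s))"
proof (rule bilinear_family_continuous_on[OF _ _ ab])
  show "bilinear (metric_coord M g c (f s))" if "s \<in> T" for s
    by (rule metric_coord_bilinear[OF M g c]) (use f that in blast)
  have "smooth_on (snd c ` fst c) (\<lambda>y. metric_coord M g c y i j)" for i j
    using g c unfolding riemannian_metric_def by blast
  then show "continuous_on T (\<lambda>s. metric_coord M g c (f s) i j)" for i j
    using continuous_on_compose2[OF smooth_on_continuous_on f] by blast
qed

lemma metric_coord_derivative_continuous_on:
  assumes c: "c \<in> atlas M" and f: "continuous_on T f" "f ` T \<subseteq> snd c ` fst c"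
    and ab: "continuous_on T a" "continuous_on T b" and w: "continuous_on T w"
  shows "continuous_on T (\<lambda>s. frechet_derivative (\<lambda>y. metric_coord M g c y (a s) (b s)) (at (f s)) (w s))"
proof (rule linear_family_continuous_on[OF _ _ w])
  have x: "f s \<in> snd c ` fst c" if "s \<in> T" for s using f that by blast
  note d1 = metric_coord_deriv_args(1)[OF M g c x] and d2 = metric_coord_deriv_args(2)[OF M g c x]
  have lin: "linear (\<lambda>a. frechet_derivative (\<lambda>y. metric_coord M g c y a b) (at (f s)) w)" if "s \<in> T" for s b w
  proof (rule linearI)
    show "frechet_derivative (\<lambda>y. metric_coord M g c y (a + a') b) (at (f s)) w =
        frechet_derivative (\<lambda>y. metric_coord M g c y a b) (at (f s)) w +
        frechet_derivative (\<lambda>y. metric_coord M g c y a' b) (at (f s)) w" for a a'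
      using d1[OF that, of 1 a 1 a' b w] by simp
    show "frechet_derivative (\<lambda>y. metric_coord M g c y (r *\<^sub>R a) b) (at (f s)) w =
        r *\<^sub>R frechet_derivative (\<lambda>y. metric_coord M g c y a b) (at (f s)) w" for r a
      using d1[OF that, of r a 0 a b w] by simp
  qed
  show "linear (frechet_derivative (\<lambda>y. metric_coord M g c y (a s) (b s)) (at (f s)))" if "s \<in> T" for s
    by (rule metric_coord_deriv_linear[OF M g c x[OF that]])
  fix k
  show "continuous_on T (\<lambda>s. frechet_derivative (\<lambda>y. metric_coord M g c y (a s) (b s)) (at (f s)) k)"
  proof (rule bilinear_family_continuous_on[where B="\<lambda>s a b. frechet_derivative (\<lambda>y. metric_coord M g c y a b) (at (f s)) k", OF _ _ ab])
    show "bilinear (\<lambda>a b. frechet_derivative (\<lambda>y. metric_coord M g c y a b) (at (f s)) k)" if "s \<in> T" for s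
      unfolding bilinear_def using lin[OF that] d2[OF that] by simp
    have "smooth_on (snd c ` fst c) (\<lambda>y. metric_coord M g c y i j)" for i j
      using g c unfolding riemannian_metric_def by blast
    then show "continuous_on T (\<lambda>s. frechet_derivative (\<lambda>y. metric_coord M g c y i j) (at (f s)) k)" for i j
      using continuous_on_compose2[OF smooth_on_continuous_on[OF smooth_on_derivative] f] by blast
  qed
qed

text \<open>In the chart, the quadratic curve through \<open>p\<close> with velocity \<open>u\<close> and second derivative
  \<open>w - \<Gamma> u u\<close> has covariant acceleration \<open>w\<close> at time \<open>0\<close>. As \<open>w\<close> is normal and nonzero, the geodesic
  curvature does not vanish at time \<open>0\<close>, nor, by continuity, for a short time \<open>e\<close>; slowing the curve
  down by the factor \<open>e\<close> makes this time the unit interval. The factor \<open>e\<close> in the conclusion is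
  harmless because curvature radii do not depend on the parametrisation.\<close>

lemma curve_with_normal_acceleration:
  assumes c: "c \<in> charts_at M p" and u: "u \<noteq> 0" and w: "w \<noteq> 0"
    and orth: "metric_coord M g c (snd c p) w u = 0"
  shows "\<exists>\<gamma> e. e > 0 \<and> \<gamma> \<in> curvature_radius_dom M g \<and> \<gamma> 0 = p \<and>
     velocity M \<gamma> 0 c = e *\<^sub>R u \<and> acceleration M g \<gamma> 0 c = e\<^sup>2 *\<^sub>R w"
proof -
  let ?S = "snd c ` fst c" and ?x = "snd c p" and ?G = "metric_coord M g c" and ?\<Gamma> = "christoffel M g c"
  note cM = charts_atD(1)[OF c] and xS = chart_image_mem[OF c]
  have S: "open ?S" using atlas_chart[OF M cM] unfolding is_chart_def by blast
  define a where "a = w - ?\<Gamma> ?x u u"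
  define f where "f s = ?x + s *\<^sub>R u + (s\<^sup>2 / 2) *\<^sub>R a" for s
  define V where "V s = u + s *\<^sub>R a" for s
  \<comment> \<open>The part of \<open>w\<close> normal to the velocity \<open>V s\<close>. Since \<open>k s\<close> is the inner product of \<open>z s\<close> with the
    covariant acceleration, the latter cannot be tangential while \<open>k s > 0\<close>.\<close>
  define z where "z s = w - (?G (f s) w (V s) / ?G (f s) (V s) (V s)) *\<^sub>R V s" for s
  define k where "k s = ?G (f s) (a + ?\<Gamma> (f s) (V s) (V s)) (z s)" for s
  define T where "T = {s. f s \<in> ?S \<and> V s \<noteq> 0}"
  have fc: "continuous_on A f" for A unfolding f_def by (intro continuous_intros) simp
  have Vc: "continuous_on A V" for A unfolding V_def by (intro continuous_intros)
  have "T = f -` ?S \<inter> V -` (- {0})" by (auto simp: T_def)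
  then have T: "open T"
    using open_Int[OF open_vimage[OF S fc] open_vimage[OF open_Compl[OF closed_singleton] Vc]] by simp
  have fT: "f ` T \<subseteq> ?S" by (auto simp: T_def)
  have fS: "f s \<in> ?S" and V0: "V s \<noteq> 0" if "s \<in> T" for s using that by (auto simp: T_def)
  have GVV: "?G (f s) (V s) (V s) > 0" if "s \<in> T" for s
    by (rule metric_coord_pos[OF M g cM fS[OF that] V0[OF that]])
  have zc: "continuous_on T z"
    unfolding z_def
    using GVV by (intro continuous_intros metric_coord_continuous_on[OF cM fc fT] Vc) (simp add: less_imp_neq[symmetric] less_imp_neq)+
  have k_koszul: "k s = ?G (f s) a (z s) + (frechet_derivative (\<lambda>y. ?G y (V s) (z s)) (at (f s)) (V s)
    - frechet_derivative (\<lambda>y. ?G y (V s) (V s)) (at (f s)) (z s) / 2)" if "s \<in> T" for s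
    unfolding k_def bilinear_ladd[OF metric_coord_bilinear[OF M g cM fS[OF that]]] koszul[OF cM fS[OF that]] ..
  have "continuous_on T (\<lambda>s. ?G (f s) a (z s) + (frechet_derivative (\<lambda>y. ?G y (V s) (z s)) (at (f s)) (V s)
    - frechet_derivative (\<lambda>y. ?G y (V s) (V s)) (at (f s)) (z s) / 2))"
    by (intro continuous_intros metric_coord_continuous_on[OF cM fc fT]
        metric_coord_derivative_continuous_on[OF cM fc fT] Vc zc) simp
  then have kc: "continuous_on T k" using k_koszul by (simp cong: continuous_on_cong)
  have f0: "f 0 = ?x" and V00: "V 0 = u" by (simp_all add: f_def V_def)
  have T0: "0 \<in> T" using u xS by (simp add: T_def f0 V00)
  have "k 0 = ?G ?x w w"
    by (simp add: k_def z_def f0 V00 orth a_def)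
  then have k0: "k 0 > 0" using metric_coord_pos[OF M g cM xS w] by simp
  have "open (T \<inter> k -` {0<..})" using kc T by (simp add: continuous_on_open_vimage Int_commute)
  then obtain r where r: "r > 0" "ball 0 r \<subseteq> T \<inter> k -` {0<..}" using T0 k0 open_contains_ball by (metis IntI greaterThan_iff vimageI)
  define e where "e = r / 2"
  have e: "e > 0" using r by (simp add: e_def)
  have good: "e * t \<in> T" "k (e * t) > 0" if "t \<in> {0..1}" for t
  proof -
    have "\<bar>e * t\<bar> \<le> e" using that e by (simp add: abs_mult mult_left_le)
    then have "e * t \<in> ball 0 r" using r by (simp add: e_def dist_real_def)
    then show "e * t \<in> T" "k (e * t) > 0" using r by auto
  qed
  define \<gamma> where "\<gamma> = (\<lambda>t\<in>{0..1}. chart_inv c (f (e * t)))"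
  have C2f: "C2_curve_on {0..1} (\<lambda>t. f (e * t))" unfolding f_def by (rule quadratic_curve_C2)
  have fim: "(\<lambda>t. f (e * t)) ` {0..1} \<subseteq> ?S" using good(1) fS by blast
  note \<gamma> = chart_curve_C2[OF M cM C2f fim, folded \<gamma>_def]
  have o: "openin (top_of_set {0..1}) {0..1::real}" by simp
  have vel: "velocity M \<gamma> t c = e *\<^sub>R V (e * t)" if t: "t \<in> {0..1}" for t
  proof -
    have "velocity M \<gamma> t c = curve_deriv (\<lambda>t. f (e * t)) t"
      unfolding velocity_apply[where \<gamma>=\<gamma> and t=t, OF \<gamma>(2)[OF t]] by (rule curve_deriv_cong[OF o t \<gamma>(3)])
    then show ?thesis unfolding f_def V_def using quadratic_curve_C2(2)[OF t] by simp
  qed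
  have acc: "acceleration M g \<gamma> t c = e\<^sup>2 *\<^sub>R (a + ?\<Gamma> (f (e * t)) (V (e * t)) (V (e * t)))" if t: "t \<in> {0..1}" for t
  proof -
    note bl = christoffel_bilinear[OF M g cM fS[OF good(1)[OF t]]]
    have "curve_deriv (curve_deriv (snd c \<circ> \<gamma>)) t = curve_deriv (curve_deriv (\<lambda>t. f (e * t))) t"
      by (rule curve_deriv_cong[OF o t curve_deriv_cong[OF o _ \<gamma>(3)]])
    also have "\<dots> = e\<^sup>2 *\<^sub>R a" unfolding f_def by (rule quadratic_curve_C2(3)[OF t])
    finally show ?thesis
      unfolding acceleration_apply[OF M \<gamma>(1) t \<gamma>(2)[OF t]] vel[OF t]
      using \<gamma>(3)[OF t] by (simp add: bilinear_lmul[OF bl] bilinear_rmul[OF bl] power2_eq_square scaleR_add_right)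
  qed
  have reg: "velocity M \<gamma> t \<noteq> (\<lambda>_. 0)" if t: "t \<in> {0..1}" for t
    using vel[OF t] V0[OF good(1)[OF t]] e by auto
  have nrm: "normal_accel M g \<gamma> t \<noteq> (\<lambda>_. 0)" if t: "t \<in> {0..1}" for t
  proof
    assume z0: "normal_accel M g \<gamma> t = (\<lambda>_. 0)"
    define s where "s = e * t"
    note s = good[OF t, folded s_def]
    note bl = metric_coord_bilinear[OF M g cM fS[OF s(1)]]
    obtain m where "acceleration M g \<gamma> t c - m *\<^sub>R velocity M \<gamma> t c = 0"
      using fun_cong[OF z0, of c] unfolding normal_accel_def perp_proj_def by blast
    then have "e\<^sup>2 *\<^sub>R (a + ?\<Gamma> (f s) (V s) (V s)) = (m * e) *\<^sub>R V s"
      unfolding vel[OF t] acc[OF t] s_def by simp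
    then have "?G (f s) (e\<^sup>2 *\<^sub>R (a + ?\<Gamma> (f s) (V s) (V s))) (z s) = ?G (f s) ((m * e) *\<^sub>R V s) (z s)" by simp
    then have "e\<^sup>2 * k s = m * e * ?G (f s) (V s) (z s)"
      unfolding bilinear_lmul[OF bl] k_def by simp
    also have "?G (f s) (V s) (z s) = 0"
      using GVV[OF s(1)] metric_coord_sym[OF M g cM fS[OF s(1)], of w "V s"]
      by (simp add: z_def bilinear_rsub[OF bl] bilinear_rmul[OF bl])
    finally show False using e s by simp
  qed
  have "geodesic_curvature M g \<gamma> t \<noteq> 0" if t: "t \<in> {0..1}" for t
  proof -
    note top = C2_curves_topspace[OF \<gamma>(1) t]
    have "tnorm g (\<gamma> t) (normal_accel M g \<gamma> t) > 0" "tnorm g (\<gamma> t) (velocity M \<gamma> t) > 0"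
      unfolding tnorm_def
      using metric_positive[OF M g top normal_accel_tangent[OF M g \<gamma>(1) t] nrm[OF t]]
        metric_positive[OF M g top velocity_tangent[OF M \<gamma>(1) t] reg[OF t]] by simp_all
    then show ?thesis unfolding geodesic_curvature_def by simp
  qed
  then have "\<gamma> \<in> curvature_radius_dom M g"
    unfolding curvature_radius_dom_def regular_def using \<gamma>(1) reg by blast
  moreover have "\<gamma> 0 = p" using f0 chart_inv_chart[OF M c] by (simp add: \<gamma>_def)
  moreover have "velocity M \<gamma> 0 c = e *\<^sub>R u" using vel[of 0] V00 by simp
  moreover have "acceleration M g \<gamma> 0 c = e\<^sup>2 *\<^sub>R w" using acc[of 0] by (simp add: f0 V00 a_def)
  ultimately show ?thesis using e by blast
qed

end

section \<open>Equal curvature radii imply homothety\<close>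

lemma orthogonal_vector_exists:
  fixes G :: "'a::euclidean_space \<Rightarrow> 'a \<Rightarrow> real"
  assumes G: "bilinear G" and u: "G u u \<noteq> 0" and dim: "DIM('a) > 1"
  shows "\<exists>w. w \<noteq> 0 \<and> G w u = 0"
proof -
  have "dim (span {u}) \<le> card {u}" by (simp add: dim_le_card')
  then have "dim (span {u}) \<noteq> dim (UNIV :: 'a set)" using dim by (simp add: dim_UNIV)
  then obtain w where w: "w \<notin> span {u}" by (metis UNIV_eq_I)
  define k where "k = G w u / G u u"
  have "w - k *\<^sub>R u \<noteq> 0" using w by (metis eq_iff_diff_eq_0 span_base span_scale singletonI)
  moreover have "G (w - k *\<^sub>R u) u = 0"
    using u by (simp add: bilinear_lsub[OF G] bilinear_lmul[OF G] k_def)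
  ultimately show ?thesis by blast
qed

lemma connection_defect_scale:
  fixes F :: "'a::euclidean_space \<Rightarrow> 'b::euclidean_space"
  assumes "x \<in> S" "smooth_on S F" "open S" "bilinear \<Gamma>" "bilinear \<Gamma>'"
  shows "connection_defect F x \<Gamma> \<Gamma>' (r *\<^sub>R u) (s *\<^sub>R v) = (r * s) *\<^sub>R connection_defect F x \<Gamma> \<Gamma>' u v"
  unfolding connection_defect_def
  using linear_scale[OF smooth_on_linear[OF assms(2,1)]] linear_scale[OF D2_linear_left[OF assms(2,1)]]
    linear_scale[OF D2_linear_right[OF assms(2,3,1)]]
  by (simp add: bilinear_lmul[OF assms(4)] bilinear_rmul[OF assms(4)] bilinear_lmul[OF assms(5)] bilinear_rmul[OF assms(5)]
      scaleR_diff_right mult.commute)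

context
  fixes M :: "('m, 'e::euclidean_space) manifold" and g :: "('m, 'e) metric"
  assumes M: "smooth_manifold M" and g: "riemannian_metric M g"
begin

lemma perp_proj_orthogonal:
  assumes "p \<in> topspace (mtop M)" "v \<in> tangent_space M p" "w \<in> tangent_space M p" "v \<noteq> (\<lambda>_. 0)"
  shows "g p (perp_proj g p v w) v = 0"
  using metric_lincomb_left[OF M g assms(1,3,2,2), of 1 "- (g p w v / g p v v)"] metric_positive[OF M g assms(1,2,4)]
  unfolding perp_proj_def by simp

context
  fixes \<gamma> :: "real \<Rightarrow> 'm" and t :: real
  assumes \<gamma>: "\<gamma> \<in> curvature_radius_dom M g" and t: "t \<in> {0..1}"
begin

lemma dom_velocity_nonzero: "velocity M \<gamma> t \<noteq> (\<lambda>_. 0)"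
  using \<gamma> t by (simp add: curvature_radius_dom_def regular_def)

lemma dom_velocity_positive: "g (\<gamma> t) (velocity M \<gamma> t) (velocity M \<gamma> t) > 0"
  by (rule metric_positive[OF M g C2_curves_topspace[OF curvature_radius_dom_C2[OF \<gamma>] t] velocity_tangent[OF M curvature_radius_dom_C2[OF \<gamma>] t] dom_velocity_nonzero])

lemma dom_normal_accel_positive: "g (\<gamma> t) (normal_accel M g \<gamma> t) (normal_accel M g \<gamma> t) > 0"
proof -
  note p = C2_curves_topspace[OF curvature_radius_dom_C2[OF \<gamma>] t] and n = normal_accel_tangent[OF M g curvature_radius_dom_C2[OF \<gamma>] t]
  have "geodesic_curvature M g \<gamma> t \<noteq> 0" using \<gamma> t by (simp add: curvature_radius_dom_def)
  then have "normal_accel M g \<gamma> t \<noteq> (\<lambda>_. 0)"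
    using metric_zero[OF M g p n] by (auto simp: geodesic_curvature_def tnorm_def)
  then show ?thesis by (rule metric_positive[OF M g p n])
qed

lemma dom_curvature_radius_at:
  "curvature_radius M g \<gamma> t = (\<lambda>c. (g (\<gamma> t) (velocity M \<gamma> t) (velocity M \<gamma> t) /
     g (\<gamma> t) (normal_accel M g \<gamma> t) (normal_accel M g \<gamma> t)) *\<^sub>R normal_accel M g \<gamma> t c)"
  unfolding curvature_radius_at[OF t] geodesic_curvature_def tnorm_def
  using dom_velocity_positive dom_normal_accel_positive by simp

lemma dom_normal_accel_orthogonal: "g (\<gamma> t) (normal_accel M g \<gamma> t) (velocity M \<gamma> t) = 0"
  unfolding normal_accel_def
  by (rule perp_proj_orthogonal[OF C2_curves_topspace[OF curvature_radius_dom_C2[OF \<gamma>] t] velocity_tangent[OF M curvature_radius_dom_C2[OF \<gamma>] t]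
        acceleration_tangent[OF M g curvature_radius_dom_C2[OF \<gamma>] t] dom_velocity_nonzero])

end

end

context
  fixes M :: "('m, 'e::euclidean_space) manifold" and N :: "('n, 'f::euclidean_space) manifold"
    and g h \<phi> \<psi>
  assumes M: "smooth_manifold M" and g: "riemannian_metric M g" and N: "smooth_manifold N" and h: "riemannian_metric N h"
    and inv: "mutually_inverse M N \<phi> \<psi>"
    and dom: "\<And>\<gamma>. \<gamma> \<in> curvature_radius_dom M g \<Longrightarrow> compose {0..1} \<phi> \<gamma> \<in> curvature_radius_dom N h"
    and radius: "\<And>\<gamma> t. \<gamma> \<in> curvature_radius_dom M g \<Longrightarrow> t \<in> {0..1} \<Longrightarrow>
      curvature_radius N h (compose {0..1} \<phi> \<gamma>) t = pushforward M N \<phi> (\<gamma> t) (curvature_radius M g \<gamma> t)"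
begin

context
  fixes \<gamma> :: "real \<Rightarrow> 'm" and t :: real
  assumes \<gamma>: "\<gamma> \<in> curvature_radius_dom M g" and t: "t \<in> {0..1}"
begin

text \<open>The curvature radius is \<open>\<bar>v\<bar>\<^sup>2 / \<bar>n\<bar>\<^sup>2\<close> times the normal acceleration \<open>n\<close>, where \<open>v\<close> is the
  velocity. So the push-forward of the normal acceleration is a multiple of the normal acceleration of
  the image curve.\<close>

lemma radii_normal_accel:
  "pushforward M N \<phi> (\<gamma> t) (normal_accel M g \<gamma> t) = (\<lambda>d.
     (h (\<phi> (\<gamma> t)) (pushforward M N \<phi> (\<gamma> t) (velocity M \<gamma> t)) (pushforward M N \<phi> (\<gamma> t) (velocity M \<gamma> t))
       / h (\<phi> (\<gamma> t)) (normal_accel N h (compose {0..1} \<phi> \<gamma>) t) (normal_accel N h (compose {0..1} \<phi> \<gamma>) t)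
      * (g (\<gamma> t) (normal_accel M g \<gamma> t) (normal_accel M g \<gamma> t) / g (\<gamma> t) (velocity M \<gamma> t) (velocity M \<gamma> t)))
     *\<^sub>R normal_accel N h (compose {0..1} \<phi> \<gamma>) t d)"
proof
  fix d
  let ?n = "normal_accel M g \<gamma> t" and ?v = "velocity M \<gamma> t" and ?\<delta> = "compose {0..1} \<phi> \<gamma>"
  let ?k = "g (\<gamma> t) ?v ?v / g (\<gamma> t) ?n ?n"
  note \<gamma>2 = curvature_radius_dom_C2[OF \<gamma>]
  have \<delta>t: "?\<delta> t = \<phi> (\<gamma> t)" using t by (simp add: compose_def)
  have "?k *\<^sub>R pushforward M N \<phi> (\<gamma> t) ?n d = curvature_radius N h ?\<delta> t d"
    unfolding radius[OF \<gamma> t] dom_curvature_radius_at[OF M g \<gamma> t]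
      pushforward_scale[OF M N mutually_inverse_smooth[OF inv] C2_curves_topspace[OF \<gamma>2 t] normal_accel_tangent[OF M g \<gamma>2 t]] ..
  then have eq: "?k *\<^sub>R pushforward M N \<phi> (\<gamma> t) ?n d =
      (h (\<phi> (\<gamma> t)) (pushforward M N \<phi> (\<gamma> t) ?v) (pushforward M N \<phi> (\<gamma> t) ?v) /
        h (\<phi> (\<gamma> t)) (normal_accel N h ?\<delta> t) (normal_accel N h ?\<delta> t)) *\<^sub>R normal_accel N h ?\<delta> t d"
    unfolding dom_curvature_radius_at[OF N h dom[OF \<gamma>] t] \<delta>t velocity_compose[OF M N mutually_inverse_smooth[OF inv] \<gamma>2 t] .
  have "pushforward M N \<phi> (\<gamma> t) ?n d = (1 / ?k) *\<^sub>R (?k *\<^sub>R pushforward M N \<phi> (\<gamma> t) ?n d)"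
    using dom_velocity_positive[OF M g \<gamma> t] dom_normal_accel_positive[OF M g \<gamma> t] by simp
  also note eq
  finally show "pushforward M N \<phi> (\<gamma> t) ?n d =
     (h (\<phi> (\<gamma> t)) (pushforward M N \<phi> (\<gamma> t) ?v) (pushforward M N \<phi> (\<gamma> t) ?v)
       / h (\<phi> (\<gamma> t)) (normal_accel N h ?\<delta> t) (normal_accel N h ?\<delta> t)
      * (g (\<gamma> t) ?n ?n / g (\<gamma> t) ?v ?v)) *\<^sub>R normal_accel N h ?\<delta> t d" by (simp add: mult.commute)
qed

lemma radii_orthogonal:
  "h (\<phi> (\<gamma> t)) (pushforward M N \<phi> (\<gamma> t) (normal_accel M g \<gamma> t)) (pushforward M N \<phi> (\<gamma> t) (velocity M \<gamma> t)) = 0"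
proof -
  note \<gamma>2 = curvature_radius_dom_C2[OF \<gamma>] and \<delta>2 = curvature_radius_dom_C2[OF dom[OF \<gamma>]]
  have \<delta>t: "compose {0..1} \<phi> \<gamma> t = \<phi> (\<gamma> t)" using t by (simp add: compose_def)
  note q = C2_curves_topspace[OF \<delta>2 t, unfolded \<delta>t]
  note n = normal_accel_tangent[OF N h \<delta>2 t, unfolded \<delta>t]
  note V = pushforward_tangent[OF M N mutually_inverse_smooth[OF inv] C2_curves_topspace[OF \<gamma>2 t] velocity_tangent[OF M \<gamma>2 t]]
  show ?thesis
    unfolding radii_normal_accel metric_scale(1)[OF N h q n V]
    using dom_normal_accel_orthogonal[OF N h dom[OF \<gamma>] t]
    unfolding \<delta>t velocity_compose[OF M N mutually_inverse_smooth[OF inv] \<gamma>2 t] by simp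
qed

text \<open>Once the differential of \<open>\<phi>\<close> is conformal at the point, the lengths of velocities in the two
  curvature radii agree up to the conformal factor, and \<open>n \<mapsto> n / \<bar>n\<bar>\<^sup>2\<close> is injective. In the proof this
  amounts to comparing the lengths of the two sides of \<open>radii_normal_accel\<close>.\<close>

lemma radii_conformal_normal_accel:
  assumes conf: "\<And>u v. u \<in> tangent_space M (\<gamma> t) \<Longrightarrow> v \<in> tangent_space M (\<gamma> t) \<Longrightarrow>
       h (\<phi> (\<gamma> t)) (pushforward M N \<phi> (\<gamma> t) u) (pushforward M N \<phi> (\<gamma> t) v) = k * g (\<gamma> t) u v"
  shows "normal_accel N h (compose {0..1} \<phi> \<gamma>) t = pushforward M N \<phi> (\<gamma> t) (normal_accel M g \<gamma> t)"
proof -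
  note \<gamma>2 = curvature_radius_dom_C2[OF \<gamma>] and \<delta>2 = curvature_radius_dom_C2[OF dom[OF \<gamma>]]
  have \<delta>t: "compose {0..1} \<phi> \<gamma> t = \<phi> (\<gamma> t)" using t by (simp add: compose_def)
  note q = C2_curves_topspace[OF \<delta>2 t, unfolded \<delta>t]
  note v = velocity_tangent[OF M \<gamma>2 t] and n = normal_accel_tangent[OF M g \<gamma>2 t]
  note n' = normal_accel_tangent[OF N h \<delta>2 t, unfolded \<delta>t]
  define A where "A = h (\<phi> (\<gamma> t)) (normal_accel N h (compose {0..1} \<phi> \<gamma>) t) (normal_accel N h (compose {0..1} \<phi> \<gamma>) t)"
  define B where "B = g (\<gamma> t) (normal_accel M g \<gamma> t) (normal_accel M g \<gamma> t)"
  define W where "W = g (\<gamma> t) (velocity M \<gamma> t) (velocity M \<gamma> t)"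
  have A: "A > 0" using dom_normal_accel_positive[OF N h dom[OF \<gamma>] t] unfolding A_def \<delta>t .
  have B: "B > 0" using dom_normal_accel_positive[OF M g \<gamma> t] unfolding B_def .
  have W: "W > 0" using dom_velocity_positive[OF M g \<gamma> t] unfolding W_def .
  have "k * W > 0"
    using dom_velocity_positive[OF N h dom[OF \<gamma>] t]
    unfolding \<delta>t velocity_compose[OF M N mutually_inverse_smooth[OF inv] \<gamma>2 t] conf[OF v v] W_def .
  then have k: "k > 0" using W by (simp add: zero_less_mult_iff)
  have push: "pushforward M N \<phi> (\<gamma> t) (normal_accel M g \<gamma> t) =
     (\<lambda>d. (k * B / A) *\<^sub>R normal_accel N h (compose {0..1} \<phi> \<gamma>) t d)"
    unfolding radii_normal_accel conf[OF v v] A_def[symmetric] B_def[symmetric] W_def[symmetric] using W by simp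
  have "k * B = (k * B / A) * ((k * B / A) * A)"
    using conf[OF n n] unfolding B_def[symmetric] push metric_scale(1)[OF N h q n' tangent_space_lincomb[OF N n' n', of _ 0, simplified]]
      metric_scale(2)[OF N h q n' n'] A_def[symmetric] by simp
  then have "k * B / A = 1" using A B k by (simp add: field_simps)
  then show ?thesis unfolding push by (simp only: scaleR_one)
qed

end

text \<open>Any two orthogonal nonzero vectors are, up to positive factors, the velocity and the normal
  acceleration of a curve. Their images are orthogonal by \<open>radii_orthogonal\<close>, and a linear map that
  preserves orthogonality is conformal.\<close>

lemma radii_conformal_at:
  assumes p: "p \<in> topspace (mtop M)"
  shows "\<exists>k. \<forall>u\<in>tangent_space M p. \<forall>v\<in>tangent_space M p.
       h (\<phi> p) (pushforward M N \<phi> p u) (pushforward M N \<phi> p v) = k * g p u v"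
proof -
  obtain c where c: "c \<in> charts_at M p" using charts_at_ex[OF M p] by blast
  note q = smooth_map_topspace[OF mutually_inverse_smooth[OF inv] p]
  obtain d where d: "d \<in> charts_at N (\<phi> p)" using charts_at_ex[OF N q] by blast
  let ?G = "metric_coord M g c (snd c p)" and ?K = "metric_coord N h d (snd d (\<phi> p))"
  let ?DF = "frechet_derivative (local_rep c d \<phi>) (at (snd c p))"
  note gc = charts_atD(1)[OF c] chart_image_mem[OF c] and hd = charts_atD(1)[OF d] chart_image_mem[OF d]
  define H where "H a b = ?K (?DF a) (?DF b)" for a b
  have hH: "h (\<phi> p) (pushforward M N \<phi> p u) (pushforward M N \<phi> p v) = H (u c) (v c)"
    if "u \<in> tangent_space M p" "v \<in> tangent_space M p" for u v
    unfolding metric_eq_coord[OF N h d pushforward_tangent[OF M N mutually_inverse_smooth[OF inv] p that(1)] pushforward_tangent[OF M N mutually_inverse_smooth[OF inv] p that(2)]]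
      pushforward_apply[OF M N mutually_inverse_smooth[OF inv] c that(1) d] pushforward_apply[OF M N mutually_inverse_smooth[OF inv] c that(2) d] H_def ..
  note lin = local_rep_derivative_linear[OF M N mutually_inverse_smooth[OF inv] c d] and bl = metric_coord_bilinear[OF N h hd]
  have Hb: "bilinear H"
    unfolding bilinear_def H_def
    by (intro conjI allI linearI) (simp_all add: linear_add[OF lin] linear_scale[OF lin] bilinear_ladd[OF bl]
        bilinear_radd[OF bl] bilinear_lmul[OF bl] bilinear_rmul[OF bl])
  have Hs: "H a b = H b a" for a b unfolding H_def by (rule metric_coord_sym[OF N h hd])
  have orth: "H w u = 0" if uw: "w \<noteq> 0" "u \<noteq> 0" "?G w u = 0" for u w
  proof -
    obtain \<gamma> e where e: "e > 0" and \<gamma>: "\<gamma> \<in> curvature_radius_dom M g" and \<gamma>0: "\<gamma> 0 = p"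
      and v: "velocity M \<gamma> 0 c = e *\<^sub>R u" and a: "acceleration M g \<gamma> 0 c = e\<^sup>2 *\<^sub>R w"
      using curve_with_normal_acceleration[OF M g c uw(2,1,3)] by blast
    have t: "0 \<in> {0..1::real}" by simp
    note \<gamma>2 = curvature_radius_dom_C2[OF \<gamma>]
    note vt = velocity_tangent[OF M \<gamma>2 t, unfolded \<gamma>0] and at = acceleration_tangent[OF M g \<gamma>2 t, unfolded \<gamma>0]
      and nt = normal_accel_tangent[OF M g \<gamma>2 t, unfolded \<gamma>0]
    have "g p (acceleration M g \<gamma> 0) (velocity M \<gamma> 0) = 0"
      unfolding metric_eq_coord[OF M g c at vt] v a
      by (simp add: bilinear_lmul[OF metric_coord_bilinear[OF M g gc]] bilinear_rmul[OF metric_coord_bilinear[OF M g gc]] uw(3))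
    then have n: "normal_accel M g \<gamma> 0 c = e\<^sup>2 *\<^sub>R w"
      unfolding normal_accel_def perp_proj_def \<gamma>0 a by simp
    have "H (e\<^sup>2 *\<^sub>R w) (e *\<^sub>R u) = 0"
      using radii_orthogonal[OF \<gamma> t] unfolding \<gamma>0 hH[OF nt vt] n v .
    then show ?thesis using e by (simp add: bilinear_lmul[OF Hb] bilinear_rmul[OF Hb])
  qed
  obtain b :: 'e where b: "b \<in> Basis" using nonempty_Basis by blast
  have "H u v = H b b / ?G b b * ?G u v" for u v
    by (rule conformal_linear_algebra[OF metric_coord_bilinear[OF M g gc] metric_coord_sym[OF M g gc]
        metric_coord_pos[OF M g gc] Hb Hs orth nonzero_Basis[OF b]])
  then show ?thesis using hH metric_eq_coord[OF M g c] by metis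
qed

context
  fixes lam :: "'m \<Rightarrow> real"
  assumes conf: "\<And>p u v. p \<in> topspace (mtop M) \<Longrightarrow> u \<in> tangent_space M p \<Longrightarrow> v \<in> tangent_space M p \<Longrightarrow>
       h (\<phi> p) (pushforward M N \<phi> p u) (pushforward M N \<phi> p v) = lam p * g p u v"
    and dim: "DIM('e) > 1"
begin

context
  fixes p c d
  assumes c: "c \<in> charts_at M p" and d: "d \<in> charts_at N (\<phi> p)"
begin

text \<open>In coordinates the conformal factor is the quotient of two smooth functions: the squared lengths
  of a fixed nonzero coordinate vector for the pulled back metric and for \<open>g\<close>.\<close>

lemma conformal_factor_differentiable: "(\<lambda>y. lam (chart_inv c y)) differentiable (at (snd c p))"
proof -
  note cM = charts_atD(1)[OF c] and dN = charts_atD(1)[OF d]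
  let ?F = "local_rep c d \<phi>" and ?S = "local_dom c d \<phi>"
  obtain b :: 'e where b: "b \<in> Basis" using nonempty_Basis by blast
  have S: "snd c p \<in> ?S" "open ?S"
    using local_domI[of c M p d N \<phi>, OF c d] open_local_dom[OF M N mutually_inverse_smooth[OF inv] cM dN] by auto
  let ?num = "\<lambda>y. metric_coord N h d (?F y) (frechet_derivative ?F (at y) b) (frechet_derivative ?F (at y) b)"
  let ?den = "\<lambda>y. metric_coord M g c y b b"
  have bil: "bilinear (metric_coord N h d (?F y))" if "y \<in> ?S" for y
    by (rule metric_coord_local_rep_bilinear[OF M N h cM dN that])
  have der: "((\<lambda>z. metric_coord N h d z u v) has_derivative
      (\<lambda>w. frechet_derivative (\<lambda>z. metric_coord N h d z u v) (at (?F (snd c p))) w)) (at (?F (snd c p)))" for u v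
    unfolding local_rep_at[OF M c] by (rule metric_coord_deriv[OF N h dN chart_image_mem[OF d]])
  have num: "?num differentiable (at (snd c p))"
    unfolding differentiable_def
    by (rule exI) (rule bilinear_field_has_derivative[OF S(1) smooth_map_local_rep[OF mutually_inverse_smooth[OF inv] cM dN] S(2) bil der])
  have den: "?den differentiable (at (snd c p))"
    unfolding differentiable_def using metric_coord_deriv[OF M g cM chart_image_mem[OF c]] by blast
  have pos: "?den y > 0" if "y \<in> ?S" for y
    by (rule metric_coord_pos[OF M g cM _ nonzero_Basis[OF b]]) (use that in \<open>auto simp: local_dom_def\<close>)
  have "(\<lambda>y. ?num y / ?den y) differentiable (at (snd c p))"
    using pos[OF S(1)] by (intro differentiable_divide num den) simp
  then obtain D where D: "((\<lambda>y. ?num y / ?den y) has_derivative D) (at (snd c p))" unfolding differentiable_def by blast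
  have "((\<lambda>y. lam (chart_inv c y)) has_derivative D) (at (snd c p))"
  proof (rule has_derivative_transform_within_open[OF D S(2,1)])
    fix y assume y: "y \<in> ?S"
    have "?num y = lam (chart_inv c y) * ?den y"
      by (rule metric_coord_conformal[where h=h and lam=lam and g=g, OF M N mutually_inverse_smooth[OF inv] conf cM dN y])
    then show "?num y / ?den y = lam (chart_inv c y)" using pos[OF y] by simp
  qed
  then show ?thesis unfolding differentiable_def by blast
qed

text \<open>For a curve with velocity \<open>u\<close> the connection defect at \<open>u\<close> is the difference between the pushed
  forward acceleration and the acceleration of the image curve. The normal parts of the two agree, so
  only a multiple of the velocity remains: \<open>\<phi>\<close> preserves unparametrised geodesics.\<close>

lemma radii_defect_tangential:
  assumes u: "u \<noteq> 0"
  shows "\<exists>k. connection_defect (local_rep c d \<phi>) (snd c p) (christoffel M g c (snd c p)) (christoffel N h d (snd d (\<phi> p))) u u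
     = k *\<^sub>R frechet_derivative (local_rep c d \<phi>) (at (snd c p)) u"
proof -
  let ?E = "connection_defect (local_rep c d \<phi>) (snd c p) (christoffel M g c (snd c p)) (christoffel N h d (snd d (\<phi> p)))"
  let ?DF = "frechet_derivative (local_rep c d \<phi>) (at (snd c p))" and ?G = "metric_coord M g c (snd c p)"
  note gc = charts_atD(1)[OF c] chart_image_mem[OF c] and hd = charts_atD(1)[OF d] chart_image_mem[OF d]
  note lin = local_rep_derivative_linear[OF M N mutually_inverse_smooth[OF inv] c d]
  obtain w where w: "w \<noteq> 0" "?G w u = 0"
    using orthogonal_vector_exists[OF metric_coord_bilinear[OF M g gc] _ dim] metric_coord_pos[OF M g gc u] by (metis less_irrefl)
  obtain \<gamma> e where e: "e > 0" and \<gamma>: "\<gamma> \<in> curvature_radius_dom M g" and \<gamma>0: "\<gamma> 0 = p"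
    and v: "velocity M \<gamma> 0 c = e *\<^sub>R u" and a: "acceleration M g \<gamma> 0 c = e\<^sup>2 *\<^sub>R w"
    using curve_with_normal_acceleration[OF M g c u w] by blast
  have t: "0 \<in> {0..1::real}" by simp
  note \<gamma>2 = curvature_radius_dom_C2[OF \<gamma>]
  note vt = velocity_tangent[OF M \<gamma>2 t, unfolded \<gamma>0] and at = acceleration_tangent[OF M g \<gamma>2 t, unfolded \<gamma>0]
    and nt = normal_accel_tangent[OF M g \<gamma>2 t, unfolded \<gamma>0]
  let ?\<delta> = "compose {0..1} \<phi> \<gamma>"
  have conf0: "h (\<phi> (\<gamma> 0)) (pushforward M N \<phi> (\<gamma> 0) u) (pushforward M N \<phi> (\<gamma> 0) v) = lam p * g (\<gamma> 0) u v"
    if "u \<in> tangent_space M (\<gamma> 0)" "v \<in> tangent_space M (\<gamma> 0)" for u v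
    using conf[OF charts_at_topspace[OF M c]] that unfolding \<gamma>0 by blast
  have n0: "normal_accel N h ?\<delta> 0 = pushforward M N \<phi> (\<gamma> 0) (normal_accel M g \<gamma> 0)"
    by (rule radii_conformal_normal_accel[OF \<gamma> t conf0])
  have n: "normal_accel N h ?\<delta> 0 d = ?DF (normal_accel M g \<gamma> 0 c)"
    unfolding n0[unfolded \<gamma>0]
    by (rule pushforward_apply[OF M N mutually_inverse_smooth[OF inv] c nt d])
  obtain k where k: "normal_accel M g \<gamma> 0 c = acceleration M g \<gamma> 0 c - k *\<^sub>R velocity M \<gamma> 0 c"
    unfolding normal_accel_def perp_proj_def by blast
  obtain k' where k': "normal_accel N h ?\<delta> 0 d = acceleration N h ?\<delta> 0 d - k' *\<^sub>R velocity N ?\<delta> 0 d"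
    unfolding normal_accel_def perp_proj_def by blast
  have cd0: "c \<in> charts_at M (\<gamma> 0)" "d \<in> charts_at N (\<phi> (\<gamma> 0))" using c d \<gamma>0 by auto
  have acc: "acceleration N h ?\<delta> 0 d = ?DF (acceleration M g \<gamma> 0 c) - ?E (velocity M \<gamma> 0 c) (velocity M \<gamma> 0 c)"
    using acceleration_compose_coord[OF M N mutually_inverse_smooth[OF inv] \<gamma>2 t cd0, of h g] unfolding \<gamma>0 .
  have vel: "velocity N ?\<delta> 0 d = ?DF (velocity M \<gamma> 0 c)"
    using velocity_compose_coord[OF M N mutually_inverse_smooth[OF inv] \<gamma>2 t cd0] unfolding \<gamma>0 .
  have "?E (velocity M \<gamma> 0 c) (velocity M \<gamma> 0 c) = (k - k') *\<^sub>R ?DF (velocity M \<gamma> 0 c)"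
  proof -
    have "?DF (acceleration M g \<gamma> 0 c) - ?E (velocity M \<gamma> 0 c) (velocity M \<gamma> 0 c) - k' *\<^sub>R ?DF (velocity M \<gamma> 0 c)
        = ?DF (acceleration M g \<gamma> 0 c) - k *\<^sub>R ?DF (velocity M \<gamma> 0 c)"
      using n unfolding k k' acc vel linear_diff[OF lin] linear_scale[OF lin] .
    moreover have "y = r - z" if "x - y - z = x - r" for x y z r :: 'f
      using diff_left_imp_eq[OF that[unfolded diff_diff_eq]] by (simp add: eq_diff_eq)
    ultimately show ?thesis unfolding scaleR_diff_left by blast
  qed
  then have "?E (e *\<^sub>R u) (e *\<^sub>R u) = ((k - k') * e) *\<^sub>R ?DF u" unfolding v by (simp add: linear_scale[OF lin])
  moreover have "?E (e *\<^sub>R u) (e *\<^sub>R u) = (e * e) *\<^sub>R ?E u u"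
    by (rule connection_defect_scale[OF local_domI[of c M p d N \<phi>, OF c d] smooth_map_local_rep[OF mutually_inverse_smooth[OF inv] gc(1) hd(1)]
       open_local_dom[OF M N mutually_inverse_smooth[OF inv] gc(1) hd(1)] christoffel_bilinear[OF M g gc] christoffel_bilinear[OF N h hd]])
  ultimately have "(e * e) *\<^sub>R ?E u u = ((k - k') * e) *\<^sub>R ?DF u" by simp
  then have "(1 / (e * e)) *\<^sub>R ((e * e) *\<^sub>R ?E u u) = (1 / (e * e)) *\<^sub>R (((k - k') * e) *\<^sub>R ?DF u)" by metis
  then have "?E u u = (1 / (e * e) * ((k - k') * e)) *\<^sub>R ?DF u"
    using e by (simp only: scaleR_scaleR) simp
  then show ?thesis by (rule exI)
qed

text \<open>Fix \<open>w\<close> and a nonzero \<open>v\<close> orthogonal to it; such a \<open>v\<close> exists because the dimension exceeds \<open>1\<close>.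
  Put \<open>T a b c = H (E a b) (DF c)\<close>. Then \<open>T v v w = 0\<close> because \<open>E v v\<close> is a multiple of \<open>DF v\<close>. Two
  applications of \<open>conformal_defect\<close> give first \<open>T v w v = - T v v w = 0\<close> and then, by the symmetry of
  \<open>E\<close>, \<open>- D w * G v v = 2 * T w v v = 0\<close>.\<close>

lemma conformal_factor_derivative_zero: "((\<lambda>y. lam (chart_inv c y)) has_derivative (\<lambda>_. 0)) (at (snd c p))"
proof -
  obtain D where D: "((\<lambda>y. lam (chart_inv c y)) has_derivative D) (at (snd c p))"
    using conformal_factor_differentiable unfolding differentiable_def by blast
  let ?E = "connection_defect (local_rep c d \<phi>) (snd c p) (christoffel M g c (snd c p)) (christoffel N h d (snd d (\<phi> p)))"
  let ?DF = "frechet_derivative (local_rep c d \<phi>) (at (snd c p))" and ?G = "metric_coord M g c (snd c p)"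
  let ?H = "metric_coord N h d (snd d (\<phi> p))"
  note gc = charts_atD(1)[OF c] chart_image_mem[OF c] and hd = charts_atD(1)[OF d] chart_image_mem[OF d]
  note bl = metric_coord_bilinear[OF N h hd] and sym = metric_coord_sym[OF N h hd]
  have main: "?H (?E w u) (?DF v) + ?H (?DF u) (?E w v) = - D w * ?G u v" for w u v
    by (rule conformal_defect[OF M g N h mutually_inverse_smooth[OF inv] conf c d D])
  have comm: "?E w v = ?E v w" for w v by (rule defect_commute[OF M g N h mutually_inverse_smooth[OF inv] c d])
  have "D w = 0" for w
  proof (cases "w = 0")
    case True
    then show ?thesis using has_derivative_linear[OF D] linear_0 by blast
  next
    case False
    have Gw: "?G w w > 0" by (rule metric_coord_pos[OF M g gc False])
    obtain v where v: "v \<noteq> 0" "?G v w = 0"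
      using orthogonal_vector_exists[OF metric_coord_bilinear[OF M g gc] _ dim] Gw by (metis less_irrefl)
    have Gv: "?G v v > 0" by (rule metric_coord_pos[OF M g gc v(1)])
    obtain k where k: "?E v v = k *\<^sub>R ?DF v" using radii_defect_tangential[OF v(1)] by blast
    have "metric_coord N h d (local_rep c d \<phi> (snd c p)) (?DF v) (?DF w) = lam (chart_inv c (snd c p)) * ?G v w"
      by (rule metric_coord_conformal[where h=h and lam=lam and g=g, OF M N mutually_inverse_smooth[OF inv] conf gc(1) hd(1) local_domI[of c M p d N \<phi>, OF c d]])
    then have "?H (?DF v) (?DF w) = lam p * ?G v w"
      unfolding local_rep_at[OF M c] chart_inv_chart[OF M c] .
    then have "?H (?E v v) (?DF w) = 0" unfolding k bilinear_lmul[OF bl] v(2) by simp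
    then have "?H (?DF v) (?E v w) = 0" using main[of v v w] v(2) by simp
    then have "?H (?DF v) (?E w v) = 0" "?H (?E w v) (?DF v) = 0"
      using comm[of w v] sym[of "?E w v" "?DF v"] by simp_all
    then show ?thesis using main[of w v v] Gv by simp
  qed
  then have "D = (\<lambda>_. 0)" by blast
  then show ?thesis using D by simp
qed

end

lemma conformal_factor_locally_constant:
  assumes p: "p \<in> topspace (mtop M)"
  shows "\<exists>U. openin (mtop M) U \<and> p \<in> U \<and> (\<forall>q\<in>U. lam q = lam p)"
proof -
  obtain c where c: "c \<in> charts_at M p" using charts_at_ex[OF M p] by blast
  obtain d where d: "d \<in> charts_at N (\<phi> p)" using charts_at_ex[OF N smooth_map_topspace[OF mutually_inverse_smooth[OF inv] p]] by blast
  note cM = charts_atD[OF c] and dN = charts_atD[OF d]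
  let ?S = "local_dom c d \<phi>"
  obtain r where r: "r > 0" "ball (snd c p) r \<subseteq> ?S"
    using open_local_dom[OF M N mutually_inverse_smooth[OF inv] cM(1) dN(1)] local_domI[of c M p d N \<phi>, OF c d] open_contains_ball by blast
  have z: "((\<lambda>y. lam (chart_inv c y)) has_derivative (\<lambda>_. 0)) (at y within ball (snd c p) r)" if "y \<in> ball (snd c p) r" for y
  proof -
    have "y \<in> ?S" using r(2) that by blast
    then obtain q where q: "c \<in> charts_at M q" "d \<in> charts_at N (\<phi> q)" "y = snd c q"
      using cM(1) dN(1) by (auto simp: local_dom_def charts_at_def)
    show ?thesis unfolding q(3) by (rule has_derivative_at_withinI[OF conformal_factor_derivative_zero[OF q(1,2)]])
  qed
  obtain k where k: "\<And>y. y \<in> ball (snd c p) r \<Longrightarrow> lam (chart_inv c y) = k"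
    using has_derivative_zero_constant[OF convex_ball z] by blast
  let ?U = "{q \<in> fst c. snd c q \<in> ball (snd c p) r}"
  have "homeomorphic_map (subtopology (mtop M) (fst c)) (top_of_set (snd c ` fst c)) (snd c)"
    using atlas_chart[OF M cM(1)] unfolding is_chart_def by blast
  then have "continuous_map (subtopology (mtop M) (fst c)) (top_of_set (snd c ` fst c)) (snd c)"
    by (rule homeomorphic_imp_continuous_map)
  then have cont: "continuous_map (subtopology (mtop M) (fst c)) euclidean (snd c)"
    using continuous_map_into_fulltopology by blast
  have "openin (subtopology (mtop M) (fst c)) {q \<in> topspace (subtopology (mtop M) (fst c)). snd c q \<in> ball (snd c p) r}"
    by (rule openin_continuous_map_preimage[OF cont]) simp
  moreover have "topspace (subtopology (mtop M) (fst c)) = fst c"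
    using openin_subset[OF chart_openin[OF M cM(1)]] by auto
  ultimately have "openin (subtopology (mtop M) (fst c)) ?U" by (simp only:)
  then have "openin (mtop M) ?U" using chart_openin[OF M cM(1)] openin_trans_full by blast
  moreover have "p \<in> ?U" using cM(2) r(1) by simp
  moreover have "lam q = lam p" if "q \<in> ?U" for q
    using k[of "snd c q"] k[of "snd c p"] that r(1) chart_inv_chart[OF M charts_atI[OF cM(1), of q]] chart_inv_chart[OF M c] by simp
  ultimately show ?thesis by blast
qed

end

end

lemma connected_space_locally_constant:
  assumes X: "connected_space X"
    and loc: "\<And>p. p \<in> topspace X \<Longrightarrow> \<exists>U. openin X U \<and> p \<in> U \<and> (\<forall>q\<in>U. f q = f p)"
    and "p \<in> topspace X" "q \<in> topspace X"
  shows "f p = f q"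
proof -
  let ?A = "{x \<in> topspace X. f x = f p}" and ?B = "{x \<in> topspace X. f x \<noteq> f p}"
  have "openin X ?A" 
    unfolding openin_subopen[of X ?A] using loc openin_subset by (smt (verit) mem_Collect_eq subset_eq)
  moreover have "openin X ?B"
    unfolding openin_subopen[of X ?B] using loc openin_subset by (smt (verit) mem_Collect_eq subset_eq)
  moreover have "topspace X \<subseteq> ?A \<union> ?B" "?A \<inter> ?B = {}" "?A \<noteq> {}" using assms(3) by auto
  ultimately have "?B = {}" using X unfolding connected_space_def by blast
  then show ?thesis using assms(4) by auto
qed

lemma same_curvature_radii_imp_homothetic:
  fixes M :: "('m, 'e::euclidean_space) manifold" and N :: "('n, 'f::euclidean_space) manifold"
  assumes Mg: "riemannian_manifold M g" and Nh: "riemannian_manifold N h"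
    and conn: "connected_space (mtop M)" and dim: "DIM('e) > 1" and same: "same_curvature_radii M g N h"
  shows "homothetic M g N h"
proof -
  have M: "smooth_manifold M" "riemannian_metric M g" and N: "smooth_manifold N" "riemannian_metric N h"
    using Mg Nh unfolding riemannian_manifold_def by auto
  obtain \<phi> where \<phi>: "diffeomorphism M N \<phi>"
    and img: "(\<lambda>\<gamma>. compose {0..1} \<phi> \<gamma>) ` curvature_radius_dom M g = curvature_radius_dom N h"
    and rad: "\<And>\<gamma>. \<gamma> \<in> curvature_radius_dom M g \<Longrightarrow> curvature_radius N h (compose {0..1} \<phi> \<gamma>) =
        (\<lambda>t\<in>{0..1}. pushforward M N \<phi> (\<gamma> t) (curvature_radius M g \<gamma> t))"
    using same unfolding same_curvature_radii_def by auto
  note inv = diffeomorphism_mutually_inverse[OF \<phi>]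
  have dom: "compose {0..1} \<phi> \<gamma> \<in> curvature_radius_dom N h" if "\<gamma> \<in> curvature_radius_dom M g" for \<gamma>
    using img that by blast
  have rad': "curvature_radius N h (compose {0..1} \<phi> \<gamma>) t = pushforward M N \<phi> (\<gamma> t) (curvature_radius M g \<gamma> t)"
    if "\<gamma> \<in> curvature_radius_dom M g" "t \<in> {0..1}" for \<gamma> t
    using rad[OF that(1)] that(2) by simp
  note ctx = M N inv dom rad'
  have point: "\<exists>k. \<forall>u\<in>tangent_space M p. \<forall>v\<in>tangent_space M p.
       h (\<phi> p) (pushforward M N \<phi> p u) (pushforward M N \<phi> p v) = k * g p u v" if "p \<in> topspace (mtop M)" for p
    by (rule radii_conformal_at[OF ctx that])
  have "\<forall>p. \<exists>k. p \<in> topspace (mtop M) \<longrightarrow> (\<forall>u\<in>tangent_space M p. \<forall>v\<in>tangent_space M p.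
       h (\<phi> p) (pushforward M N \<phi> p u) (pushforward M N \<phi> p v) = k * g p u v)"
    using point by blast
  then obtain lam where "\<forall>p. p \<in> topspace (mtop M) \<longrightarrow> (\<forall>u\<in>tangent_space M p. \<forall>v\<in>tangent_space M p.
       h (\<phi> p) (pushforward M N \<phi> p u) (pushforward M N \<phi> p v) = lam p * g p u v)"
    by (rule choice[THEN exE])
  then have conf: "h (\<phi> p) (pushforward M N \<phi> p u) (pushforward M N \<phi> p v) = lam p * g p u v"
    if "p \<in> topspace (mtop M)" "u \<in> tangent_space M p" "v \<in> tangent_space M p" for p u v
    using that by blast
  have const: "lam p = lam q" if "p \<in> topspace (mtop M)" "q \<in> topspace (mtop M)" for p q
    by (rule connected_space_locally_constant[OF conn conformal_factor_locally_constant[OF ctx conf dim] that])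
  show ?thesis
  proof (cases "topspace (mtop M) = {}")
    case True
    then show ?thesis unfolding homothetic_def using \<phi> by (intro exI[of _ \<phi>] exI[of _ 1]) simp
  next
    case False
    then obtain p where p: "p \<in> topspace (mtop M)" by blast
    obtain c where c: "c \<in> charts_at M p" using charts_at_ex[OF M(1) p] by blast
    obtain b :: 'e where b: "b \<in> Basis" using nonempty_Basis by blast
    let ?e = "coord_vec M c p b"
    have e: "?e \<in> tangent_space M p" by (rule coord_vec_tangent[OF M(1) c])
    have e0: "?e \<noteq> (\<lambda>_. 0)" using coord_vec_self[OF M(1) c, of b] nonzero_Basis[OF b] by auto
    have push0: "pushforward M N \<phi> p ?e \<noteq> (\<lambda>_. 0)" by (rule pushforward_nonzero[OF M(1) N(1) inv p e e0])
    have s\<phi>: "smooth_map M N \<phi>" using \<phi> unfolding diffeomorphism_def by blast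
    have "lam p * g p ?e ?e > 0"
      using metric_positive[OF N smooth_map_topspace[OF s\<phi> p] pushforward_tangent[OF M(1) N(1) s\<phi> p e] push0]
      unfolding conf[OF p e e] .
    moreover have "g p ?e ?e > 0" by (rule metric_positive[OF M p e e0])
    ultimately have "lam p > 0" by (simp add: zero_less_mult_iff)
    then show ?thesis
      unfolding homothetic_def using \<phi> conf const[OF _ p]
      by (intro exI[of _ \<phi>] exI[of _ "lam p"] conjI ballI) simp_all
  qed
qed

theorem theorem1p2:
  fixes M :: "('m, 'e::euclidean_space) manifold" and g :: "('m, 'e) metric"
    and N :: "('n, 'f::euclidean_space) manifold" and h :: "('n, 'f) metric"
  assumes "riemannian_manifold M g" and "riemannian_manifold N h"
    and "connected_space (mtop M)" and "connected_space (mtop N)"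
    and "DIM('e) > 1" and "DIM('f) > 1"
  shows "same_curvature_radii M g N h \<longleftrightarrow> homothetic M g N h"
proof
  show "homothetic M g N h" if "same_curvature_radii M g N h"
    by (rule same_curvature_radii_imp_homothetic[OF assms(1-3,5) that])
  show "same_curvature_radii M g N h" if "homothetic M g N h"
    by (rule homothetic_imp_same_curvature_radii[OF assms(1,2) that])
qed

end
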